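(* Let $N\ge 2$, let $\Omega\subset B_+$ be a domain as in the setting, and let $u\in W^{1,\infty}(\Omega)\cap W^{2,2}(\Omega)$ be the solution of the mixed problem $\Delta u=N$ in $\Omega$, $u=0$ on $\Sigma$, $u_\nu=u$ on $T$. If $u_\nu=R$ on $\Sigma$ for a constant $R$, then $$R=N\,\frac{\int_\Omega x_N\,dx}{\int_\Sigma x_N\,dS_x}=\frac{N\,|\Omega|}{|\Sigma|}\,\frac{c_N^\Omega}{c_N^\Sigma},$$ where $c_N^E$ denotes the $N$-th coordinate of the center of mass of a set $E$.
   Context: Setting. $B$ is the open unit ball of $\mathbb{R}^N$ centered at the origin, $S=\partial B$, $B_+=\{x=(x_1,\dots,x_N)\in B: x_N>0\}$. $\Omega\subset B_+$ is a bounded domain (open connected set) whose boundary $\Gamma=\partial\Omega$ is the union of $\overline\Sigma$ and $T=\Gamma\setminus\overline\Sigma$, where $\Sigma$ is a smooth hypersurface contained in $B_+$, $T\subset S$, and $\overline T$ meets $\overline\Sigma$ at a common $(N-2)$-dimensional submanifold $\Lambda=\overline\Sigma\cap\overline T$ of $S$. $\nu$ is the outward unit normal to $\Gamma$ (so $\nu(x)=x$ on $T$), $u_\nu$ the derivative in the direction $\nu$, and $dS_x$ surface measure. The mixed problem is known to have a unique solution $u$ that is smooth in $\overline\Omega\setminus\Lambda$ and in $C^{0,\gamma}(\overline\Omega)$ for some $\gamma\in(0,1)$; the additional regularity $u\in W^{1,\infty}(\Omega)\cap W^{2,2}(\Omega)$ is an assumption. Measures and centers of mass are taken with respect to Lebesgue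 measure for $\Omega$ and surface measure for $\Sigma$. *)

theory Defs
  imports "HOL-Analysis.Analysis"
begin

text \<open>Smooth means \<open>C\<^sup>\<infinity>\<close> throughout. The set \<open>U\<close> in \<open>Ck_on k U f\<close> is meant to be open.\<close>

primrec Ck_on :: "nat \<Rightarrow> 'a::euclidean_space set \<Rightarrow> ('a \<Rightarrow> 'b::real_normed_vector) \<Rightarrow> bool" where
  "Ck_on 0 U f \<longleftrightarrow> continuous_on U f"
| "Ck_on (Suc k) U f \<longleftrightarrow> (\<forall>x\<in>U. f differentiable (at x)) \<and>
     (\<forall>e\<in>Basis. Ck_on k U (\<lambda>x. frechet_derivative f (at x) e))"

text \<open>On a set that need not be open, smoothness is existence of local smooth extensions; on
  \<open>closure \<Omega> - \<Lambda>\<close> this is smoothness up to the boundary part \<open>frontier \<Omega> - \<Lambda>\<close>.\<close>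

definition smooth_on :: "'a::euclidean_space set \<Rightarrow> ('a \<Rightarrow> 'b::real_normed_vector) \<Rightarrow> bool" where
  "smooth_on A f \<longleftrightarrow> (\<forall>p\<in>A. \<exists>U g. open U \<and> p \<in> U \<and> (\<forall>k. Ck_on k U g) \<and>
     (\<forall>x\<in>A \<inter> U. g x = f x))"

text \<open>Embedded submanifold of dimension \<open>d\<close>, without boundary, by local flattening
  diffeomorphisms. The empty set is included, for every \<open>d\<close>.\<close>

definition smooth_submanifold :: "nat \<Rightarrow> 'a::euclidean_space set \<Rightarrow> bool" where
  "smooth_submanifold d M \<longleftrightarrow> (\<forall>p\<in>M. \<exists>U V \<Phi> \<Psi> L.
     open U \<and> p \<in> U \<and> open (V :: 'a set) \<and> homeomorphism U V \<Phi> \<Psi> \<and>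
     smooth_on U \<Phi> \<and> smooth_on V \<Psi> \<and>
     subspace L \<and> dim L = d \<and> \<Phi> ` (M \<inter> U) = V \<inter> L)"

text \<open>Near \<open>x\<close> the open set \<open>\<Omega>\<close> is a sublevel set of a smooth function with nonzero gradient, so it
  lies on one side of a smooth boundary; \<open>v\<close> is the normalized gradient.\<close>

definition outward_unit_normal :: "'a::euclidean_space set \<Rightarrow> 'a \<Rightarrow> 'a \<Rightarrow> bool" where
  "outward_unit_normal \<Omega> x v \<longleftrightarrow> (\<exists>U \<rho> g. open U \<and> x \<in> U \<and> smooth_on U (\<rho> :: 'a \<Rightarrow> real) \<and>
     \<rho> x = 0 \<and> \<Omega> \<inter> U = {y \<in> U. \<rho> y < 0} \<and> GDERIV \<rho> x :> g \<and> g \<noteq> 0 \<and> v = sgn g)"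

text \<open>Derivative at a boundary point \<open>x\<close> in the outward direction \<open>v\<close>, taken from inside the domain:
  only \<open>u (x + t v)\<close> with \<open>t \<le> 0\<close> enters.\<close>

definition has_normal_derivative :: "('a::euclidean_space \<Rightarrow> real) \<Rightarrow> 'a \<Rightarrow> 'a \<Rightarrow> real \<Rightarrow> bool" where
  "has_normal_derivative u x v d \<longleftrightarrow> ((\<lambda>t. u (x + t *\<^sub>R v)) has_real_derivative d) (at_left 0)"

definition laplacian :: "('a::euclidean_space \<Rightarrow> real) \<Rightarrow> 'a \<Rightarrow> real" where
  "laplacian u x =
     (\<Sum>e\<in>Basis. frechet_derivative (\<lambda>y. frechet_derivative u (at y) e) (at x) e)"

definition holder_on :: "real \<Rightarrow> 'a::metric_space set \<Rightarrow> ('a \<Rightarrow> real) \<Rightarrow> bool" where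
  "holder_on \<gamma> A u \<longleftrightarrow> (\<exists>C. \<forall>x\<in>A. \<forall>y\<in>A. \<bar>u x - u y\<bar> \<le> C * dist x y powr \<gamma>)"

text \<open>Lebesgue and Sobolev spaces, for exponents \<open>1 \<le> p \<le> \<infinity>\<close>; functions are representatives, and
  only their values on the open set \<open>\<Omega>\<close> matter.\<close>

definition Lp_space :: "ennreal \<Rightarrow> 'a::euclidean_space set \<Rightarrow> ('a \<Rightarrow> real) \<Rightarrow> bool" where
  "Lp_space p \<Omega> f \<longleftrightarrow> f \<in> borel_measurable (lebesgue_on \<Omega>) \<and>
     (if p = \<infinity> then \<exists>C. AE x in lebesgue_on \<Omega>. \<bar>f x\<bar> \<le> C
      else integrable (lebesgue_on \<Omega>) (\<lambda>x. \<bar>f x\<bar> powr enn2real p))"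

definition test_function :: "'a::euclidean_space set \<Rightarrow> ('a \<Rightarrow> real) \<Rightarrow> bool" where
  "test_function \<Omega> \<phi> \<longleftrightarrow> smooth_on UNIV \<phi> \<and>
     compact (closure {x. \<phi> x \<noteq> 0}) \<and> closure {x. \<phi> x \<noteq> 0} \<subseteq> \<Omega>"

definition weak_derivative ::
    "'a::euclidean_space set \<Rightarrow> 'a \<Rightarrow> ('a \<Rightarrow> real) \<Rightarrow> ('a \<Rightarrow> real) \<Rightarrow> bool" where
  "weak_derivative \<Omega> e u g \<longleftrightarrow> (\<forall>\<phi>. test_function \<Omega> \<phi> \<longrightarrow>
     (LINT x|lebesgue_on \<Omega>. u x * frechet_derivative \<phi> (at x) e) =
     - (LINT x|lebesgue_on \<Omega>. g x * \<phi> x))"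

primrec sobolev_space :: "nat \<Rightarrow> ennreal \<Rightarrow> 'a::euclidean_space set \<Rightarrow> ('a \<Rightarrow> real) \<Rightarrow> bool" where
  "sobolev_space 0 p \<Omega> u \<longleftrightarrow> Lp_space p \<Omega> u"
| "sobolev_space (Suc k) p \<Omega> u \<longleftrightarrow> Lp_space p \<Omega> u \<and>
     (\<forall>e\<in>Basis. \<exists>g. weak_derivative \<Omega> e u g \<and> sobolev_space k p \<Omega> g)"

text \<open>Hausdorff measure, normalized to agree with Lebesgue measure on \<open>d\<close>-dimensional Euclidean
  space. Covering sets are required to be bounded because \<^const>\<open>diameter\<close> is unspecified otherwise;
  the empty set is treated separately so that \<open>d = 0\<close> gives the counting measure.\<close>

definition hausdorff_content :: "nat \<Rightarrow> real \<Rightarrow> 'a::metric_space set \<Rightarrow> ennreal" where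
  "hausdorff_content d \<delta> A =
     (INF C\<in>{C :: nat \<Rightarrow> 'a set. A \<subseteq> (\<Union>i. C i) \<and> (\<forall>i. bounded (C i) \<and> diameter (C i) \<le> \<delta>)}.
        \<Sum>i. if C i = {} then 0 else ennreal (unit_ball_vol (real d) * (diameter (C i) / 2) ^ d))"

definition hausdorff_outer_measure :: "nat \<Rightarrow> 'a::metric_space set \<Rightarrow> ennreal" where
  "hausdorff_outer_measure d A = (SUP \<delta>\<in>{0<..}. hausdorff_content d \<delta> A)"

definition hausdorff_measure :: "nat \<Rightarrow> 'a::metric_space measure" where
  "hausdorff_measure d = measure_of UNIV (sets borel) (hausdorff_outer_measure d)"

definition surface_measure :: "'a::euclidean_space measure" where
  "surface_measure = hausdorff_measure (DIM('a) - 1)"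

text \<open>Center of mass of the whole space of \<open>M\<close> with respect to \<open>M\<close>.\<close>

definition center_of_mass :: "'a::euclidean_space measure \<Rightarrow> 'a" where
  "center_of_mass M = (1 / measure M (space M)) *\<^sub>R (LINT x|M. x)"

text \<open>The index \<open>n\<close> plays the role of the last coordinate.\<close>

definition upper_half_ball :: "'n::finite \<Rightarrow> (real^'n) set" where
  "upper_half_ball n = {x \<in> ball 0 1. x $ n > 0}"

end

theory Submission
  imports Defs
begin

text \<open>Apply Green's identity to \<open>u\<close> and a weight \<open>w(x) = b \<bullet> x + k (1 + |x|\<^sup>2)/2\<close>. On the unit sphere the
  radial derivative of \<open>w\<close> equals \<open>w\<close>, so the flux \<open>w u\<^sub>\<nu> - u w\<^sub>\<nu>\<close> vanishes on \<open>T\<close>, while it is \<open>R w\<close> on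
  \<open>\<Sigma>\<close>. The weight \<open>w = x\<^sub>N\<close> is harmonic and gives \<open>R \<integral>\<^sub>\<Sigma> x\<^sub>N = N \<integral>\<^sub>\<Omega> x\<^sub>N\<close>; the weight
  \<open>(1 + |x|\<^sup>2)/2 \<ge> 1/2\<close> shows that \<open>\<Sigma>\<close> has finite area.

  The edge \<open>\<Lambda>\<close> is a compact null set for \<open>(N-1)\<close>-dimensional Hausdorff measure, so it can be cut out by
  functions whose gradients are small in \<open>L\<^sup>1\<close>; this is harmless because \<open>\<nabla>u\<close> is bounded. Away from \<open>\<Lambda>\<close>
  the identity is local. In coordinates adapted to the normal at a point, the boundary is a graph with
  slope at most \<open>\<epsilon>\<close>, hence both the flux integral and the Hausdorff measure agree with Lebesgue measure
  on the tangent plane up to factors \<open>(1 + \<epsilon>)\<^sup>N\<close>, and no area formula is needed. That Hausdorff measure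
  is correctly normalized is the isodiametric inequality, proved by Steiner symmetrization.\<close>

text \<open>Every chart compares the two sides only approximately, yet the final identity is exact.
  The error is therefore measured by \<delta> times the surface flux itself
  (\<open>flux_estimate\<close>). Such an error is additive in the cutoff, so local estimates glue
  with the same \<delta>, and \<delta> is arbitrary. This is why the weights have to be nonnegative
  on \<Sigma>.

  Finite area of \<Sigma> is not assumed, and without it a surface integral could be the default
  value 0 of a nonintegrable function. This forces an order. With cutoffs still present, the weight
  \<open>x $ n\<close> gives R \<noteq> 0, because a positive volume integral is the limit of R
  times the cutoff fluxes. Then the second weight gives finite area, and only then can the cutoffs
  be removed on \<Sigma> by dominated convergence.

  Boundedness of the classical gradient is read off from the weak one: u is smooth inside \<Omega>,
  so exceeding the essential bound at one point would mean exceeding it on an open set, which a test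
  function detects.

  The surface measure comes from \<open>measure_of\<close> applied to an outer measure, so even its
  additivity on Borel sets has to be established.\<close>

section \<open>Metric outer measures and Caratheodory's criterion\<close>

definition separated_sets :: "'a::metric_space set \<Rightarrow> 'a set \<Rightarrow> bool" where
  "separated_sets A B \<longleftrightarrow> (\<exists>\<eta>>0. \<forall>a\<in>A. \<forall>b\<in>B. \<eta> \<le> dist a b)"

text \<open>Additivity is demanded only for sets with a positive gap, and only as an inequality; the
  opposite one follows from countable subadditivity.\<close>

locale metric_outer_measure =
  fixes f :: "'a::metric_space set \<Rightarrow> ennreal"
  assumes empty [simp]: "f {} = 0"
    and mono: "A \<subseteq> B \<Longrightarrow> f A \<le> f B"
    and countable_subadditive: "f (\<Union>i. S i) \<le> (\<Sum>i::nat. f (S i))"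
    and separated_add: "separated_sets A B \<Longrightarrow> f A + f B \<le> f (A \<union> B)"
begin

lemma outer_measure_space: "outer_measure_space UNIV f"
  unfolding outer_measure_space_def positive_def increasing_def countably_subadditive_def
  using mono countable_subadditive by auto

lemma subadditive_Un: "f (A \<union> B) \<le> f A + f B"
proof -
  have "f (\<Union>i. binaryset A B i) \<le> (\<Sum>i. f (binaryset A B i))"
    by (rule countable_subadditive)
  also have "\<dots> = f A + f B"
    using binaryset_sums[of f A B] by (simp add: sums_iff)
  finally show ?thesis by (simp add: UN_binaryset_eq)
qed

text \<open>Finitely many gaps have a positive minimum, so the union of the first sets keeps a gap
  to the next one and induction applies.\<close>

lemma sum_separated_le:
  assumes "\<And>j k. j < k \<Longrightarrow> k < (n::nat) \<Longrightarrow> separated_sets (A j) (A k)"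
  shows "(\<Sum>j<n. f (A j)) \<le> f (\<Union>j<n. A j)"
  using assms
proof (induction n)
  case (Suc n)
  have "separated_sets (\<Union>j<n. A j) (A n)"
  proof -
    have "\<exists>\<eta>. \<forall>j<n. \<eta> j > 0 \<and> (\<forall>a\<in>A j. \<forall>b\<in>A n. \<eta> j \<le> dist a b)"
      using Suc.prems[of _ n] unfolding separated_sets_def by (metis lessI)
    then obtain \<eta> where \<eta>: "\<And>j. j < n \<Longrightarrow> \<eta> j > 0"
      "\<And>j a b. j < n \<Longrightarrow> a \<in> A j \<Longrightarrow> b \<in> A n \<Longrightarrow> \<eta> j \<le> dist a b" by blast
    \<comment> \<open>The extra element 1 keeps the minimum defined when
      \<open>n = 0\<close>.\<close>
    have "0 < Min (insert (1::real) (\<eta> ` {..<n}))" using \<eta>(1) by (auto simp: Min_gr_iff)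
    moreover have "Min (insert (1::real) (\<eta> ` {..<n})) \<le> dist a b"
      if "a \<in> (\<Union>j<n. A j)" "b \<in> A n" for a b
    proof -
      obtain j where j: "j < n" "a \<in> A j" using \<open>a \<in> _\<close> by auto
      have "Min (insert (1::real) (\<eta> ` {..<n})) \<le> \<eta> j" using j by (intro Min_le) auto
      with \<eta>(2)[OF j \<open>b \<in> A n\<close>] show ?thesis by linarith
    qed
    ultimately show ?thesis unfolding separated_sets_def by blast
  qed
  then have "f (\<Union>j<n. A j) + f (A n) \<le> f ((\<Union>j<n. A j) \<union> A n)" by (rule separated_add)
  moreover have "(\<Sum>j<n. f (A j)) \<le> f (\<Union>j<n. A j)" using Suc by auto
  moreover have "(\<Union>j<n. A j) \<union> A n = (\<Union>j<Suc n. A j)" by (auto simp: less_Suc_eq)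
  ultimately show ?case by (simp add: add_mono order_trans[OF add_right_mono])
qed simp

text \<open>The shells \<open>{x \<in> X. 1/(k+2) \<le> infdist x F < 1/(k+1)}\<close> with \<open>k\<close> of one parity are pairwise
  separated, so the sum of their measures is finite and its tails vanish.\<close>

lemma closed_splits:
  assumes "closed F"
  shows "f (X \<inter> F) + f (X - F) \<le> f X"
proof (cases "F = {} \<or> f X = \<infinity>")
  case True
  then show ?thesis by auto
next
  case False
  then have F: "F \<noteq> {}" and fin: "f X < \<infinity>" by (auto simp: top.not_eq_extremum)
  define Y where "Y n = {x \<in> X. 1 / (real n + 1) \<le> infdist x F}" for n
  define S where "S k = {x \<in> X. 1 / (real k + 2) \<le> infdist x F \<and> infdist x F < 1 / (real k + 1)}" for k
  have infd: "infdist x F \<le> infdist y F + dist x y" for x y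
    by (rule infdist_triangle)
  have sepY: "separated_sets (X \<inter> F) (Y n)" for n
    unfolding separated_sets_def
  proof (intro exI[of _ "1 / (real n + 1)"] conjI ballI)
    fix a b assume "a \<in> X \<inter> F" "b \<in> Y n"
    then show "1 / (real n + 1) \<le> dist a b"
      using infdist_le[of a F b] by (auto simp: Y_def dist_commute)
  qed simp
  have sepS: "separated_sets (S k) (S j)" if "k + 2 \<le> j" for j k
    unfolding separated_sets_def
  proof (intro exI[of _ "1 / (real k + 2) - 1 / (real k + 3)"] conjI ballI)
    have "1 / (real k + 3) < 1 / (real k + 2)" by (rule frac_less2) auto
    then show "0 < 1 / (real k + 2) - 1 / (real k + 3)" by simp
    fix a b assume "a \<in> S k" "b \<in> S j"
    then have "1 / (real k + 2) \<le> infdist a F" "infdist b F < 1 / (real j + 1)" by (auto simp: S_def)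
    moreover have "1 / (real j + 1) \<le> 1 / (real k + 3)" using that by (intro divide_left_mono) auto
    ultimately show "1 / (real k + 2) - 1 / (real k + 3) \<le> dist a b" using infd[of a b] by linarith
  qed
  have bound: "(\<Sum>j<n. f (S (2 * j + i))) \<le> f X" for n i
  proof -
    have "(\<Sum>j<n. f (S (2 * j + i))) \<le> f (\<Union>j<n. S (2 * j + i))"
      by (rule sum_separated_le) (auto intro!: sepS)
    also have "\<dots> \<le> f X" by (rule mono) (auto simp: S_def)
    finally show ?thesis .
  qed
  have half: "(\<Sum>j. f (S (2 * j + i))) \<le> f X" for i
    by (rule suminf_le_const) (auto intro: bound)
  have eo: "(\<Sum>k<2 * n. f (S k)) = (\<Sum>j<n. f (S (2 * j))) + (\<Sum>j<n. f (S (2 * j + 1)))" for n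
    by (induction n) (auto simp: algebra_simps)
  have "(\<Sum>k<n. f (S k)) \<le> f X + f X" for n
  proof -
    have "(\<Sum>k<n. f (S k)) \<le> (\<Sum>k<2 * n. f (S k))" by (rule sum_mono2) auto
    also have "\<dots> \<le> f X + f X" unfolding eo using bound[of 0 n] bound[of 1 n] by (intro add_mono) auto
    finally show ?thesis .
  qed
  then have "(\<Sum>k. f (S k)) \<le> f X + f X" by (intro suminf_le_const) auto
  then have sfin: "(\<Sum>k. f (S k)) \<noteq> \<infinity>" using fin by (auto simp: top_unique)
  have tail: "(\<lambda>n. \<Sum>k. f (S (k + n))) \<longlonglongrightarrow> 0"
  proof -
    have nn: "(\<Sum>k. f (S (k + n))) = (\<Sum>k. f (S k)) - (\<Sum>k<n. f (S k))" for n
    proof -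
      have "(\<Sum>k. f (S k)) = (\<Sum>k. f (S (k + n))) + (\<Sum>k<n. f (S k))"
        by (rule suminf_offset) auto
      moreover have "(\<Sum>k<n. f (S k)) \<noteq> \<infinity>"
        using sfin sum_le_suminf[of "\<lambda>k. f (S k)" "{..<n}"]
        by (metis infinity_ennreal_def summableI top_unique finite_lessThan zero_le)
      ultimately show ?thesis by simp
    qed
    have "(\<lambda>n. (\<Sum>k. f (S k)) - (\<Sum>k<n. f (S k))) \<longlonglongrightarrow> (\<Sum>k. f (S k)) - (\<Sum>k. f (S k))"
      using sfin by (intro tendsto_diff_ennreal_general summable_LIMSEQ tendsto_const) auto
    then show ?thesis unfolding nn using sfin by simp
  qed
  \<comment> \<open>\<open>X - F\<close> consists of \<open>Y n\<close>, which has a gap to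
    \<open>F\<close>, and of the shells from index \<open>n\<close> on, which cost no more than the
    tail of a convergent series.\<close>
  have main: "f (X \<inter> F) + f (X - F) \<le> f X + (\<Sum>k. f (S (k + n)))" for n
  proof -
    have "X - F \<subseteq> Y n \<union> (\<Union>k. S (k + n))"
    proof
      fix x assume x: "x \<in> X - F"
      then have pos: "0 < infdist x F"
        using assms F in_closed_iff_infdist_zero[of F x] infdist_nonneg[of x F] by auto
      show "x \<in> Y n \<union> (\<Union>k. S (k + n))"
      proof (cases "1 / (real n + 1) \<le> infdist x F")
        case True then show ?thesis using x by (auto simp: Y_def)
      next
        case less: False
        define P where "P j \<longleftrightarrow> 1 / (real (j + n) + 2) \<le> infdist x F" for j
        obtain m :: nat where m: "1 / infdist x F < real m" using reals_Archimedean2 by blast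
        have "P m" unfolding P_def
        proof -
          have "1 < real m * infdist x F" using m pos by (simp add: field_simps)
          also have "\<dots> \<le> (real (m + n) + 2) * infdist x F" using pos by (intro mult_right_mono) auto
          finally show "1 / (real (m + n) + 2) \<le> infdist x F" by (simp add: field_simps)
        qed
        \<comment> \<open>\<open>P j\<close> is the lower bound that defines the shell
          \<open>j + n\<close>; failure of \<open>P\<close> one index earlier, or the case
          assumption if \<open>j = 0\<close>, is its upper bound.\<close>
        define j where "j = (LEAST j. P j)"
        have Pj: "P j" unfolding j_def by (rule LeastI[of P m]) fact
        have "infdist x F < 1 / (real (j + n) + 1)"
        proof (cases j)
          case 0 then show ?thesis using less by simp
        next
          case (Suc i)
          then have "\<not> P i" using not_less_Least[of i P] unfolding j_def by auto
          then show ?thesis using Suc by (simp add: P_def add_ac)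
        qed
        then have "x \<in> S (j + n)" using Pj x by (auto simp: S_def P_def)
        then show ?thesis by blast
      qed
    qed
    then have "f (X - F) \<le> f (Y n \<union> (\<Union>k. S (k + n)))" by (rule mono)
    also have "\<dots> \<le> f (Y n) + f (\<Union>k. S (k + n))" by (rule subadditive_Un)
    also have "\<dots> \<le> f (Y n) + (\<Sum>k. f (S (k + n)))" by (intro add_left_mono countable_subadditive)
    finally have "f (X \<inter> F) + f (X - F) \<le> (f (X \<inter> F) + f (Y n)) + (\<Sum>k. f (S (k + n)))"
      by (simp add: add.assoc add_left_mono)
    also have "f (X \<inter> F) + f (Y n) \<le> f (X \<inter> F \<union> Y n)" by (rule separated_add[OF sepY])
    also have "\<dots> \<le> f X" by (rule mono) (auto simp: Y_def)
    finally show ?thesis by (simp add: add_right_mono)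
  qed
  have "(\<lambda>n. f X + (\<Sum>k. f (S (k + n)))) \<longlonglongrightarrow> f X + 0" by (intro tendsto_add tail tendsto_const)
  then show ?thesis using main by (intro LIMSEQ_le_const[where a = "f (X \<inter> F) + f (X - F)"]) auto
qed

text \<open>The Caratheodory measurable sets form a sigma-algebra, so closed sets, which generate
  the Borel sets, are all that has to be checked.\<close>

theorem borel_lambda_system: "sets borel \<subseteq> lambda_system UNIV UNIV f"
proof -
  interpret sigma_algebra UNIV "UNIV :: 'a set set" using sigma_algebra_Pow[of UNIV] by simp
  have sa: "sigma_algebra UNIV (lambda_system UNIV UNIV f)"
    using caratheodory_lemma[OF outer_measure_space] by (simp add: measure_space_def)
  have "F \<in> lambda_system UNIV UNIV f" if "closed F" for F
  proof -
    have "f (X \<inter> F) + f (X - F) = f X" for X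
    proof (rule antisym[OF closed_splits[OF that]])
      have "f ((X \<inter> F) \<union> (X - F)) \<le> f (X \<inter> F) + f (X - F)" by (rule subadditive_Un)
      then show "f X \<le> f (X \<inter> F) + f (X - F)" by (simp add: Int_Diff_Un)
    qed
    then show ?thesis by (simp add: lambda_system_eq)
  qed
  then have "sigma_sets UNIV (Collect closed) \<subseteq> lambda_system UNIV UNIV f"
    by (intro sigma_algebra.sigma_sets_subset[OF sa]) auto
  then show ?thesis by (simp add: borel_eq_closed)
qed

text \<open>\<open>measure_of\<close> returns the given function only if that function is countably
  additive on the sigma-algebra; this is inherited from the Caratheodory measurable sets.\<close>

lemma emeasure_measure_of_borel:
  assumes "A \<in> sets borel"
  shows "emeasure (measure_of UNIV (sets borel) f) A = f A"
proof (rule emeasure_measure_of_sigma)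
  interpret sigma_algebra UNIV "UNIV :: 'a set set" using sigma_algebra_Pow[of UNIV] by simp
  have "measure_space UNIV (lambda_system UNIV UNIV f) f"
    by (rule caratheodory_lemma[OF outer_measure_space])
  then have "positive (lambda_system UNIV UNIV f) f" "countably_additive (lambda_system UNIV UNIV f) f"
    by (auto simp: measure_space_def)
  then show "positive (sets borel) f" "countably_additive (sets borel) f"
    using borel_lambda_system subset_trans[OF _ borel_lambda_system]
    unfolding positive_def countably_additive_def by blast+
  show "sigma_algebra UNIV (sets (borel :: 'a measure))" by (metis sets.sigma_algebra_axioms space_borel)
qed (use assms in auto)

end

section \<open>Hausdorff outer measure as a metric outer measure\<close>

text \<open>The summand of \<open>hausdorff_content\<close>: the volume of a
  \<open>d\<close>-dimensional ball with the diameter of \<open>C\<close>.\<close>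

definition hausdorff_gauge :: "nat \<Rightarrow> 'a::metric_space set \<Rightarrow> ennreal" where
  "hausdorff_gauge d C =
     (if C = {} then 0 else ennreal (unit_ball_vol (real d) * (diameter C / 2) ^ d))"

lemma hausdorff_gauge_empty [simp]: "hausdorff_gauge d {} = 0"
  by (simp add: hausdorff_gauge_def)

lemma hausdorff_content_eq:
  "hausdorff_content d \<delta> A =
     (INF C\<in>{C :: nat \<Rightarrow> 'a::metric_space set. A \<subseteq> (\<Union>i. C i) \<and> (\<forall>i. bounded (C i) \<and> diameter (C i) \<le> \<delta>)}.
        \<Sum>i. hausdorff_gauge d (C i))"
  by (simp add: hausdorff_content_def hausdorff_gauge_def)

lemma hausdorff_content_le:
  assumes "A \<subseteq> (\<Union>i. C i)" "\<And>i. bounded (C i)" "\<And>i. diameter (C i) \<le> \<delta>"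
  shows "hausdorff_content d \<delta> A \<le> (\<Sum>i. hausdorff_gauge d (C i))"
  unfolding hausdorff_content_eq by (rule INF_lower) (use assms in auto)

lemma hausdorff_content_coverE:
  assumes "hausdorff_content d \<delta> A < x"
  obtains C :: "nat \<Rightarrow> 'a::metric_space set" where "A \<subseteq> (\<Union>i. C i)" "\<And>i. bounded (C i)"
    "\<And>i. diameter (C i) \<le> \<delta>" "(\<Sum>i. hausdorff_gauge d (C i)) < x"
  using assms unfolding hausdorff_content_eq INF_less_iff by auto

lemma hausdorff_content_mono: "A \<subseteq> B \<Longrightarrow> hausdorff_content d \<delta> A \<le> hausdorff_content d \<delta> B"
  unfolding hausdorff_content_eq by (rule INF_superset_mono) auto

lemma hausdorff_content_antimono:
  "\<delta> \<le> \<epsilon> \<Longrightarrow> hausdorff_content d \<epsilon> A \<le> hausdorff_content d \<delta> A"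
  unfolding hausdorff_content_eq by (rule INF_superset_mono) (auto intro: order_trans)

text \<open>Each \<open>A i\<close> has a cover that is optimal up to
  \<open>e / 2 ^ (i + 1)\<close>, and the doubly indexed family of covering sets is enumerated by
  the pairing function.\<close>

lemma hausdorff_content_subadditive:
  fixes A :: "nat \<Rightarrow> 'a::metric_space set"
  assumes "\<delta> > 0"
  shows "hausdorff_content d \<delta> (\<Union>i. A i) \<le> (\<Sum>i. hausdorff_content d \<delta> (A i))"
proof (cases "(\<Sum>i. hausdorff_content d \<delta> (A i)) = \<infinity>")
  case False
  then have fin: "hausdorff_content d \<delta> (A i) < \<infinity>" for i
    by (metis infinity_ennreal_def ennreal_suminf_lessD top.not_eq_extremum)
  show ?thesis
  proof (rule ennreal_le_epsilon)
    fix e :: real assume "0 < e"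
    have "\<exists>C. A i \<subseteq> (\<Union>j. C j) \<and> (\<forall>j. bounded (C j) \<and> diameter (C j) \<le> \<delta>) \<and>
        (\<Sum>j. hausdorff_gauge d (C j)) \<le> hausdorff_content d \<delta> (A i) + ennreal e * ennreal ((1 / 2) ^ Suc i)" for i
    proof -
      have "hausdorff_content d \<delta> (A i) < hausdorff_content d \<delta> (A i) + ennreal e * ennreal ((1 / 2) ^ Suc i)"
        using fin[of i] \<open>0 < e\<close>
          ennreal_add_left_cancel_less[of "hausdorff_content d \<delta> (A i)" 0 "ennreal e * ennreal ((1 / 2) ^ Suc i)"]
        by (simp add: ennreal_zero_less_mult_iff)
      then show ?thesis by (elim hausdorff_content_coverE) (metis less_imp_le)
    qed
    then obtain C where C: "\<And>i. A i \<subseteq> (\<Union>j. C i j)" "\<And>i j. bounded (C i j)" "\<And>i j. diameter (C i j) \<le> \<delta>"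
      "\<And>i. (\<Sum>j. hausdorff_gauge d (C i j)) \<le> hausdorff_content d \<delta> (A i) + ennreal e * ennreal ((1 / 2) ^ Suc i)"
      by metis
    define D where "D k = (case prod_decode k of (i, j) \<Rightarrow> C i j)" for k
    have "hausdorff_content d \<delta> (\<Union>i. A i) \<le> (\<Sum>k. hausdorff_gauge d (D k))"
    proof (rule hausdorff_content_le)
      show "(\<Union>i. A i) \<subseteq> (\<Union>k. D k)"
      proof
        fix x assume "x \<in> (\<Union>i. A i)"
        then obtain i j where "x \<in> C i j" using C(1) by blast
        then have "x \<in> D (prod_encode (i, j))" by (simp add: D_def)
        then show "x \<in> (\<Union>k. D k)" by blast
      qed
    qed (auto simp: D_def C split: prod.splits)
    also have "(\<Sum>k. hausdorff_gauge d (D k)) = (\<Sum>i. \<Sum>j. hausdorff_gauge d (C i j))"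
      using suminf_ennreal_2dimen[of "\<lambda>i. \<Sum>j. hausdorff_gauge d (C i j)" "\<lambda>(i, j). hausdorff_gauge d (C i j)"]
      by (simp add: D_def case_prod_beta)
    also have "\<dots> \<le> (\<Sum>i. hausdorff_content d \<delta> (A i) + ennreal e * ennreal ((1 / 2) ^ Suc i))"
      by (intro suminf_le C) auto
    also have "\<dots> = (\<Sum>i. hausdorff_content d \<delta> (A i)) + (\<Sum>i. ennreal e * ennreal ((1 / 2) ^ Suc i))"
      by (rule suminf_add[symmetric]) auto
    also have "(\<Sum>i. ennreal e * ennreal ((1 / 2) ^ Suc i)) = ennreal e * ennreal 1"
      unfolding ennreal_suminf_cmult
      by (rule arg_cong[OF suminf_ennreal_eq]) (use power_half_series in simp_all)
    finally show "hausdorff_content d \<delta> (\<Union>i. A i) \<le> (\<Sum>i. hausdorff_content d \<delta> (A i)) + ennreal e" by simp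
  qed
qed simp

lemma hausdorff_outer_measure_upper: "\<delta> > 0 \<Longrightarrow> hausdorff_content d \<delta> A \<le> hausdorff_outer_measure d A"
  unfolding hausdorff_outer_measure_def by (rule SUP_upper) auto

lemma hausdorff_outer_measure_least:
  "(\<And>\<delta>. \<delta> > 0 \<Longrightarrow> hausdorff_content d \<delta> A \<le> x) \<Longrightarrow> hausdorff_outer_measure d A \<le> x"
  unfolding hausdorff_outer_measure_def by (rule SUP_least) auto

text \<open>A set of diameter at most \<delta> cannot meet both \<open>A\<close> and
  \<open>B\<close>, so a cover of the union splits into a cover of \<open>A\<close> and one of
  \<open>B\<close> that share no nonempty set.\<close>

lemma hausdorff_content_separated:
  fixes A B :: "'a::metric_space set"
  assumes "\<And>a b. a \<in> A \<Longrightarrow> b \<in> B \<Longrightarrow> \<delta> < dist a b" "0 < \<delta>"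
  shows "hausdorff_content d \<delta> A + hausdorff_content d \<delta> B \<le> hausdorff_content d \<delta> (A \<union> B)"
  unfolding hausdorff_content_eq[of _ _ "A \<union> B"]
proof (rule INF_greatest, clarsimp)
  fix C :: "nat \<Rightarrow> 'a set"
  assume C: "A \<subseteq> (\<Union>i. C i)" "B \<subseteq> (\<Union>i. C i)" "\<forall>i. bounded (C i) \<and> diameter (C i) \<le> \<delta>"
  define CA where "CA i = (if C i \<inter> A = {} then {} else C i)" for i
  define CB where "CB i = (if C i \<inter> B = {} then {} else C i)" for i
  have 1: "hausdorff_content d \<delta> A \<le> (\<Sum>i. hausdorff_gauge d (CA i))"
    by (rule hausdorff_content_le) (use C \<open>0 < \<delta>\<close> in \<open>auto simp: CA_def split: if_splits, blast\<close>)
  have 2: "hausdorff_content d \<delta> B \<le> (\<Sum>i. hausdorff_gauge d (CB i))"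
    by (rule hausdorff_content_le) (use C \<open>0 < \<delta>\<close> in \<open>auto simp: CB_def split: if_splits, blast\<close>)
  have "hausdorff_content d \<delta> A + hausdorff_content d \<delta> B \<le>
      (\<Sum>i. hausdorff_gauge d (CA i)) + (\<Sum>i. hausdorff_gauge d (CB i))"
    by (rule add_mono[OF 1 2])
  also have "(\<Sum>i. hausdorff_gauge d (CA i)) + (\<Sum>i. hausdorff_gauge d (CB i))
      = (\<Sum>i. hausdorff_gauge d (CA i) + hausdorff_gauge d (CB i))"
    by (rule suminf_add) auto
  also have "\<dots> \<le> (\<Sum>i. hausdorff_gauge d (C i))"
  proof (rule suminf_le)
    fix i
    have "CA i = {} \<or> CB i = {}"
    proof (rule ccontr)
      assume "\<not> ?thesis"
      then obtain a b where "a \<in> A" "b \<in> B" "a \<in> C i" "b \<in> C i"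
        by (auto simp: CA_def CB_def split: if_splits)
      moreover have "bounded (C i)" "diameter (C i) \<le> \<delta>" using C(3) by auto
      ultimately show False
        using assms(1)[of a b] diameter_bounded_bound[of "C i" a b] by linarith
    qed
    then show "hausdorff_gauge d (CA i) + hausdorff_gauge d (CB i) \<le> hausdorff_gauge d (C i)"
    proof
      assume "CA i = {}"
      then show ?thesis by (simp add: CB_def)
    next
      assume "CB i = {}"
      then show ?thesis by (simp add: CA_def)
    qed
  qed auto
  finally show "hausdorff_content d \<delta> A + hausdorff_content d \<delta> B \<le> (\<Sum>i. hausdorff_gauge d (C i))" .
qed

interpretation hausdorff: metric_outer_measure "hausdorff_outer_measure d :: 'a::metric_space set \<Rightarrow> ennreal" for d
proof
  show "hausdorff_outer_measure d ({} :: 'a set) = 0"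
  proof -
    have "hausdorff_outer_measure d ({} :: 'a set) \<le> 0"
    proof (rule hausdorff_outer_measure_least)
      fix \<delta> :: real assume "\<delta> > 0"
      then have "hausdorff_content d \<delta> ({} :: 'a set) \<le> (\<Sum>i::nat. hausdorff_gauge d ({} :: 'a set))"
        by (intro hausdorff_content_le) auto
      then show "hausdorff_content d \<delta> ({} :: 'a set) \<le> 0" by simp
    qed
    then show ?thesis by simp
  qed
next
  fix A B :: "'a set" assume "A \<subseteq> B"
  then show "hausdorff_outer_measure d A \<le> hausdorff_outer_measure d B"
    unfolding hausdorff_outer_measure_def by (intro SUP_mono) (auto intro: hausdorff_content_mono)
next
  fix A :: "nat \<Rightarrow> 'a set"
  show "hausdorff_outer_measure d (\<Union>i. A i) \<le> (\<Sum>i. hausdorff_outer_measure d (A i))"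
  proof (rule hausdorff_outer_measure_least)
    fix \<delta> :: real assume "\<delta> > 0"
    then have "hausdorff_content d \<delta> (\<Union>i. A i) \<le> (\<Sum>i. hausdorff_content d \<delta> (A i))"
      by (rule hausdorff_content_subadditive)
    also have "\<dots> \<le> (\<Sum>i. hausdorff_outer_measure d (A i))"
      by (intro suminf_le hausdorff_outer_measure_upper \<open>\<delta> > 0\<close>) auto
    finally show "hausdorff_content d \<delta> (\<Union>i. A i) \<le> (\<Sum>i. hausdorff_outer_measure d (A i))" .
  qed
next
  fix A B :: "'a set" assume "separated_sets A B"
  then obtain \<eta> where \<eta>: "\<eta> > 0" "\<And>a b. a \<in> A \<Longrightarrow> b \<in> B \<Longrightarrow> \<eta> \<le> dist a b"
    unfolding separated_sets_def by blast
  \<comment> \<open>Contents grow as the scale shrinks, so the suprema are directed and may be added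
    under one common scale.\<close>
  have "hausdorff_outer_measure d A + hausdorff_outer_measure d B =
     (SUP \<delta>\<in>{0<..}. hausdorff_content d \<delta> A + hausdorff_content d \<delta> B)"
    unfolding hausdorff_outer_measure_def
  proof (rule SUP_add_directed_ennreal[symmetric])
    fix i j :: real assume "i \<in> {0<..}" "j \<in> {0<..}"
    then show "\<exists>k\<in>{0<..}. hausdorff_content d i A + hausdorff_content d j B \<le> hausdorff_content d k A + hausdorff_content d k B"
      by (intro bexI[of _ "min i j"] add_mono hausdorff_content_antimono) auto
  qed
  also have "\<dots> \<le> hausdorff_outer_measure d (A \<union> B)"
  proof (rule SUP_least)
    fix \<delta> :: real assume \<delta>: "\<delta> \<in> {0<..}"
    \<comment> \<open>Half of the gap makes the scale strictly smaller than the distance of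
      \<open>A\<close> and \<open>B\<close>; passing to a smaller scale only increases the left
      side.\<close>
    define \<delta>' where "\<delta>' = min \<delta> (\<eta> / 2)"
    have \<delta>': "0 < \<delta>'" "\<delta>' \<le> \<delta>" "\<delta>' < \<eta>" using \<delta> \<eta> by (auto simp: \<delta>'_def)
    have "hausdorff_content d \<delta> A + hausdorff_content d \<delta> B \<le> hausdorff_content d \<delta>' A + hausdorff_content d \<delta>' B"
      by (intro add_mono hausdorff_content_antimono \<delta>')
    also have "\<dots> \<le> hausdorff_content d \<delta>' (A \<union> B)"
      by (rule hausdorff_content_separated) (use \<eta> \<delta>' in force)+
    also have "\<dots> \<le> hausdorff_outer_measure d (A \<union> B)" by (rule hausdorff_outer_measure_upper[OF \<delta>'(1)])
    finally show "hausdorff_content d \<delta> A + hausdorff_content d \<delta> B \<le> hausdorff_outer_measure d (A \<union> B)" .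
  qed
  finally show "hausdorff_outer_measure d A + hausdorff_outer_measure d B \<le> hausdorff_outer_measure d (A \<union> B)" .
qed

lemma sets_hausdorff_measure [simp, measurable_cong]: "sets (hausdorff_measure d) = sets borel"
  unfolding hausdorff_measure_def
  by (metis sets.sigma_sets_eq sets_measure_of space_borel subset_UNIV top_greatest Pow_UNIV)

lemma space_hausdorff_measure [simp]: "space (hausdorff_measure d) = UNIV"
  by (simp add: hausdorff_measure_def)

lemma emeasure_hausdorff_measure:
  "A \<in> sets borel \<Longrightarrow> emeasure (hausdorff_measure d) A = hausdorff_outer_measure d A"
  unfolding hausdorff_measure_def by (rule hausdorff.emeasure_measure_of_borel)

section \<open>Hausdorff measure of Lipschitz images\<close>

lemma bounded_lipschitz_image:
  fixes f :: "'a::metric_space \<Rightarrow> 'b::metric_space"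
  assumes "L-lipschitz_on X f" "bounded X"
  shows "bounded (f ` X)"
proof -
  obtain e where e: "\<And>x y. x \<in> X \<Longrightarrow> y \<in> X \<Longrightarrow> dist x y \<le> e"
    using assms(2) by (auto simp: bounded_two_points)
  have "dist (f x) (f y) \<le> L * e" if "x \<in> X" "y \<in> X" for x y
    using lipschitz_onD[OF assms(1) that] mult_left_mono[OF e[OF that] lipschitz_on_nonneg[OF assms(1)]]
    by linarith
  then show ?thesis by (auto simp: bounded_two_points)
qed

lemma diameter_lipschitz_image_le:
  fixes f :: "'a::metric_space \<Rightarrow> 'b::metric_space"
  assumes "L-lipschitz_on X f" "bounded X"
  shows "diameter (f ` X) \<le> L * diameter X"
proof (cases "X = {}")
  case False
  have "dist (f a) (f b) \<le> L * diameter X" if "a \<in> X" "b \<in> X" for a b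
  proof -
    have "dist (f a) (f b) \<le> L * dist a b" by (rule lipschitz_onD[OF assms(1)]) (use that in auto)
    also have "\<dots> \<le> L * diameter X"
      by (intro mult_left_mono diameter_bounded_bound assms(2) that lipschitz_on_nonneg[OF assms(1)])
    finally show ?thesis .
  qed
  then show ?thesis using False by (auto simp: diameter_def intro!: cSUP_least)
qed simp

text \<open>The images of a cover at scale \<open>\<delta> / L\<close> form a cover at scale
  \<delta>, and each gauge grows by at most \<open>L ^ d\<close>. The covering sets are first cut
  down to \<open>A\<close>, where \<open>f\<close> is known to be Lipschitz.\<close>

lemma hausdorff_outer_measure_lipschitz_le:
  fixes f :: "'a::metric_space \<Rightarrow> 'b::metric_space"
  assumes "L-lipschitz_on A f" "L > 0"
  shows "hausdorff_outer_measure d (f ` A) \<le> ennreal (L ^ d) * hausdorff_outer_measure d A"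
proof (rule hausdorff_outer_measure_least)
  fix \<delta> :: real assume "\<delta> > 0"
  define \<delta>' where "\<delta>' = \<delta> / L"
  have \<delta>': "\<delta>' > 0" using \<open>\<delta> > 0\<close> \<open>L > 0\<close> by (simp add: \<delta>'_def)
  have "hausdorff_content d \<delta> (f ` A) \<le> ennreal (L ^ d) * hausdorff_content d \<delta>' A"
  proof -
    \<comment> \<open>Dividing by the constant leaves a bare infimum on the right, so each cover can
      be treated separately.\<close>
    have "hausdorff_content d \<delta> (f ` A) / ennreal (L ^ d) \<le> hausdorff_content d \<delta>' A"
      unfolding hausdorff_content_eq[of _ _ A]
    proof (rule INF_greatest, clarsimp)
      fix C :: "nat \<Rightarrow> 'a set" assume C: "A \<subseteq> (\<Union>i. C i)" "\<forall>i. bounded (C i) \<and> diameter (C i) \<le> \<delta>'"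
      have lip: "L-lipschitz_on (C i \<inter> A) f" for i using assms(1) by (rule lipschitz_on_subset) auto
      have bd: "bounded (C i \<inter> A)" for i using C by (auto intro: bounded_subset)
      have dm: "diameter (f ` (C i \<inter> A)) \<le> L * diameter (C i)" for i
      proof -
        have "diameter (f ` (C i \<inter> A)) \<le> L * diameter (C i \<inter> A)"
          by (rule diameter_lipschitz_image_le[OF lip bd])
        also have "\<dots> \<le> L * diameter (C i)"
          using C \<open>L > 0\<close> by (intro mult_left_mono diameter_subset) auto
        finally show ?thesis .
      qed
      have "hausdorff_content d \<delta> (f ` A) \<le> (\<Sum>i. hausdorff_gauge d (f ` (C i \<inter> A)))"
      proof (rule hausdorff_content_le)
        show "f ` A \<subseteq> (\<Union>i. f ` (C i \<inter> A))" using C by blast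
        show "bounded (f ` (C i \<inter> A))" for i
          by (rule bounded_lipschitz_image[OF lip bd])
        have "L * diameter (C i) \<le> \<delta>" for i
          using C(2) \<open>L > 0\<close> by (simp add: \<delta>'_def field_simps)
        then show "diameter (f ` (C i \<inter> A)) \<le> \<delta>" for i using dm order_trans by blast
      qed
      also have "\<dots> \<le> (\<Sum>i. ennreal (L ^ d) * hausdorff_gauge d (C i))"
      proof (rule suminf_le)
        fix i
        show "hausdorff_gauge d (f ` (C i \<inter> A)) \<le> ennreal (L ^ d) * hausdorff_gauge d (C i)"
        proof (cases "C i \<inter> A = {}")
          case False
          have "unit_ball_vol (real d) * (diameter (f ` (C i \<inter> A)) / 2) ^ d \<le>
              unit_ball_vol (real d) * (L * diameter (C i) / 2) ^ d"
            by (intro mult_left_mono power_mono divide_right_mono dm)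
              (use bounded_lipschitz_image[OF lip bd] in \<open>auto intro: diameter_ge_0\<close>)
          also have "\<dots> = L ^ d * (unit_ball_vol (real d) * (diameter (C i) / 2) ^ d)"
            by (simp add: power_mult_distrib power_divide)
          finally show ?thesis using False \<open>L > 0\<close>
            by (auto simp: hausdorff_gauge_def ennreal_mult'[symmetric] intro!: ennreal_leI)
        qed simp
      qed auto
      also have "\<dots> = ennreal (L ^ d) * (\<Sum>i. hausdorff_gauge d (C i))" by simp
      finally show "hausdorff_content d \<delta> (f ` A) / ennreal (L ^ d) \<le> (\<Sum>i. hausdorff_gauge d (C i))"
        using \<open>L > 0\<close> by (simp add: divide_le_posI_ennreal mult.commute)
    qed
    then have "hausdorff_content d \<delta> (f ` A) / ennreal (L ^ d) * ennreal (L ^ d) \<le> hausdorff_content d \<delta>' A * ennreal (L ^ d)"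
      by (rule mult_right_mono) simp
    moreover have "hausdorff_content d \<delta> (f ` A) / ennreal (L ^ d) * ennreal (L ^ d) = hausdorff_content d \<delta> (f ` A)"
      using \<open>L > 0\<close> by (simp add: ennreal_divide_times ennreal_times_divide[symmetric] divide_ennreal)
    ultimately show ?thesis by (simp add: mult.commute)
  qed
  also have "\<dots> \<le> ennreal (L ^ d) * hausdorff_outer_measure d A"
    by (intro mult_left_mono hausdorff_outer_measure_upper \<delta>') simp
  finally show "hausdorff_content d \<delta> (f ` A) \<le> ennreal (L ^ d) * hausdorff_outer_measure d A" .
qed

section \<open>Steiner symmetrization and the isodiametric inequality\<close>

lemma lborel_translate_nn_integral:
  fixes F :: "'a::euclidean_space \<Rightarrow> ennreal"
  assumes "F \<in> borel_measurable borel"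
  shows "(\<integral>\<^sup>+x. F (x + c) \<partial>lborel) = (\<integral>\<^sup>+x. F x \<partial>lborel)"
proof -
  have "(\<integral>\<^sup>+x. F x \<partial>lborel) = (\<integral>\<^sup>+x. F x \<partial>distr lborel borel ((+) c))"
    by (simp add: lborel_distr_plus)
  also have "\<dots> = (\<integral>\<^sup>+x. F (c + x) \<partial>lborel)"
    using assms by (subst nn_integral_distr) auto
  finally show ?thesis by (simp add: add.commute)
qed

text \<open>Fubini for the lines parallel to \<open>b\<close>, averaged over the slab \<open>0 \<le> x \<bullet> b \<le> 1\<close> so that no
  decomposition of the space is needed.\<close>

lemma nn_integral_lborel_lines:
  fixes F :: "'a::euclidean_space \<Rightarrow> ennreal"
  assumes F [measurable]: "F \<in> borel_measurable borel" and b: "b \<bullet> b = 1"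
  shows "(\<integral>\<^sup>+x. F x \<partial>lborel) =
    (\<integral>\<^sup>+x. indicator {0..1} (x \<bullet> b) * (\<integral>\<^sup>+t. F (x + t *\<^sub>R b) \<partial>lborel) \<partial>lborel)"
proof -
  let ?w = "indicator {0..1::real} :: real \<Rightarrow> ennreal"
  have "(\<integral>\<^sup>+x. ?w (x \<bullet> b) * (\<integral>\<^sup>+t. F (x + t *\<^sub>R b) \<partial>lborel) \<partial>lborel) =
      (\<integral>\<^sup>+x. (\<integral>\<^sup>+t. ?w (x \<bullet> b) * F (x + t *\<^sub>R b) \<partial>lborel) \<partial>lborel)"
    by (intro nn_integral_cong nn_integral_cmult[symmetric]) measurable
  also have "\<dots> = (\<integral>\<^sup>+t. (\<integral>\<^sup>+x. ?w (x \<bullet> b) * F (x + t *\<^sub>R b) \<partial>lborel) \<partial>lborel)"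
    by (rule lborel_pair.Fubini'[symmetric]) measurable
  also have "\<dots> = (\<integral>\<^sup>+t. (\<integral>\<^sup>+x. ?w (x \<bullet> b - t) * F x \<partial>lborel) \<partial>lborel)"
  proof (rule nn_integral_cong)
    fix t :: real
    have "(\<integral>\<^sup>+x. ?w ((x + t *\<^sub>R b) \<bullet> b - t) * F (x + t *\<^sub>R b) \<partial>lborel) = (\<integral>\<^sup>+x. ?w (x \<bullet> b - t) * F x \<partial>lborel)"
      by (rule lborel_translate_nn_integral) measurable
    then show "(\<integral>\<^sup>+x. ?w (x \<bullet> b) * F (x + t *\<^sub>R b) \<partial>lborel) = (\<integral>\<^sup>+x. ?w (x \<bullet> b - t) * F x \<partial>lborel)"
      by (simp add: inner_add_left b)
  qed
  also have "\<dots> = (\<integral>\<^sup>+x. (\<integral>\<^sup>+t. ?w (x \<bullet> b - t) * F x \<partial>lborel) \<partial>lborel)"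
    by (rule lborel_pair.Fubini') measurable
  also have "\<dots> = (\<integral>\<^sup>+x. F x \<partial>lborel)"
  proof (rule nn_integral_cong)
    fix x
    \<comment> \<open>For fixed \<open>x\<close> the admissible shifts fill an interval of length
      one, which is why averaging over the unit slab introduces no constant.\<close>
    have "?w (x \<bullet> b - t) = indicator {x \<bullet> b - 1..x \<bullet> b} t" for t
      by (auto simp: indicator_def)
    then have "(\<integral>\<^sup>+t. ?w (x \<bullet> b - t) * F x \<partial>lborel) = (\<integral>\<^sup>+t. F x * indicator {x \<bullet> b - 1..x \<bullet> b} t \<partial>lborel)"
      by (simp add: mult.commute)
    also have "\<dots> = F x" by (subst nn_integral_cmult_indicator) auto
    finally show "(\<integral>\<^sup>+t. ?w (x \<bullet> b - t) * F x \<partial>lborel) = F x" .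
  qed
  finally show ?thesis by simp
qed

definition line_measure :: "'a::euclidean_space \<Rightarrow> 'a set \<Rightarrow> 'a \<Rightarrow> ennreal" where
  "line_measure b A x = (\<integral>\<^sup>+t. indicator A (x + t *\<^sub>R b) \<partial>lborel)"

text \<open>For a unit vector \<open>b\<close>, each line parallel to \<open>b\<close> keeps the
  length of its intersection with \<open>A\<close>, now as an open interval centered on the
  hyperplane orthogonal to \<open>b\<close>. By the strict inequality a line that meets
  \<open>A\<close> in a null set contributes nothing.\<close>

definition steiner :: "'a::euclidean_space \<Rightarrow> 'a set \<Rightarrow> 'a set" where
  "steiner b A = {x. ennreal (2 * \<bar>x \<bullet> b\<bar>) < line_measure b A x}"

lemma line_measure_measurable [measurable]:
  assumes [measurable]: "A \<in> sets borel"
  shows "line_measure b A \<in> borel_measurable borel"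
  unfolding line_measure_def by measurable

lemma steiner_measurable [measurable]:
  assumes [measurable]: "A \<in> sets borel"
  shows "steiner b A \<in> sets borel"
  unfolding steiner_def by measurable

lemma line_measure_shift:
  assumes [measurable]: "A \<in> sets borel"
  shows "line_measure b A (x + s *\<^sub>R b) = line_measure b A x"
proof -
  have "(\<integral>\<^sup>+t. indicator A (x + (t + s) *\<^sub>R b) \<partial>lborel) = line_measure b A x"
    unfolding line_measure_def
    by (rule lborel_translate_nn_integral[where F = "\<lambda>t. indicator A (x + t *\<^sub>R b)"]) measurable
  then show ?thesis by (simp add: line_measure_def algebra_simps)
qed

lemma emeasure_symmetric_interval: "(\<integral>\<^sup>+t. indicator {s. ennreal (2 * \<bar>s\<bar>) < c} t \<partial>lborel) = c"
proof -
  have "{s. ennreal (2 * \<bar>s\<bar>) < c} = {- r / 2<..<r / 2}" if "c = ennreal r" "0 \<le> r" for r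
    using that by (auto simp: ennreal_less_iff abs_if)
  then show ?thesis
    by (cases c) (auto simp: emeasure_lborel_Ioo ennreal_less_top top_unique)
qed

lemma line_measure_steiner:
  assumes [measurable]: "A \<in> sets borel" and b: "b \<bullet> b = 1"
  shows "line_measure b (steiner b A) x = line_measure b A x"
proof -
  have "line_measure b (steiner b A) x =
      (\<integral>\<^sup>+t. indicator {s. ennreal (2 * \<bar>s\<bar>) < line_measure b A x} (t + x \<bullet> b) \<partial>lborel)"
    unfolding line_measure_def[of b "steiner b A"]
    by (intro nn_integral_cong)
      (simp add: steiner_def indicator_def line_measure_shift inner_add_left b add.commute)
  also have "\<dots> = (\<integral>\<^sup>+t. indicator {s. ennreal (2 * \<bar>s\<bar>) < line_measure b A x} t \<partial>lborel)"
    by (rule lborel_translate_nn_integral) measurable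
  finally show ?thesis by (simp add: emeasure_symmetric_interval)
qed

text \<open>The length on each line is preserved, and the volume is the average of these lengths
  over a slab.\<close>

lemma emeasure_steiner:
  assumes [measurable]: "A \<in> sets borel" and b: "b \<bullet> b = 1"
  shows "emeasure lborel (steiner b A) = emeasure lborel A"
proof -
  have *: "emeasure lborel B = (\<integral>\<^sup>+x. indicator {0..1} (x \<bullet> b) * line_measure b B x \<partial>lborel)"
    if [measurable]: "B \<in> sets borel" for B
    using nn_integral_lborel_lines[of "indicator B" b] b by (simp add: line_measure_def)
  show ?thesis by (simp add: * line_measure_steiner b)
qed

text \<open>Let \<open>H z\<close> be the heights of \<open>A\<close> on the line through
  \<open>z\<close>. If all heights in \<open>H x\<close> and \<open>H y\<close> differed by less
  than \<open>E\<close>, the two sets would lie in intervals of total length \<open>2 * E\<close>.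
  But their measures exceed \<open>2 * \<bar>x \<bullet> b\<bar>\<close> and
  \<open>2 * \<bar>y \<bullet> b\<bar>\<close>, whose sum is at least \<open>2 * E\<close>. Hence
  \<open>A\<close> has points on the two lines that are at least as far apart in height as
  \<open>x\<close> and \<open>y\<close>, with the same offset orthogonal to
  \<open>b\<close>.\<close>

lemma steiner_dist_le:
  assumes A [measurable]: "A \<in> sets borel" and b: "b \<bullet> b = 1"
    and D: "\<And>x y. x \<in> A \<Longrightarrow> y \<in> A \<Longrightarrow> dist x y \<le> D"
    and x: "x \<in> steiner b A" and y: "y \<in> steiner b A"
  shows "dist x y \<le> D"
proof -
  define H where "H z = {h. z + (h - z \<bullet> b) *\<^sub>R b \<in> A}" for z
  have [measurable]: "H z \<in> sets borel" for z unfolding H_def by measurable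
  have emH: "emeasure lborel (H z) = line_measure b A z" for z
  proof -
    have "emeasure lborel (H z) = (\<integral>\<^sup>+t. indicator A (z + (t + (- (z \<bullet> b))) *\<^sub>R b) \<partial>lborel)"
      by (subst nn_integral_indicator[symmetric], measurable)
        (intro nn_integral_cong, simp add: H_def indicator_def)
    also have "\<dots> = line_measure b A z" unfolding line_measure_def
      by (rule lborel_translate_nn_integral[where F = "\<lambda>t. indicator A (z + t *\<^sub>R b)"]) measurable
    finally show ?thesis .
  qed
  have lt: "ennreal (2 * \<bar>z \<bullet> b\<bar>) < emeasure lborel (H z)" if "z \<in> steiner b A" for z
    using that by (simp add: steiner_def emH)
  define E where "E = \<bar>x \<bullet> b - y \<bullet> b\<bar>"
  have "\<exists>h\<in>H x. \<exists>k\<in>H y. E \<le> \<bar>h - k\<bar>"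
  proof (rule ccontr)
    assume "\<not> ?thesis"
    then have close: "\<And>h k. h \<in> H x \<Longrightarrow> k \<in> H y \<Longrightarrow> \<bar>h - k\<bar> < E" by (auto simp: not_le)
    have "H x \<noteq> {}" "H y \<noteq> {}" using lt[OF x] lt[OF y] by (auto simp: less_le)
    then obtain h0 k0 where h0: "h0 \<in> H x" and k0: "k0 \<in> H y" by blast
    have bdd: "bdd_above (H x)" "bdd_below (H x)"
      by (rule bdd_aboveI[of _ "k0 + E"], use close[OF _ k0] in force,
          rule bdd_belowI[of _ "k0 - E"], use close[OF _ k0] in force)
    have "H x \<subseteq> {Inf (H x)..Sup (H x)}" using bdd by (auto intro: cInf_lower cSup_upper)
    then have "emeasure lborel (H x) \<le> emeasure lborel {Inf (H x)..Sup (H x)}"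
      by (intro emeasure_mono) auto
    moreover have io: "Inf (H x) \<le> Sup (H x)" using bdd h0 by (meson cInf_lower cSup_upper order_trans)
    ultimately have 1: "emeasure lborel (H x) \<le> ennreal (Sup (H x) - Inf (H x))" by simp
    \<comment> \<open>A height in \<open>H y\<close> is within \<open>E\<close> of both ends of
      \<open>H x\<close>. The lengths \<open>Sup - Inf\<close> and \<open>Inf - Sup + 2 * E\<close>
      add up to \<open>2 * E\<close>.\<close>
    have "H y \<subseteq> {Sup (H x) - E..Inf (H x) + E}"
    proof
      fix k assume k: "k \<in> H y"
      have "Sup (H x) \<le> k + E" by (rule cSup_least) (use h0 close[OF _ k] in force)+
      moreover have "k - E \<le> Inf (H x)" by (rule cInf_greatest) (use h0 close[OF _ k] in force)+
      ultimately show "k \<in> {Sup (H x) - E..Inf (H x) + E}" by auto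
    qed
    then have "emeasure lborel (H y) \<le> emeasure lborel {Sup (H x) - E..Inf (H x) + E}"
      and io2: "Sup (H x) - E \<le> Inf (H x) + E" using k0 by (auto intro: emeasure_mono)
    then have 2: "emeasure lborel (H y) \<le> ennreal (Inf (H x) + E - (Sup (H x) - E))" by simp
    have "ennreal (2 * \<bar>x \<bullet> b\<bar>) < ennreal (Sup (H x) - Inf (H x))" using lt[OF x] 1 by (rule less_le_trans)
    moreover have "ennreal (2 * \<bar>y \<bullet> b\<bar>) < ennreal (Inf (H x) + E - (Sup (H x) - E))"
      using lt[OF y] 2 by (rule less_le_trans)
    ultimately have "2 * \<bar>x \<bullet> b\<bar> < Sup (H x) - Inf (H x)" "2 * \<bar>y \<bullet> b\<bar> < Inf (H x) + E - (Sup (H x) - E)"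
      by (auto simp: ennreal_less_iff)
    then show False unfolding E_def by linarith
  qed
  then obtain h k where hk: "h \<in> H x" "k \<in> H y" "E \<le> \<bar>h - k\<bar>" by blast
  define p where "p = x + (h - x \<bullet> b) *\<^sub>R b"
  define q where "q = y + (k - y \<bullet> b) *\<^sub>R b"
  \<comment> \<open>The component of \<open>x - y\<close> orthogonal to \<open>b\<close>, shared
    with \<open>p - q\<close>; by Pythagoras only the height differences have to be
    compared.\<close>
  define v where "v = x - y - ((x - y) \<bullet> b) *\<^sub>R b"
  have vb: "v \<bullet> b = 0" by (simp add: v_def inner_diff_left b)
  have "p - q = v + (h - k) *\<^sub>R b" "x - y = v + (x \<bullet> b - y \<bullet> b) *\<^sub>R b"
    by (simp_all add: p_def q_def v_def algebra_simps)
  moreover have "norm (v + s *\<^sub>R b) ^ 2 = norm v ^ 2 + s ^ 2" for s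
    unfolding power2_norm_eq_inner
    using vb b by (simp add: inner_add_left inner_add_right inner_commute[of b v] power2_eq_square)
  ultimately have "norm (x - y) ^ 2 \<le> norm (p - q) ^ 2"
    using hk(3) by (simp add: E_def abs_le_square_iff)
  then have "dist x y \<le> dist p q" unfolding dist_norm by (rule power2_le_imp_le) simp
  also have "\<dots> \<le> D" by (rule D) (use hk in \<open>auto simp: H_def p_def q_def\<close>)
  finally show ?thesis .
qed

text \<open>For a unit vector \<open>c\<close> the map is the reflection in the hyperplane
  orthogonal to \<open>c\<close>. It is an involution, so one inclusion says that the set is
  fixed.\<close>

definition reflection_invariant :: "'a::euclidean_space \<Rightarrow> 'a set \<Rightarrow> bool" where
  "reflection_invariant c A \<longleftrightarrow> (\<forall>x\<in>A. x - (2 * (x \<bullet> c)) *\<^sub>R c \<in> A)"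

lemma reflection_invariant_steiner_self:
  assumes "A \<in> sets borel" "b \<bullet> b = 1"
  shows "reflection_invariant b (steiner b A)"
  using line_measure_shift[OF assms(1), of b _ "- (2 * (_ \<bullet> b))"] assms(2)
  by (auto simp: reflection_invariant_def steiner_def inner_diff_left)

text \<open>The reflection in a direction orthogonal to \<open>b\<close> permutes the lines parallel
  to \<open>b\<close> and keeps heights along \<open>b\<close>. Hence symmetrizing in one basis
  direction preserves the symmetries gained from the earlier ones.\<close>

lemma reflection_invariant_steiner:
  assumes "A \<in> sets borel" "c \<bullet> c = 1" "b \<bullet> c = 0" "reflection_invariant c A"
  shows "reflection_invariant c (steiner b A)"
proof -
  let ?r = "\<lambda>x. x - (2 * (x \<bullet> c)) *\<^sub>R c"
  have rr: "?r (?r x) = x" for x using assms(2) by (simp add: inner_diff_left)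
  have iff: "?r x \<in> A \<longleftrightarrow> x \<in> A" for x
    using assms(4) rr[of x] unfolding reflection_invariant_def by metis
  have "line_measure b A (?r x) = line_measure b A x" for x
    unfolding line_measure_def
  proof (rule nn_integral_cong)
    fix t
    have "?r x + t *\<^sub>R b = ?r (x + t *\<^sub>R b)" using assms(3) by (simp add: inner_add_left algebra_simps)
    then show "indicator A (?r x + t *\<^sub>R b) = (indicator A (x + t *\<^sub>R b) :: ennreal)"
      by (simp only: iff indicator_def)
  qed
  moreover have "?r x \<bullet> b = x \<bullet> b" for x
    using assms(3) by (simp add: inner_diff_left inner_commute[of c b])
  ultimately show ?thesis by (simp add: reflection_invariant_def steiner_def)
qed

lemma steiner_symmetrization:
  fixes A :: "'a::euclidean_space set"
  assumes "A \<in> sets borel" "\<And>x y. x \<in> A \<Longrightarrow> y \<in> A \<Longrightarrow> dist x y \<le> D" "F \<subseteq> Basis"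
  shows "\<exists>A' :: 'a set. A' \<in> sets borel \<and> emeasure lborel A' = emeasure lborel A \<and>
    (\<forall>x\<in>A'. \<forall>y\<in>A'. dist x y \<le> D) \<and> (\<forall>c\<in>F. reflection_invariant c A')"
  using finite_subset[OF assms(3) finite_Basis] assms(3)
proof (induction F rule: finite_induct)
  case empty
  show ?case by (rule exI[of _ A]) (use assms(1,2) in auto)
next
  case (insert b F)
  then obtain A' where A': "A' \<in> sets borel" "emeasure lborel A' = emeasure lborel A"
    "\<And>x y. x \<in> A' \<Longrightarrow> y \<in> A' \<Longrightarrow> dist x y \<le> D" "\<And>c. c \<in> F \<Longrightarrow> reflection_invariant c A'" by auto
  have b: "b \<bullet> b = 1" "b \<in> Basis" using insert by (auto simp: inner_same_Basis)
  show ?case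
  proof (intro exI[of _ "steiner b A'"] conjI ballI)
    fix c assume "c \<in> insert b F"
    then consider "c = b" | "c \<in> F" "c \<noteq> b" by auto
    then show "reflection_invariant c (steiner b A')"
    proof cases
      case 1 then show ?thesis using reflection_invariant_steiner_self A' b by blast
    next
      case 2
      then have "c \<in> Basis" using insert by auto
      then show ?thesis using reflection_invariant_steiner[of A' c b] A' b 2
        by (auto simp: inner_same_Basis inner_not_same_Basis)
    qed
  qed (use A' b emeasure_steiner[of A' b] steiner_dist_le[OF A'(1) b(1) A'(3)] in auto)
qed

text \<open>After symmetrization in all coordinate directions the set contains \<open>- x\<close>
  with every \<open>x\<close>. The distance of these two points is \<open>2 * norm x\<close>, so a
  bound \<open>D\<close> on distances puts the set into a ball of radius
  \<open>D / 2\<close>.\<close>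

theorem isodiametric_inequality:
  fixes A :: "'a::euclidean_space set"
  assumes "A \<in> sets borel" "\<And>x y. x \<in> A \<Longrightarrow> y \<in> A \<Longrightarrow> dist x y \<le> D" "0 \<le> D"
  shows "emeasure lborel A \<le> ennreal (unit_ball_vol (real DIM('a)) * (D / 2) ^ DIM('a))"
proof -
  obtain A' :: "'a set" where A': "A' \<in> sets borel" "emeasure lborel A' = emeasure lborel A"
    "\<And>x y. x \<in> A' \<Longrightarrow> y \<in> A' \<Longrightarrow> dist x y \<le> D" "\<And>c. c \<in> Basis \<Longrightarrow> reflection_invariant c A'"
    using steiner_symmetrization[OF assms(1,2) subset_refl] by auto
  have neg: "- x \<in> A'" if "x \<in> A'" for x
  proof -
    \<comment> \<open>The coordinate reflections are applied one after the other; over the whole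
      basis the subtracted sum is \<open>2 *\<^sub>R x\<close>.\<close>
    have "x - (\<Sum>c\<in>F. (2 * (x \<bullet> c)) *\<^sub>R c) \<in> A'" if "F \<subseteq> Basis" for F
      using finite_subset[OF that finite_Basis] that
    proof (induction F rule: finite_induct)
      case empty then show ?case using \<open>x \<in> A'\<close> by simp
    next
      case (insert b F)
      let ?y = "x - (\<Sum>c\<in>F. (2 * (x \<bullet> c)) *\<^sub>R c)"
      have "(\<Sum>c\<in>F. (2 * (x \<bullet> c)) *\<^sub>R c) \<bullet> b = 0"
        using insert by (auto simp: inner_sum_left intro!: sum.neutral) (metis inner_not_same_Basis subsetD)
      then have "?y \<bullet> b = x \<bullet> b" by (simp add: inner_diff_left)
      moreover have "?y - (2 * (?y \<bullet> b)) *\<^sub>R b \<in> A'"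
        using insert A'(4)[of b] by (auto simp: reflection_invariant_def)
      ultimately show ?case using insert by (simp add: algebra_simps)
    qed
    from this[OF subset_refl] have "x - 2 *\<^sub>R (\<Sum>c\<in>Basis. (x \<bullet> c) *\<^sub>R c) \<in> A'"
      by (simp add: scaleR_sum_right)
    then show ?thesis by (simp add: euclidean_representation scaleR_2)
  qed
  have "A' \<subseteq> cball 0 (D / 2)"
  proof
    fix x assume "x \<in> A'"
    then have "dist x (- x) \<le> D" by (intro A'(3) neg)
    moreover have "dist x (- x) = 2 * norm x" by (simp add: dist_norm scaleR_2[symmetric])
    ultimately show "x \<in> cball 0 (D / 2)" by simp
  qed
  then have "emeasure lborel A' \<le> emeasure lborel (cball (0::'a) (D / 2))"
    by (intro emeasure_mono) auto
  also have "\<dots> = ennreal (unit_ball_vol (real DIM('a)) * (D / 2) ^ DIM('a))"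
    using assms(3) by (intro emeasure_cball) auto
  finally show ?thesis using A'(2) by simp
qed

section \<open>Hausdorff measure of full dimension is Lebesgue measure\<close>

text \<open>Covering sets in the Hausdorff content are arbitrary; the closure is measurable and has
  the same diameter.\<close>

lemma emeasure_closure_le_hausdorff_gauge:
  fixes C :: "'a::euclidean_space set"
  assumes "bounded C"
  shows "emeasure lborel (closure C) \<le> hausdorff_gauge DIM('a) C"
proof (cases "C = {}")
  case False
  have "emeasure lborel (closure C) \<le> ennreal (unit_ball_vol (real DIM('a)) * (diameter C / 2) ^ DIM('a))"
  proof (rule isodiametric_inequality)
    show "dist x y \<le> diameter C" if "x \<in> closure C" "y \<in> closure C" for x y
      using diameter_bounded_bound[of "closure C" x y] bounded_closure[OF assms] assms that
      by (simp add: diameter_closure)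
  qed (auto intro: diameter_ge_0 assms)
  then show ?thesis using False by (simp add: hausdorff_gauge_def)
qed simp

text \<open>By the isodiametric inequality every cover has total gauge at least the volume, at any
  scale; scale 1 is taken.\<close>

lemma emeasure_lborel_le_hausdorff:
  fixes A :: "'a::euclidean_space set"
  assumes "A \<in> sets borel"
  shows "emeasure lborel A \<le> hausdorff_outer_measure DIM('a) A"
proof -
  have "emeasure lborel A \<le> hausdorff_content DIM('a) 1 A"
    unfolding hausdorff_content_eq
  proof (rule INF_greatest, clarsimp)
    fix C :: "nat \<Rightarrow> 'a set"
    assume C: "A \<subseteq> (\<Union>i. C i)" "\<forall>i. bounded (C i) \<and> diameter (C i) \<le> 1"
    have "emeasure lborel A \<le> emeasure lborel (\<Union>i. closure (C i))"
      using C closure_subset by (intro emeasure_mono) (blast, auto)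
    also have "\<dots> \<le> (\<Sum>i. emeasure lborel (closure (C i)))"
      by (intro emeasure_subadditive_countably) auto
    also have "\<dots> \<le> (\<Sum>i. hausdorff_gauge DIM('a) (C i))"
      using C by (intro suminf_le emeasure_closure_le_hausdorff_gauge) auto
    finally show "emeasure lborel A \<le> (\<Sum>i. hausdorff_gauge DIM('a) (C i))" .
  qed
  also have "\<dots> \<le> hausdorff_outer_measure DIM('a) A" by (rule hausdorff_outer_measure_upper) simp
  finally show ?thesis .
qed

text \<open>For balls the gauge equals the volume, and disjoint balls inside \<open>U\<close> have
  total volume at most that of \<open>U\<close>. The enlargement factor \<open>k\<close> is 5 for
  Vitali's covering lemma and 1 for his covering theorem.\<close>

lemma hausdorff_content_le_disjoint_balls:
  fixes a :: "'i \<Rightarrow> 'a::euclidean_space"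
  assumes C: "countable C" "pairwise (\<lambda>i j. disjnt (ball (a i) (r i)) (ball (a j) (r j))) C"
    and r: "\<And>i. i \<in> C \<Longrightarrow> 0 < r i" "\<And>i. i \<in> C \<Longrightarrow> 2 * (k * r i) \<le> \<delta>" "k > 0" "\<delta> > 0"
    and U: "\<And>i. i \<in> C \<Longrightarrow> ball (a i) (r i) \<subseteq> U" "U \<in> sets borel"
    and A: "A \<subseteq> (\<Union>i\<in>C. ball (a i) (k * r i))"
  shows "hausdorff_content DIM('a) \<delta> A \<le> ennreal (k ^ DIM('a)) * emeasure lborel U"
proof -
  define J where "J = to_nat_on C ` C"
  define g where "g = from_nat_into C"
  have gJ: "g n \<in> C" "to_nat_on C (g n) = n" if "n \<in> J" for n
    using that C(1) by (auto simp: J_def g_def)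
  have gC: "\<exists>n\<in>J. g n = i" if "i \<in> C" for i
    using that C(1) by (auto simp: J_def g_def)
  define B where "B s n = (if n \<in> J then ball (a (g n)) (s * r (g n)) else {})" for s n
  have "hausdorff_content DIM('a) \<delta> A \<le> (\<Sum>n. hausdorff_gauge DIM('a) (B k n))"
  proof (rule hausdorff_content_le)
    show "A \<subseteq> (\<Union>n. B k n)"
    proof
      fix x assume "x \<in> A"
      then obtain i where i: "i \<in> C" "x \<in> ball (a i) (k * r i)" using A by blast
      then obtain n where "n \<in> J" "g n = i" using gC by blast
      then show "x \<in> (\<Union>n. B k n)" using i by (auto simp: B_def)
    qed
    show "bounded (B k n)" for n by (auto simp: B_def)
    show "diameter (B k n) \<le> \<delta>" for n using r gJ[of n] by (auto simp: B_def diameter_ball)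
  qed
  also have "\<dots> = (\<Sum>n. ennreal (k ^ DIM('a)) * emeasure lborel (B 1 n))"
  proof (intro suminf_cong)
    fix n
    show "hausdorff_gauge DIM('a) (B k n) = ennreal (k ^ DIM('a)) * emeasure lborel (B 1 n)"
    proof (cases "n \<in> J")
      case True
      then have p: "0 < r (g n)" "0 < k * r (g n)" using r gJ by auto
      then have "hausdorff_gauge DIM('a) (B k n) = ennreal (unit_ball_vol (real DIM('a)) * (k * r (g n)) ^ DIM('a))"
        using True by (simp add: B_def hausdorff_gauge_def diameter_ball)
      also have "\<dots> = ennreal (k ^ DIM('a) * (unit_ball_vol (real DIM('a)) * r (g n) ^ DIM('a)))"
        by (simp add: power_mult_distrib ac_simps)
      also have "\<dots> = ennreal (k ^ DIM('a)) * emeasure lborel (B 1 n)"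
        using True p r(3) by (simp add: B_def emeasure_ball ennreal_mult')
      finally show ?thesis .
    qed (simp add: B_def)
  qed
  also have "\<dots> = ennreal (k ^ DIM('a)) * (\<Sum>n. emeasure lborel (B 1 n))" by simp
  also have "(\<Sum>n. emeasure lborel (B 1 n)) = emeasure lborel (\<Union>n. B 1 n)"
  proof (rule suminf_emeasure)
    show "disjoint_family (B 1)"
      unfolding disjoint_family_on_def
    proof (intro ballI impI)
      fix m n :: nat assume "m \<noteq> n"
      show "B 1 m \<inter> B 1 n = {}"
      proof (cases "m \<in> J \<and> n \<in> J")
        case True
        then have "g m \<noteq> g n" "g m \<in> C" "g n \<in> C" using gJ \<open>m \<noteq> n\<close> by metis+
        with C(2) have "disjnt (ball (a (g m)) (r (g m))) (ball (a (g n)) (r (g n)))"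
          by (simp add: pairwise_def)
        then show ?thesis using True by (simp add: B_def disjnt_def)
      qed (auto simp: B_def)
    qed
  qed (auto simp: B_def)
  also have "\<dots> \<le> emeasure lborel U"
    using U gJ by (intro emeasure_mono) (auto simp: B_def split: if_splits)
  finally show ?thesis by (simp add: mult_left_mono)
qed

text \<open>A null set has an open neighbourhood of volume below \<open>e / 5 ^ DIM('a)\<close>, and
  fivefold enlargements of disjoint balls in that neighbourhood cover the set.\<close>

lemma hausdorff_content_negligible:
  fixes N :: "'a::euclidean_space set"
  assumes "negligible N" "\<delta> > 0"
  shows "hausdorff_content DIM('a) \<delta> N = 0"
proof -
  obtain N' where N': "N' \<in> null_sets lborel" "N \<subseteq> N'"
    using assms(1) by (auto simp: negligible_iff_null_sets null_sets_completion_iff2)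
  have "hausdorff_content DIM('a) \<delta> N \<le> 0"
  proof (rule ennreal_le_epsilon)
    fix e :: real assume "e > 0"
    obtain U where U: "open U" "N' \<subseteq> U" "emeasure lborel (U - N') < ennreal (e / 5 ^ DIM('a))"
      using outer_regular_lborel[of N' "e / 5 ^ DIM('a)"] N' \<open>e > 0\<close> by (auto simp: null_sets_def)
    have "emeasure lborel U = emeasure lborel (U - N')"
      using N' U by (intro emeasure_Diff_null_set[symmetric]) auto
    then have eU: "emeasure lborel U < ennreal (e / 5 ^ DIM('a))" using U by simp
    \<comment> \<open>A tenth of \<delta>, since the fivefold enlarged balls must have diameter at
      most \<delta>.\<close>
    have "\<exists>r. 0 < r \<and> r \<le> \<delta> / 10 \<and> ball x r \<subseteq> U" if "x \<in> N" for x
    proof -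
      obtain s where "s > 0" "ball x s \<subseteq> U" using U N' \<open>x \<in> N\<close> by (meson openE subsetD)
      then show ?thesis using assms(2) by (intro exI[of _ "min s (\<delta> / 10)"]) auto
    qed
    then obtain r where r: "\<And>x. x \<in> N \<Longrightarrow> 0 < r x \<and> r x \<le> \<delta> / 10 \<and> ball x (r x) \<subseteq> U" by metis
    have cov: "N \<subseteq> (\<Union>x\<in>N. ball x (r x))" using r by force
    obtain C where C: "countable C" "C \<subseteq> N" "pairwise (\<lambda>i j. disjnt (ball i (r i)) (ball j (r j))) C"
      "N \<subseteq> (\<Union>i\<in>C. ball i (5 * r i))"
      using Vitali_covering_lemma_balls[OF cov, of "\<delta> / 10"] r by auto
    have "hausdorff_content DIM('a) \<delta> N \<le> ennreal (5 ^ DIM('a)) * emeasure lborel U"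
      by (rule hausdorff_content_le_disjoint_balls[OF C(1,3)]) (use C r U assms in force)+
    also have "\<dots> \<le> ennreal (5 ^ DIM('a)) * ennreal (e / 5 ^ DIM('a))" using eU by (intro mult_left_mono) auto
    also have "\<dots> = ennreal e" using \<open>e > 0\<close> by (subst ennreal_mult[symmetric]) auto
    finally show "hausdorff_content DIM('a) \<delta> N \<le> 0 + ennreal e" by simp
  qed
  then show ?thesis by simp
qed

text \<open>Vitali's theorem fills an open set of almost the same measure with small disjoint balls
  up to a negligible set; the balls have gauge equal to volume, and the remainder has content
  0.\<close>

lemma hausdorff_le_emeasure_lborel:
  fixes A :: "'a::euclidean_space set"
  assumes "A \<in> sets borel"
  shows "hausdorff_outer_measure DIM('a) A \<le> emeasure lborel A"
proof (rule hausdorff_outer_measure_least, rule ennreal_le_epsilon)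
  fix \<delta> e :: real assume \<delta>: "\<delta> > 0" and e: "e > 0"
  obtain U where U: "open U" "A \<subseteq> U" "emeasure lborel (U - A) < ennreal e"
    using outer_regular_lborel[OF assms e] by blast
  have "emeasure lborel U \<le> emeasure lborel A + emeasure lborel (U - A)"
    using emeasure_subadditive[of A lborel "U - A"] assms U by (simp add: Un_absorb1)
  then have eU: "emeasure lborel U \<le> emeasure lborel A + ennreal e"
    using U(3) by (meson add_left_mono less_imp_le order_trans)
  define K where "K = {(x, r). 0 < r \<and> 2 * r \<le> \<delta> \<and> ball x r \<subseteq> U}"
  have fine: "\<exists>i. i \<in> K \<and> x \<in> ball (fst i) (snd i) \<and> snd i < d" if "x \<in> U" "0 < d" for x d
  proof -
    obtain s where "s > 0" "ball x s \<subseteq> U" using U \<open>x \<in> U\<close> by (meson openE)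
    then show ?thesis using \<delta> \<open>0 < d\<close>
      by (intro exI[of _ "(x, min (min s (\<delta> / 2)) (d / 2))"]) (auto simp: K_def)
  qed
  obtain C where C: "countable C" "C \<subseteq> K"
    "pairwise (\<lambda>i j. disjnt (ball (fst i) (snd i)) (ball (fst j) (snd j))) C"
    "negligible (U - (\<Union>i\<in>C. ball (fst i) (snd i)))"
    by (rule Vitali_covering_theorem_balls[OF fine])
  let ?V = "\<Union>i\<in>C. ball (fst i) (snd i)"
  have "hausdorff_content DIM('a) \<delta> A \<le> hausdorff_content DIM('a) \<delta> (?V \<union> (U - ?V))"
    using U by (intro hausdorff_content_mono) auto
  also have "\<dots> \<le> hausdorff_content DIM('a) \<delta> ?V + hausdorff_content DIM('a) \<delta> (U - ?V)"
  proof -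
    have e0: "hausdorff_content DIM('a) \<delta> ({} :: 'a set) = 0"
      by (rule hausdorff_content_negligible[OF negligible_empty \<delta>])
    show ?thesis
      using hausdorff_content_subadditive[OF \<delta>, of "DIM('a)" "binaryset ?V (U - ?V)"]
        binaryset_sums[of "hausdorff_content DIM('a) \<delta>" ?V "U - ?V", OF e0]
      by (simp add: UN_binaryset_eq sums_iff)
  qed
  also have "hausdorff_content DIM('a) \<delta> (U - ?V) = 0"
    by (rule hausdorff_content_negligible[OF C(4) \<delta>])
  also have "hausdorff_content DIM('a) \<delta> ?V \<le> ennreal (1 ^ DIM('a)) * emeasure lborel U"
    by (rule hausdorff_content_le_disjoint_balls[OF C(1,3)]) (use C(2) \<delta> U(1) in \<open>force simp: K_def\<close>)+
  finally show "hausdorff_content DIM('a) \<delta> A \<le> emeasure lborel A + ennreal e"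
    using eU by (auto intro: order_trans)
qed

theorem hausdorff_outer_measure_lborel:
  fixes A :: "'a::euclidean_space set"
  shows "A \<in> sets borel \<Longrightarrow> hausdorff_outer_measure DIM('a) A = emeasure lborel A"
  by (intro antisym hausdorff_le_emeasure_lborel emeasure_lborel_le_hausdorff)

lemma hausdorff_outer_measure_negligible:
  fixes N :: "'a::euclidean_space set"
  shows "negligible N \<Longrightarrow> hausdorff_outer_measure DIM('a) N = 0"
  using hausdorff_outer_measure_least[of "DIM('a)" N 0] by (simp add: hausdorff_content_negligible)

text \<open>Both Lebesgue measures are Hausdorff measures, which do not see the isometry.\<close>

lemma distr_lborel_isometry:
  fixes f :: "'a::euclidean_space \<Rightarrow> 'b::euclidean_space"
  assumes dim: "DIM('a) = DIM('b)" and f: "\<And>x y. dist (f x) (f y) = dist x y" and surj: "surj f"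
  shows "distr lborel borel f = lborel"
proof (rule measure_eqI)
  have lip: "1-lipschitz_on UNIV f" by (rule lipschitz_onI) (auto simp: f)
  then have [measurable]: "f \<in> borel_measurable borel"
    by (intro borel_measurable_continuous_onI lipschitz_on_continuous_on)
  fix A :: "'b set" assume "A \<in> sets (distr lborel borel f)"
  then have A [measurable]: "A \<in> sets borel" by simp
  let ?P = "f -` A"
  have P [measurable]: "?P \<in> sets borel" using measurable_sets[of f borel borel A] by simp
  have im: "f ` ?P = A" using surj by auto
  have inj: "inj f" by (rule injI) (metis f dist_eq_0_iff)
  have "hausdorff_outer_measure DIM('b) A \<le> hausdorff_outer_measure DIM('b) ?P"
    using hausdorff_outer_measure_lipschitz_le[OF lipschitz_on_subset[OF lip], of ?P "DIM('b)"] im by simp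
  moreover have "hausdorff_outer_measure DIM('b) ?P \<le> hausdorff_outer_measure DIM('b) A"
  proof -
    have "1-lipschitz_on A (inv f)" by (rule lipschitz_onI) (auto simp: f[symmetric] surj_f_inv_f[OF surj])
    from hausdorff_outer_measure_lipschitz_le[OF this, of "DIM('b)"]
    have "hausdorff_outer_measure DIM('b) (inv f ` A) \<le> hausdorff_outer_measure DIM('b) A" by simp
    moreover have "inv f ` A = ?P" using inj surj by (metis bij_def bij_vimage_eq_inv_image)
    ultimately show ?thesis by simp
  qed
  ultimately have "emeasure lborel ?P = emeasure lborel A"
    using hausdorff_outer_measure_lborel[OF P] hausdorff_outer_measure_lborel[OF A] dim by simp
  then show "emeasure (distr lborel borel f) A = emeasure lborel A"
    by (simp add: emeasure_distr)
qed simp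

section \<open>Continuously differentiable functions with explicit gradients\<close>

text \<open>The gradient is an argument, so product and chain rules deliver it as a formula. The
  derivative is the full one at each point, so \<open>U\<close> is meant to be open.\<close>

definition c1_on :: "'a::euclidean_space set \<Rightarrow> ('a \<Rightarrow> real) \<Rightarrow> ('a \<Rightarrow> 'a) \<Rightarrow> bool" where
  "c1_on U f g \<longleftrightarrow> (\<forall>x\<in>U. GDERIV f x :> g x) \<and> continuous_on U g"

lemma GDERIV_has_derivative: "GDERIV f x :> D \<Longrightarrow> (f has_derivative (\<lambda>v. v \<bullet> D)) (at x)"
  by (simp add: gderiv_def)

lemma GDERIV_unique: "GDERIV f x :> D \<Longrightarrow> GDERIV f x :> E \<Longrightarrow> D = E"
proof -
  assume "GDERIV f x :> D" "GDERIV f x :> E"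
  then have "(\<lambda>v. v \<bullet> D) = (\<lambda>v. v \<bullet> E)" by (metis GDERIV_has_derivative has_derivative_unique)
  then have "(D - E) \<bullet> D = (D - E) \<bullet> E" by meson
  then show "D = E" by (metis eq_iff_diff_eq_0 inner_diff_right inner_eq_zero_iff)
qed

lemma GDERIV_transform:
  assumes "GDERIV f x :> D" "open U" "x \<in> U" "\<And>y. y \<in> U \<Longrightarrow> f y = f' y"
  shows "GDERIV f' x :> D"
  using has_derivative_transform_within_open[OF GDERIV_has_derivative[OF assms(1)] assms(2-4)]
  by (simp add: gderiv_def)

lemma c1_onD: "c1_on U f g \<Longrightarrow> x \<in> U \<Longrightarrow> GDERIV f x :> g x"
  by (simp add: c1_on_def)

lemma c1_on_continuous_gradient: "c1_on U f g \<Longrightarrow> continuous_on U g"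
  by (simp add: c1_on_def)

lemma c1_on_continuous: "c1_on U f g \<Longrightarrow> continuous_on U f"
  unfolding c1_on_def
  by (intro continuous_at_imp_continuous_on ballI has_derivative_continuous[OF GDERIV_has_derivative]) auto

lemma c1_on_subset: "c1_on U f g \<Longrightarrow> V \<subseteq> U \<Longrightarrow> c1_on V f g"
  by (auto simp: c1_on_def intro: continuous_on_subset)

lemma c1_on_transform:
  assumes "c1_on U f g" "open U" "\<And>x. x \<in> U \<Longrightarrow> f x = f' x"
  shows "c1_on U f' g"
  using assms(1) GDERIV_transform[OF _ assms(2) _ assms(3)] by (simp add: c1_on_def)

lemma c1_on_const: "c1_on U (\<lambda>x. c) (\<lambda>x. 0)"
  by (simp add: c1_on_def GDERIV_const)

lemma c1_on_add: "c1_on U f g \<Longrightarrow> c1_on U f' g' \<Longrightarrow> c1_on U (\<lambda>x. f x + f' x) (\<lambda>x. g x + g' x)"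
  by (auto simp: c1_on_def intro: GDERIV_add continuous_intros)

lemma c1_on_diff: "c1_on U f g \<Longrightarrow> c1_on U f' g' \<Longrightarrow> c1_on U (\<lambda>x. f x - f' x) (\<lambda>x. g x - g' x)"
  by (auto simp: c1_on_def intro: GDERIV_diff continuous_intros)

lemma c1_on_mult:
  assumes "c1_on U f g" "c1_on U f' g'"
  shows "c1_on U (\<lambda>x. f x * f' x) (\<lambda>x. f x *\<^sub>R g' x + f' x *\<^sub>R g x)"
  using assms c1_on_continuous[OF assms(1)] c1_on_continuous[OF assms(2)]
  by (auto simp: c1_on_def intro!: GDERIV_mult continuous_intros)

lemma c1_on_compose_real:
  assumes "c1_on U f g" "\<And>t. (\<phi> has_real_derivative \<phi>' t) (at t)" "continuous_on UNIV \<phi>'"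
  shows "c1_on U (\<lambda>x. \<phi> (f x)) (\<lambda>x. \<phi>' (f x) *\<^sub>R g x)"
  using c1_on_continuous[OF assms(1)] c1_on_continuous_gradient[OF assms(1)]
    GDERIV_DERIV_compose[where g = \<phi>, OF c1_onD[OF assms(1)] assms(2)]
  by (auto simp: c1_on_def intro!: continuous_intros continuous_on_compose2[OF assms(3)])

text \<open>The open sets \<open>U\<close> and \<open>- K\<close> cover the space; on the second one
  the extended function is identically zero, and on the overlap the gradient vanishes as
  well.\<close>

lemma c1_on_extend_zero:
  assumes f: "c1_on U f g" and U: "open U" and K: "closed K" "K \<subseteq> U"
    and zero: "\<And>x. x \<in> U - K \<Longrightarrow> f x = 0"
  shows "c1_on UNIV (\<lambda>x. if x \<in> U then f x else 0) (\<lambda>x. if x \<in> U then g x else 0)"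
    (is "c1_on UNIV ?f ?g")
proof -
  have g0: "g x = 0" if "x \<in> U - K" for x
  proof -
    have "GDERIV (\<lambda>x. 0) x :> g x"
      by (rule GDERIV_transform[OF c1_onD[OF f], where U = "U - K"]) (use U K that zero in auto)
    then show ?thesis using GDERIV_unique GDERIV_const by blast
  qed
  have 1: "c1_on U ?f ?g"
  proof -
    have "continuous_on U ?g \<longleftrightarrow> continuous_on U g" by (rule continuous_on_cong) auto
    moreover have "c1_on U ?f g" by (rule c1_on_transform[OF f U]) simp
    ultimately show ?thesis by (simp add: c1_on_def)
  qed
  have z: "?f x = 0" "?g x = 0" if "x \<in> - K" for x using that zero g0 by auto
  have 2: "c1_on (- K) ?f ?g"
  proof -
    have "c1_on (- K) ?f (\<lambda>x. 0)"
      by (rule c1_on_transform[OF c1_on_const]) (use K z in auto)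
    moreover have "continuous_on (- K) ?g \<longleftrightarrow> continuous_on (- K) (\<lambda>x. 0 :: 'a)"
      by (rule continuous_on_cong[OF refl z(2)])
    ultimately show ?thesis by (simp only: c1_on_def z(2) ball_simps cong: ball_cong) (simp add: z(2))
  qed
  have "U \<union> - K = UNIV" using K by blast
  moreover have "continuous_on (U \<union> - K) ?g"
    using 1 2 U K by (intro continuous_on_open_Un) (auto simp: c1_on_def)
  moreover have "GDERIV ?f x :> ?g x" for x
  proof (cases "x \<in> U")
    case True then show ?thesis using c1_onD[OF 1, of x] by simp
  next
    case False
    then have "x \<in> - K" using K by blast
    then show ?thesis using c1_onD[OF 2, of x] by simp
  qed
  ultimately show ?thesis unfolding c1_on_def by auto
qed

lemma c1_on_gradient_zero:
  assumes "c1_on UNIV f g" "open U" "\<And>x. x \<in> U \<Longrightarrow> f x = c" "x \<in> U"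
  shows "g x = 0"
  using GDERIV_unique[OF GDERIV_transform[OF c1_onD[OF assms(1)] assms(2,4), of "\<lambda>x. c"] GDERIV_const]
    assms by auto

subsection \<open>A family of bump functions\<close>

text \<open>A quotient of squared positive parts: equal to 1 up to 1, equal to 0 from 4 on, and
  continuously differentiable, which is enough for a cutoff. It is applied to a squared distance,
  smooth also at the center, so 1 and 4 stand for the radii 1 and 2.\<close>

definition bump_profile :: "real \<Rightarrow> real" where
  "bump_profile t = (max 0 (4 - t))\<^sup>2 / ((max 0 (4 - t))\<^sup>2 + (max 0 (t - 1))\<^sup>2)"

lemma max_zero_square_derivative: "((\<lambda>t. (max 0 t)\<^sup>2) has_real_derivative 2 * max 0 t) (at (t::real))"
proof -
  consider "t > 0" | "t < 0" | "t = 0" by linarith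
  then show ?thesis
  proof cases
    case 1
    have "((\<lambda>t. t\<^sup>2) has_real_derivative 2 * max 0 t) (at t)"
      using 1 by (auto intro!: derivative_eq_intros)
    then show ?thesis
      by (rule has_field_derivative_transform_within_open[where S = "{0<..}"]) (use 1 in auto)
  next
    case 2
    have "((\<lambda>t. 0) has_real_derivative 2 * max 0 t) (at t)" using 2 by simp
    then show ?thesis
      by (rule has_field_derivative_transform_within_open[where S = "{..<0}"]) (use 2 in auto)
  next
    case 3
    have "((\<lambda>h. max 0 h) \<longlongrightarrow> max 0 0) (at (0::real))"
      by (intro tendsto_max tendsto_const tendsto_ident_at)
    moreover have "\<forall>\<^sub>F h in at (0::real). max 0 h = ((max 0 h)\<^sup>2 - (max 0 0)\<^sup>2) / h"
      by (auto simp: eventually_at_filter max_def power2_eq_square)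
    ultimately have "((\<lambda>h. ((max 0 h)\<^sup>2 - (max 0 0)\<^sup>2) / h) \<longlongrightarrow> 0) (at (0::real))"
      by (auto intro: Lim_transform_eventually)
    then show ?thesis using 3 by (simp add: has_field_derivative_iff)
  qed
qed

lemma bump_profile_c1:
  obtains d M where "\<And>t. (bump_profile has_real_derivative d t) (at t)" "continuous_on UNIV d"
    "\<And>t. \<bar>d t\<bar> \<le> M"
proof -
  let ?p = "\<lambda>t::real. (max 0 (4 - t))\<^sup>2" and ?q = "\<lambda>t::real. (max 0 (t - 1))\<^sup>2"
  let ?p' = "\<lambda>t::real. - (2 * max 0 (4 - t))" and ?q' = "\<lambda>t::real. 2 * max 0 (t - 1)"
  define d where "d t = (?p' t * (?p t + ?q t) - ?p t * (?p' t + ?q' t)) / (?p t + ?q t)\<^sup>2" for t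
  have pos: "?p t + ?q t > 0" for t
  proof (cases "t < 4")
    case True then show ?thesis by (intro add_pos_nonneg) auto
  next
    case False then show ?thesis by (intro add_nonneg_pos) auto
  qed
  have p: "(?p has_real_derivative ?p' t) (at t)" for t
  proof -
    have "((\<lambda>t. 4 - t) has_real_derivative -1) (at t)" by (auto intro!: derivative_eq_intros)
    from DERIV_chain2[OF max_zero_square_derivative this] show ?thesis by simp
  qed
  have q: "(?q has_real_derivative ?q' t) (at t)" for t
  proof -
    have "((\<lambda>t. t - 1) has_real_derivative 1) (at t)" by (auto intro!: derivative_eq_intros)
    from DERIV_chain2[OF max_zero_square_derivative this] show ?thesis by simp
  qed
  have der: "(bump_profile has_real_derivative d t) (at t)" for t
  proof -
    have "?p t + ?q t \<noteq> 0" by (rule less_imp_neq[OF pos, THEN not_sym])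
    from DERIV_divide[OF p DERIV_add[OF p q] this] show ?thesis
      unfolding bump_profile_def[abs_def] d_def power2_eq_square[of "?p t + ?q t"] .
  qed
  have cont: "continuous_on UNIV d"
    unfolding d_def by (intro continuous_intros ballI) (use pos in \<open>auto simp: less_le\<close>)
  have "compact (d ` {1..4})"
    by (intro compact_continuous_image continuous_on_subset[OF cont]) auto
  then have "bounded (d ` {1..4})" by (rule compact_imp_bounded)
  then obtain M where "\<forall>t\<in>{1..4}. \<bar>d t\<bar> \<le> M" unfolding bounded_iff by auto
  then have M: "\<And>t. t \<in> {1..4} \<Longrightarrow> \<bar>d t\<bar> \<le> M" by blast
  have "\<bar>d t\<bar> \<le> M" for t
  proof (cases "t \<in> {1..4}")
    case False
    then have "d t = 0" by (auto simp: d_def) (simp add: algebra_simps)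
    then show ?thesis using M[of 1] by auto
  qed (rule M)
  then show ?thesis using that der cont by blast
qed

lemma bump_profile_range: "0 \<le> bump_profile t" "bump_profile t \<le> 1"
proof -
  have "a / (a + b) \<le> 1" if "0 \<le> a" "0 \<le> b" for a b :: real
    using that by (cases "a + b = 0") (auto simp: field_simps)
  then show "0 \<le> bump_profile t" "bump_profile t \<le> 1" by (simp_all add: bump_profile_def)
qed

lemma bump_profile_eq_1: "t \<le> 1 \<Longrightarrow> bump_profile t = 1"
  by (simp add: bump_profile_def)

lemma bump_profile_eq_0: "4 \<le> t \<Longrightarrow> bump_profile t = 0"
  by (simp add: bump_profile_def)

definition bump :: "'a::euclidean_space \<Rightarrow> real \<Rightarrow> 'a \<Rightarrow> real" where
  "bump p r x = bump_profile ((dist x p / r)\<^sup>2)"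

lemma bump_range: "0 \<le> bump p r x" "bump p r x \<le> 1"
  by (simp_all add: bump_def bump_profile_range)

lemma bump_eq_1: "r > 0 \<Longrightarrow> dist x p \<le> r \<Longrightarrow> bump p r x = 1"
  unfolding bump_def by (intro bump_profile_eq_1 power_le_one) auto

lemma bump_eq_0: "r > 0 \<Longrightarrow> 2 * r \<le> dist x p \<Longrightarrow> bump p r x = 0"
  unfolding bump_def
proof (rule bump_profile_eq_0)
  assume "r > 0" "2 * r \<le> dist x p"
  then have "2\<^sup>2 \<le> (dist x p / r)\<^sup>2" by (intro power_mono) (auto simp: field_simps)
  then show "4 \<le> (dist x p / r)\<^sup>2" by simp
qed

text \<open>The point is that \<open>M\<close> depends neither on the center nor on the radius. The
  factor 4 arises because the squared scaled distance has gradient of norm at most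
  \<open>4 / r\<close> on the ball of radius \<open>2 * r\<close>, outside which the bump
  vanishes.\<close>

lemma bump_c1:
  obtains M :: real where "M \<ge> 0"
    "\<And>(p::'a::euclidean_space) r. r > 0 \<Longrightarrow> \<exists>g. c1_on UNIV (bump p r) g \<and> (\<forall>x. norm (g x) \<le> M / r)"
proof -
  obtain d M where d: "\<And>t. (bump_profile has_real_derivative d t) (at t)" "continuous_on UNIV d"
    "\<And>t. \<bar>d t\<bar> \<le> M" by (rule bump_profile_c1) blast
  have "M \<ge> 0" using d(3)[of 0] by linarith
  have "\<exists>g. c1_on UNIV (bump p r) g \<and> (\<forall>x. norm (g x) \<le> (4 * M) / r)" if "r > 0" for r and p :: 'a
  proof -
    have q: "c1_on UNIV (\<lambda>x. (dist x p / r)\<^sup>2) (\<lambda>x. (2 / r\<^sup>2) *\<^sub>R (x - p))"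
      unfolding c1_on_def gderiv_def
    proof (intro conjI ballI continuous_intros)
      fix x
      have "((\<lambda>x. (x - p) \<bullet> (x - p)) has_derivative (\<lambda>v. 2 * (v \<bullet> (x - p)))) (at x)"
        by (auto intro!: derivative_eq_intros simp: inner_commute)
      then have "((\<lambda>x. (1 / r\<^sup>2) * ((x - p) \<bullet> (x - p))) has_derivative (\<lambda>v. (1 / r\<^sup>2) * (2 * (v \<bullet> (x - p))))) (at x)"
        by (rule has_derivative_mult_right)
      then show "((\<lambda>x. (dist x p / r)\<^sup>2) has_derivative (\<lambda>v. v \<bullet> ((2 / r\<^sup>2) *\<^sub>R (x - p)))) (at x)"
        by (simp add: dist_norm power_divide power2_norm_eq_inner)
    qed
    define g where "g x = d ((dist x p / r)\<^sup>2) *\<^sub>R ((2 / r\<^sup>2) *\<^sub>R (x - p))" for x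
    have c: "c1_on UNIV (bump p r) g"
      unfolding bump_def g_def by (rule c1_on_compose_real[OF q d(1,2)])
    have "norm (g x) \<le> (4 * M) / r" for x
    proof (cases "dist x p \<le> 2 * r")
      case True
      have "norm (g x) = \<bar>d ((dist x p / r)\<^sup>2)\<bar> * ((2 / r\<^sup>2) * dist x p)"
        using that by (simp add: g_def dist_norm abs_mult)
      also have "\<dots> \<le> M * ((2 / r\<^sup>2) * (2 * r))"
        using True that by (intro mult_mono d(3) mult_left_mono) (auto simp: \<open>M \<ge> 0\<close>)
      also have "\<dots> = (4 * M) / r" using that by (simp add: power2_eq_square field_simps)
      finally show ?thesis .
    next
      case False
      have "g x = 0"
      proof (rule c1_on_gradient_zero[OF c])
        show "open {x. 2 * r < dist x p}" by (intro open_Collect_less continuous_intros)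
        show "bump p r y = 0" if "y \<in> {x. 2 * r < dist x p}" for y
          using that \<open>r > 0\<close> by (intro bump_eq_0) auto
      qed (use False in auto)
      then show ?thesis using that \<open>M \<ge> 0\<close> by simp
    qed
    with c show ?thesis by blast
  qed
  then show ?thesis using that[of "4 * M"] \<open>M \<ge> 0\<close> by auto
qed

subsection \<open>The divergence theorem below a graph\<close>

lemma lborel_translate_integral:
  fixes F :: "'a::euclidean_space \<Rightarrow> real"
  assumes "F \<in> borel_measurable borel"
  shows "(LINT x|lborel. F (x + c)) = (LINT x|lborel. F x)"
proof -
  have "(LINT x|lborel. F x) = (LINT x|distr lborel borel ((+) c). F x)"
    by (simp add: lborel_distr_plus)
  also have "\<dots> = (LINT x|lborel. F (c + x))"
    using assms by (subst integral_distr) auto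
  finally show ?thesis by (simp add: add.commute)
qed

lemma integrable_continuous_bounded_support:
  fixes F :: "'a::euclidean_space \<Rightarrow> real"
  assumes "continuous_on UNIV F" "\<And>x. K < norm x \<Longrightarrow> F x = 0"
  shows "integrable lborel F"
proof -
  have "integrable lborel (\<lambda>x. indicator (cball 0 K) x *\<^sub>R F x)"
    by (intro borel_integrable_compact continuous_on_subset[OF assms(1)]) auto
  moreover have "(\<lambda>x. indicator (cball 0 K) x *\<^sub>R F x) = F"
    using assms(2) by (force simp: fun_eq_iff indicator_def)
  ultimately show ?thesis by (simp only:)
qed

lemma continuous_on_bounded_on_cball:
  fixes G :: "'a::euclidean_space \<Rightarrow> 'b::real_normed_vector"
  assumes "continuous_on UNIV G"
  obtains M where "M \<ge> 0" "\<And>x. norm x \<le> K \<Longrightarrow> norm (G x) \<le> M"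
proof -
  have "compact (G ` cball 0 K)"
    by (intro compact_continuous_image continuous_on_subset[OF assms]) auto
  then have "bounded (G ` cball 0 K)" by (rule compact_imp_bounded)
  then obtain M where "\<forall>x\<in>cball 0 K. norm (G x) \<le> M"
    unfolding bounded_iff by blast
  then show ?thesis by (intro that[of "max 0 M"]) (auto simp: le_max_iff_disj)
qed

lemma c1_gradient_bounded_support:
  assumes "c1_on UNIV f g" "\<And>x. K < norm x \<Longrightarrow> f x = 0" "K < norm x"
  shows "g x = 0"
  by (rule c1_on_gradient_zero[OF assms(1), of "{x. K < norm x}" 0])
    (use assms in \<open>auto intro!: open_Collect_less continuous_intros\<close>)

lemma c1_gradient_bounded:
  assumes "c1_on UNIV f g" "\<And>x. K < norm x \<Longrightarrow> f x = 0"
  obtains M where "\<And>x. norm (g x) \<le> M"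
proof -
  obtain M where M: "M \<ge> 0" "\<And>x. norm x \<le> K \<Longrightarrow> norm (g x) \<le> M"
    using continuous_on_bounded_on_cball[OF c1_on_continuous_gradient[OF assms(1)]] by blast
  have "norm (g x) \<le> M" for x
  proof (cases "norm x \<le> K")
    case True then show ?thesis by (rule M)
  next
    case False then show ?thesis using c1_gradient_bounded_support[OF assms, where x = x] M(1) by simp
  qed
  then show ?thesis by (rule that)
qed

lemma c1_bounded_gradient_lipschitz:
  assumes "c1_on UNIV f g" "\<And>x. norm (g x) \<le> M"
  shows "\<bar>f x - f y\<bar> \<le> M * norm (x - y)"
proof -
  have "norm (f x - f y) \<le> M * norm (x - y)"
  proof (rule differentiable_bound[where S = UNIV and f' = "\<lambda>x v. v \<bullet> g x"])
    fix z show "(f has_derivative (\<lambda>v. v \<bullet> g z)) (at z within UNIV)"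
      using GDERIV_has_derivative[OF c1_onD[OF assms(1)]] by simp
    show "onorm (\<lambda>v. v \<bullet> g z) \<le> M"
    proof (rule onorm_le)
      fix v show "norm (v \<bullet> g z) \<le> M * norm v"
        using Cauchy_Schwarz_ineq2[of v "g z"] mult_left_mono[OF assms(2)[of z] norm_ge_zero[of v]]
        by (simp add: mult.commute)
    qed
  qed auto
  then show ?thesis by simp
qed

text \<open>The difference quotients in a fixed direction have integral zero by translation invariance.\<close>

lemma integral_gradient_zero:
  fixes f :: "'a::euclidean_space \<Rightarrow> real"
  assumes f: "c1_on UNIV f g" and supp: "\<And>x. K < norm x \<Longrightarrow> f x = 0"
  shows "(LINT x|lborel. g x \<bullet> w) = 0"
proof -
  obtain M where M: "\<And>x. norm (g x) \<le> M" using c1_gradient_bounded[OF f supp] by blast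
  have cf: "continuous_on UNIV f" by (rule c1_on_continuous[OF f])
  then have [measurable]: "f \<in> borel_measurable borel" by (rule borel_measurable_continuous_onI)
  have [measurable]: "g \<in> borel_measurable borel"
    by (rule borel_measurable_continuous_onI[OF c1_on_continuous_gradient[OF f]])
  define t where "t n = 1 / (real n + 1)" for n
  define q where "q n x = (f (x + t n *\<^sub>R w) - f x) / t n" for n x
  have t: "0 < t n" "t n \<le> 1" for n by (auto simp: t_def)
  \<comment> \<open>The quotients are dominated by the Lipschitz bound on a ball that exceeds the
    support by \<open>norm w\<close>, the longest shift.\<close>
  have "(\<lambda>n. LINT x|lborel. q n x) \<longlonglongrightarrow> (LINT x|lborel. g x \<bullet> w)"
  proof (rule integral_dominated_convergence[where w = "\<lambda>x. indicator (cball 0 (\<bar>K\<bar> + norm w)) x *\<^sub>R (M * norm w)"])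
    show "integrable lborel (\<lambda>x::'a. indicator (cball 0 (\<bar>K\<bar> + norm w)) x *\<^sub>R (M * norm w))"
      by (intro borel_integrable_compact) auto
    show "AE x in lborel. (\<lambda>n. q n x) \<longlonglongrightarrow> g x \<bullet> w"
    proof (rule AE_I2)
      fix x
      have "((\<lambda>s. f (x + s *\<^sub>R w)) has_derivative (\<lambda>s. (s *\<^sub>R w) \<bullet> g x)) (at 0)"
      proof (rule has_derivative_compose[where g = f and f = "\<lambda>s. x + s *\<^sub>R w", of "\<lambda>s. s *\<^sub>R w" 0 UNIV "\<lambda>v. v \<bullet> g x"])
        show "((\<lambda>s. x + s *\<^sub>R w) has_derivative (\<lambda>s. s *\<^sub>R w)) (at 0)"
          by (auto intro!: derivative_eq_intros)
        show "(f has_derivative (\<lambda>v. v \<bullet> g x)) (at (x + 0 *\<^sub>R w))"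
          using GDERIV_has_derivative[OF c1_onD[OF f]] by simp
      qed
      then have "((\<lambda>s. f (x + s *\<^sub>R w)) has_real_derivative (g x \<bullet> w)) (at 0)"
        by (simp add: has_field_derivative_def inner_commute mult.commute[of _ "w \<bullet> g x"])
      then have "((\<lambda>s. (f (x + s *\<^sub>R w) - f x) / s) \<longlongrightarrow> g x \<bullet> w) (at 0)"
        by (simp add: has_field_derivative_iff)
      moreover have "filterlim t (at 0) sequentially"
        unfolding filterlim_at
      proof
        show "\<forall>\<^sub>F n in sequentially. t n \<in> UNIV \<and> t n \<noteq> 0" using t by (simp add: less_le)
        show "t \<longlonglongrightarrow> 0" unfolding t_def using LIMSEQ_inverse_real_of_nat by (simp add: inverse_eq_divide add.commute)
      qed
      ultimately show "(\<lambda>n. q n x) \<longlonglongrightarrow> g x \<bullet> w"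
        unfolding q_def by (rule filterlim_compose)
    qed
    fix n
    show "AE x in lborel. norm (q n x) \<le> indicator (cball 0 (\<bar>K\<bar> + norm w)) x *\<^sub>R (M * norm w)"
    proof (rule AE_I2)
      fix x
      show "norm (q n x) \<le> indicator (cball 0 (\<bar>K\<bar> + norm w)) x *\<^sub>R (M * norm w)"
      proof (cases "x \<in> cball 0 (\<bar>K\<bar> + norm w)")
        case True
        have "\<bar>f (x + t n *\<^sub>R w) - f x\<bar> \<le> M * norm (t n *\<^sub>R w)"
          using c1_bounded_gradient_lipschitz[OF f M, of "x + t n *\<^sub>R w" x] by simp
        then show ?thesis using True t[of n] by (simp add: q_def divide_le_eq ac_simps)
      next
        case False
        then have "\<bar>K\<bar> + norm w < norm x" by simp
        moreover have "norm x \<le> norm (x + t n *\<^sub>R w) + norm w"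
        proof -
          have "norm x \<le> norm (x + t n *\<^sub>R w) + norm (t n *\<^sub>R w)"
            using norm_triangle_ineq4[of "x + t n *\<^sub>R w" "t n *\<^sub>R w"] by simp
          also have "norm (t n *\<^sub>R w) \<le> norm w" using t[of n] by (simp add: mult_left_le_one_le)
          finally show ?thesis by simp
        qed
        ultimately have "K < norm (x + t n *\<^sub>R w)" "K < norm x" using norm_ge_zero[of w] by linarith+
        then show ?thesis using False by (simp add: q_def supp)
      qed
    qed
  qed (auto simp: q_def)
  moreover have "(LINT x|lborel. q n x) = 0" for n
  proof -
    have i: "integrable lborel (\<lambda>x. f (x + t n *\<^sub>R w))"
    proof (rule integrable_continuous_bounded_support)
      show "continuous_on UNIV (\<lambda>x. f (x + t n *\<^sub>R w))"
        by (intro continuous_on_compose2[OF cf] continuous_intros) auto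
      show "f (x + t n *\<^sub>R w) = 0" if "\<bar>K\<bar> + norm (t n *\<^sub>R w) < norm x" for x
      proof (rule supp)
        have "norm x \<le> norm (x + t n *\<^sub>R w) + norm (t n *\<^sub>R w)"
          using norm_triangle_ineq4[of "x + t n *\<^sub>R w" "t n *\<^sub>R w"] by simp
        then show "K < norm (x + t n *\<^sub>R w)" using that by linarith
      qed
    qed
    moreover have "integrable lborel f" by (rule integrable_continuous_bounded_support[OF cf supp])
    ultimately show ?thesis
      using lborel_translate_integral[of f "t n *\<^sub>R w"] by (simp add: q_def)
  qed
  ultimately show ?thesis by (simp add: LIMSEQ_const_iff)
qed

text \<open>The shear \<open>(y, s) \<mapsto> (y, s + h y)\<close> preserves the measure and straightens the graph.\<close>

lemma divergence_below_graph:
  fixes f :: "'a::euclidean_space \<times> real \<Rightarrow> real"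
  assumes h: "c1_on UNIV h dh" and f: "c1_on UNIV f df"
    and supp: "\<And>z. K < norm z \<Longrightarrow> f z = 0"
  shows "(LINT z|lborel. indicator {z. snd z < h (fst z)} z * (df z \<bullet> w)) =
    (LINT y|lborel. (snd w - dh y \<bullet> fst w) * f (y, h y))"
proof -
  have ch: "continuous_on UNIV h" by (rule c1_on_continuous[OF h])
  have cdh: "continuous_on UNIV dh" by (rule c1_on_continuous_gradient[OF h])
  have cf: "continuous_on UNIV f" by (rule c1_on_continuous[OF f])
  have cdf: "continuous_on UNIV df" by (rule c1_on_continuous_gradient[OF f])
  note [measurable] = borel_measurable_continuous_onI[OF ch] borel_measurable_continuous_onI[OF cdh]
    borel_measurable_continuous_onI[OF cf]
  have [measurable]: "df \<in> borel_measurable borel" by (rule borel_measurable_continuous_onI[OF cdf])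
  have [measurable]: "{z. snd z < h (fst z)} \<in> sets borel"
    by (intro borel_open open_Collect_less continuous_intros continuous_on_compose2[OF ch]) auto
  have [measurable]: "df \<in> borel_measurable (borel \<Otimes>\<^sub>M borel)"
    using borel_measurable_continuous_onI[OF cdf] by (simp add: borel_prod)
  note [continuous_intros] = continuous_on_compose2[OF ch] continuous_on_compose2[OF cdh]
    continuous_on_compose2[OF cf] continuous_on_compose2[OF cdf]
  have supp': "K < norm z \<Longrightarrow> df z = 0" for z by (rule c1_gradient_bounded_support[OF f supp])
  obtain B where B: "\<And>y. norm y \<le> K \<Longrightarrow> \<bar>h y\<bar> \<le> B" "B \<ge> 0"
    using continuous_on_bounded_on_cball[OF ch, of K] by (metis real_norm_def)
  \<comment> \<open>The shear moves the support, but only within a larger ball, because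
    \<open>h\<close> is bounded by \<open>B\<close> where the support projects.\<close>
  have far: "K < norm (y, s + h y)" if "\<bar>K\<bar> + (\<bar>K\<bar> + B) < norm (y, s)" for y s
  proof (rule ccontr)
    assume "\<not> ?thesis"
    then have "norm (y, s + h y) \<le> K" by simp
    then have "norm y \<le> K" "\<bar>s + h y\<bar> \<le> K"
      using norm_fst_le[of y "s + h y"] norm_snd_le[of "s + h y" y] by auto
    with B(1)[of y] have "norm y \<le> \<bar>K\<bar>" "\<bar>s\<bar> \<le> \<bar>K\<bar> + B" by auto
    then have "norm (y, s) \<le> \<bar>K\<bar> + (\<bar>K\<bar> + B)" using norm_Pair_le[of y s] by simp
    with that show False by simp
  qed
  define e where "e = fst w"
  define \<tau> where "\<tau> = snd w"
  \<comment> \<open>In sheared coordinates \<open>a\<close> is the derivative along \<open>e\<close>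
    of \<open>f (y, s + h y)\<close> at fixed \<open>s\<close>, and \<open>b\<close> is its
    derivative in \<open>s\<close>. The first integrates to zero over \<open>y\<close>, the second
    integrates over \<open>s < 0\<close> to the boundary value.\<close>
  define a where "a y s = fst (df (y, s + h y)) \<bullet> e + snd (df (y, s + h y)) * (dh y \<bullet> e)" for y s
  define b where "b y s = snd (df (y, s + h y))" for y s
  have ab: "df (y, s + h y) \<bullet> w = a y s + (\<tau> - dh y \<bullet> e) * b y s" for y s
    by (simp add: a_def b_def e_def \<tau>_def inner_prod_def algebra_simps)
  let ?I = "indicator {..<0::real} :: real \<Rightarrow> real"
  have int1: "integrable lborel (\<lambda>z. indicator {z. snd z < h (fst z)} z * (df z \<bullet> w))"
  proof (rule Bochner_Integration.integrable_bound[of lborel "\<lambda>z. df z \<bullet> w"])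
    show "integrable lborel (\<lambda>z. df z \<bullet> w)"
      by (rule integrable_continuous_bounded_support[where K = K]) (auto intro!: continuous_intros simp: supp')
    show "(\<lambda>z. indicator {z. snd z < h (fst z)} z * (df z \<bullet> w)) \<in> borel_measurable lborel"
      by simp
  qed (auto simp: indicator_def)
  have inta: "integrable lborel (\<lambda>z. ?I (snd z) * a (fst z) (snd z))"
  proof (rule Bochner_Integration.integrable_bound[of lborel "\<lambda>z. a (fst z) (snd z)"])
    show "integrable lborel (\<lambda>z. a (fst z) (snd z))"
      by (rule integrable_continuous_bounded_support[where K = "\<bar>K\<bar> + (\<bar>K\<bar> + B)"])
        (auto simp: a_def supp'[OF far] intro!: continuous_intros)
    have "continuous_on UNIV (\<lambda>z. a (fst z) (snd z))" unfolding a_def by (auto intro!: continuous_intros)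
    then have [measurable]: "(\<lambda>z. a (fst z) (snd z)) \<in> borel_measurable borel"
      by (rule borel_measurable_continuous_onI)
    have [measurable]: "(snd :: 'a \<times> real \<Rightarrow> real) \<in> borel_measurable borel"
      by (intro borel_measurable_continuous_onI continuous_intros)
    show "(\<lambda>z. ?I (snd z) * a (fst z) (snd z)) \<in> borel_measurable lborel" by simp
  qed (auto simp: indicator_def)
  have sec: "integrable lborel (\<lambda>s. ?I s * a y s)" "integrable lborel (\<lambda>s. ?I s * b y s)" for y
  proof -
    have *: "integrable lborel (\<lambda>s. ?I s * c s)"
      if "continuous_on UNIV c" "\<And>s. \<bar>K\<bar> + (\<bar>K\<bar> + B) < norm (y, s) \<Longrightarrow> c s = 0" for c :: "real \<Rightarrow> real"
    proof (rule Bochner_Integration.integrable_bound[of lborel c])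
      have [measurable]: "c \<in> borel_measurable borel" by (rule borel_measurable_continuous_onI[OF that(1)])
      show "integrable lborel c"
      proof (rule integrable_continuous_bounded_support[OF that(1), of "\<bar>K\<bar> + (\<bar>K\<bar> + B)"])
        fix s :: real assume "\<bar>K\<bar> + (\<bar>K\<bar> + B) < norm s"
        then show "c s = 0" by (intro that(2) less_le_trans[OF _ norm_snd_le])
      qed
      show "(\<lambda>s. ?I s * c s) \<in> borel_measurable lborel" by simp
    qed (auto simp: indicator_def)
    show "integrable lborel (\<lambda>s. ?I s * a y s)" "integrable lborel (\<lambda>s. ?I s * b y s)"
      by (auto intro!: * continuous_intros simp: a_def b_def supp'[OF far])
  qed
  have intb: "(LINT s|lborel. ?I s * b y s) = f (y, h y)" for y
  proof -
    \<comment> \<open>A height below the whole support, so the fundamental theorem of calculus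
      leaves only the value at \<open>s = 0\<close>.\<close>
    define L where "L = - (\<bar>K\<bar> + (\<bar>K\<bar> + B) + 1)"
    have L: "L \<le> 0" using B(2) by (simp add: L_def)
    have z: "f (y, s + h y) = 0" "b y s = 0" if "s \<le> L" for s
    proof -
      have "\<bar>K\<bar> + (\<bar>K\<bar> + B) < norm (y, s)"
        using norm_snd_le[of s y] that L unfolding L_def by auto
      from far[OF this] show "f (y, s + h y) = 0" "b y s = 0" using supp supp' by (auto simp: b_def)
    qed
    have d: "((\<lambda>s. f (y, s + h y)) has_real_derivative b y s) (at s)" for s
    proof -
      have "((\<lambda>s. f (y, s + h y)) has_derivative (\<lambda>t. (0, t) \<bullet> df (y, s + h y))) (at s)"
      proof (rule has_derivative_compose[where g = f and f = "\<lambda>s. (y, s + h y)"])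
        show "((\<lambda>s. (y, s + h y)) has_derivative (\<lambda>t. (0, t))) (at s)"
          by (auto intro!: derivative_eq_intros)
        show "(f has_derivative (\<lambda>v. v \<bullet> df (y, s + h y))) (at (y, s + h y))"
          using GDERIV_has_derivative[OF c1_onD[OF f]] by simp
      qed
      then show ?thesis
        by (simp add: has_field_derivative_def b_def inner_prod_def mult.commute[of _ "snd (df (y, s + h y))"])
    qed
    have [measurable]: "(\<lambda>s. snd (df (y, s + h y))) \<in> borel_measurable borel"
      by (intro borel_measurable_continuous_onI continuous_intros) auto
    have "(LINT s|lborel. ?I s * b y s) = (LINT s|lborel. indicator {L..0} s *\<^sub>R b y s)"
    proof (rule integral_cong_AE)
      have "AE s in lborel. s \<noteq> (0::real)" by (rule AE_lborel_singleton)
      then show "AE s in lborel. ?I s * b y s = indicator {L..0} s *\<^sub>R b y s"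
      proof eventually_elim
        case (elim s) then show ?case using z(2)[of s] by (auto simp: indicator_def)
      qed
    qed (auto simp: b_def)
    also have "\<dots> = f (y, 0 + h y) - f (y, L + h y)"
    proof (rule integral_FTC_Icc[OF L])
      show "((\<lambda>s. f (y, s + h y)) has_vector_derivative b y s) (at s within {L..0})" for s
        unfolding has_real_derivative_iff_has_vector_derivative[symmetric]
        by (rule has_field_derivative_at_within[OF d])
      show "continuous_on {L..0} (b y)" unfolding b_def by (intro continuous_intros) auto
    qed
    finally show ?thesis using z(1)[of L] by simp
  qed
  have zero: "(LINT y|lborel. a y s) = 0" for s
  proof -
    have "c1_on UNIV (\<lambda>y. f (y, s + h y)) (\<lambda>y. fst (df (y, s + h y)) + snd (df (y, s + h y)) *\<^sub>R dh y)"
      unfolding c1_on_def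
    proof (intro conjI ballI)
      fix y
      have "((\<lambda>y. f (y, s + h y)) has_derivative (\<lambda>v. (v, v \<bullet> dh y) \<bullet> df (y, s + h y))) (at y)"
      proof (rule has_derivative_compose[where g = f and f = "\<lambda>y. (y, s + h y)"])
        show "((\<lambda>y. (y, s + h y)) has_derivative (\<lambda>v. (v, v \<bullet> dh y))) (at y)"
          using GDERIV_has_derivative[OF c1_onD[OF h, of y]] by (auto intro!: derivative_eq_intros)
        show "(f has_derivative (\<lambda>v. v \<bullet> df (y, s + h y))) (at (y, s + h y))"
          using GDERIV_has_derivative[OF c1_onD[OF f]] by simp
      qed
      then show "GDERIV (\<lambda>y. f (y, s + h y)) y :> fst (df (y, s + h y)) + snd (df (y, s + h y)) *\<^sub>R dh y"
        by (simp add: gderiv_def inner_prod_def inner_add_right mult.commute)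
    qed (auto intro!: continuous_intros)
    moreover have "f (y, s + h y) = 0" if "\<bar>K\<bar> + (\<bar>K\<bar> + B) < norm y" for y
      by (intro supp far less_le_trans[OF that norm_fst_le])
    ultimately have "(LINT y|lborel. (fst (df (y, s + h y)) + snd (df (y, s + h y)) *\<^sub>R dh y) \<bullet> e) = 0"
      by (rule integral_gradient_zero)
    then show ?thesis by (simp add: a_def inner_add_left)
  qed
  have "(LINT z|lborel. indicator {z. snd z < h (fst z)} z * (df z \<bullet> w)) =
      (LINT y|lborel. LINT t|lborel. indicator {z. snd z < h (fst z)} (y, t) * (df (y, t) \<bullet> w))"
    using lborel_pair.integral_fst'[of "\<lambda>z. indicator {z. snd z < h (fst z)} z * (df z \<bullet> w)"] int1
    by (simp add: lborel_prod)
  also have "\<dots> = (LINT y|lborel. (LINT s|lborel. ?I s * a y s) + (\<tau> - dh y \<bullet> e) * f (y, h y))"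
  proof (intro Bochner_Integration.integral_cong refl)
    fix y
    have [measurable]: "(\<lambda>t. df (y, t)) \<in> borel_measurable borel"
      by (intro borel_measurable_continuous_onI continuous_intros) auto
    have "(LINT t|lborel. indicator {z. snd z < h (fst z)} (y, t) * (df (y, t) \<bullet> w)) =
      (LINT s|lborel. indicator {z. snd z < h (fst z)} (y, s + h y) * (df (y, s + h y) \<bullet> w))"
      by (rule lborel_translate_integral[symmetric]) measurable
    also have "\<dots> = (LINT s|lborel. ?I s * a y s + (\<tau> - dh y \<bullet> e) * (?I s * b y s))"
      by (intro Bochner_Integration.integral_cong refl) (simp add: ab indicator_def)
    also have "\<dots> = (LINT s|lborel. ?I s * a y s) + (\<tau> - dh y \<bullet> e) * f (y, h y)"
      using sec[of y] by (simp add: intb)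
    finally show "(LINT t|lborel. indicator {z. snd z < h (fst z)} (y, t) * (df (y, t) \<bullet> w)) =
       (LINT s|lborel. ?I s * a y s) + (\<tau> - dh y \<bullet> e) * f (y, h y)" .
  qed
  also have "\<dots> = (LINT y|lborel. LINT s|lborel. ?I s * a y s) + (LINT y|lborel. (\<tau> - dh y \<bullet> e) * f (y, h y))"
  proof (rule Bochner_Integration.integral_add)
    show "integrable lborel (\<lambda>y. LINT s|lborel. ?I s * a y s)"
      using lborel_pair.integrable_fst'[of "\<lambda>z. ?I (snd z) * a (fst z) (snd z)"] inta
      by (simp add: lborel_prod)
    show "integrable lborel (\<lambda>y. (\<tau> - dh y \<bullet> e) * f (y, h y))"
    proof (rule integrable_continuous_bounded_support[where K = K])
      show "continuous_on UNIV (\<lambda>y. (\<tau> - dh y \<bullet> e) * f (y, h y))" by (auto intro!: continuous_intros)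
      show "(\<tau> - dh y \<bullet> e) * f (y, h y) = 0" if "K < norm y" for y
        using supp[OF less_le_trans[OF that norm_fst_le]] by simp
    qed
  qed
  also have "(LINT y|lborel. LINT s|lborel. ?I s * a y s) = (LINT s|lborel. LINT y|lborel. ?I s * a y s)"
  proof (rule lborel_pair.Fubini_integral[symmetric])
    show "integrable (lborel \<Otimes>\<^sub>M lborel) (case_prod (\<lambda>y s. ?I s * a y s))"
      using inta by (simp add: lborel_prod case_prod_beta')
  qed
  also have "\<dots> = 0" using zero by simp
  finally show ?thesis by (simp add: e_def \<tau>_def)
qed

section \<open>Implicit functions and boundary charts\<close>

lemma c1_mvt:
  assumes f: "c1_on U f g" and U: "closed_segment x y \<subseteq> U"
  obtains \<xi> where "\<xi> \<in> closed_segment x y" "f y - f x = (y - x) \<bullet> g \<xi>"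
proof -
  define c where "c t = x + t *\<^sub>R (y - x)" for t
  have seg: "c t \<in> closed_segment x y" if "0 \<le> t" "t \<le> 1" for t
    using that by (auto simp: c_def closed_segment_def algebra_simps intro!: exI[of _ t])
  have d: "((\<lambda>t. f (c t)) has_real_derivative (y - x) \<bullet> g (c t)) (at t)" if "0 \<le> t" "t \<le> 1" for t
  proof -
    have "((\<lambda>t. f (c t)) has_derivative (\<lambda>s. (s *\<^sub>R (y - x)) \<bullet> g (c t))) (at t)"
    proof (rule has_derivative_compose[where g = f and f = c])
      show "(c has_derivative (\<lambda>s. s *\<^sub>R (y - x))) (at t)"
        unfolding c_def by (auto intro!: derivative_eq_intros)
      show "(f has_derivative (\<lambda>v. v \<bullet> g (c t))) (at (c t))"
        using GDERIV_has_derivative[OF c1_onD[OF f]] seg[OF that] U by blast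
    qed
    then show ?thesis
      by (simp add: has_field_derivative_def mult.commute[of _ "(y - x) \<bullet> g (c t)"])
  qed
  obtain t where t: "0 < t" "t < 1" "f (c 1) - f (c 0) = (1 - 0) * ((y - x) \<bullet> g (c t))"
    using MVT2[of 0 1 "\<lambda>t. f (c t)" "\<lambda>t. (y - x) \<bullet> g (c t)"] d by auto
  then show ?thesis using that[of "c t"] seg[of t] by (simp add: c_def)
qed

text \<open>At 0 the gradient is vertical, so nearby \<rho> increases strictly along vertical lines
  while its horizontal gradient stays small relative to the vertical derivative. The intermediate
  value theorem then yields the graph, strict monotonicity identifies the sublevel set with the
  region below it, and the mean value theorem yields the slope.\<close>

lemma implicit_graph:
  fixes \<rho> :: "'a::euclidean_space \<times> real \<Rightarrow> real"
  assumes \<rho>: "c1_on U \<rho> g" and U: "open U" "0 \<in> U" and \<rho>0: "\<rho> 0 = 0"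
    and g0: "fst (g 0) = 0" "snd (g 0) > 0" and \<epsilon>: "\<epsilon> > 0"
  obtains r s h dh where "r > 0" "s > 0" "ball 0 r \<times> {-s..s} \<subseteq> U" "c1_on (ball 0 r) h dh"
    "\<And>y. norm y < r \<Longrightarrow> norm (dh y) \<le> \<epsilon>"
    "\<And>y t. norm y < r \<Longrightarrow> \<bar>t\<bar> \<le> s \<Longrightarrow> \<rho> (y, t) < 0 \<longleftrightarrow> t < h y"
proof -
  \<comment> \<open>A lower bound for the vertical derivative near 0. With the horizontal gradient
    kept below \<open>\<epsilon> * c\<close>, the quotient that gives the slope is at most
    \<epsilon>.\<close>
  define c where "c = snd (g 0) / 2"
  have c: "c > 0" using g0 by (simp add: c_def)
  have cg: "continuous_on U g" by (rule c1_on_continuous_gradient[OF \<rho>])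
  have c\<rho>: "continuous_on U \<rho>" by (rule c1_on_continuous[OF \<rho>])
  have "open {z \<in> U. c < snd (g z)}" "open {z \<in> U. norm (fst (g z)) < \<epsilon> * c}"
    by (intro continuous_open_preimage[OF _ U(1), of "\<lambda>z. snd (g z)" "{c<..}", simplified vimage_def Int_def, simplified]
        continuous_intros cg, intro continuous_open_preimage[OF _ U(1), of "\<lambda>z. norm (fst (g z))" "{..<\<epsilon> * c}", simplified vimage_def Int_def, simplified]
        continuous_intros cg)
  then have "open ({z \<in> U. c < snd (g z)} \<inter> {z \<in> U. norm (fst (g z)) < \<epsilon> * c})" by (rule open_Int)
  moreover have "0 \<in> {z \<in> U. c < snd (g z)} \<inter> {z \<in> U. norm (fst (g z)) < \<epsilon> * c}"
    using U c \<epsilon> g0 by (auto simp: c_def)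
  ultimately obtain d where d: "d > 0" "ball 0 d \<subseteq> {z \<in> U. c < snd (g z)} \<inter> {z \<in> U. norm (fst (g z)) < \<epsilon> * c}"
    by (rule openE)
  then have dU: "ball 0 d \<subseteq> U" and gs: "\<And>z. norm z < d \<Longrightarrow> c < snd (g z)"
    and gf: "\<And>z. norm z < d \<Longrightarrow> norm (fst (g z)) < \<epsilon> * c" by (auto simp: subset_iff)
  have \<rho>d: "c1_on (ball 0 d) \<rho> g" by (rule c1_on_subset[OF \<rho> dU])
  define s where "s = d / 2"
  have s: "s > 0" using d by (simp add: s_def)
  have small: "norm (y, t) < d" if "norm y < s" "\<bar>t\<bar> \<le> s" for y :: 'a and t
    using norm_Pair_le[of y t] that by (simp add: s_def)
  have mono: "\<rho> (y, t1) < \<rho> (y, t2)" if "norm y < s" "\<bar>t1\<bar> \<le> s" "\<bar>t2\<bar> \<le> s" "t1 < t2" for y t1 t2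
  proof -
    have "closed_segment (y, t1) (y, t2) \<subseteq> ball 0 d"
      by (intro closed_segment_subset) (use small that in auto)
    then obtain \<xi> where \<xi>: "\<xi> \<in> closed_segment (y, t1) (y, t2)" "\<rho> (y, t2) - \<rho> (y, t1) = ((y, t2) - (y, t1)) \<bullet> g \<xi>"
      by (rule c1_mvt[OF \<rho>d])
    have "\<xi> \<in> ball 0 d" using \<xi> \<open>_ \<subseteq> ball 0 d\<close> by blast
    then have "0 < snd (g \<xi>)" using gs[of \<xi>] c by auto
    moreover have "\<rho> (y, t2) - \<rho> (y, t1) = (t2 - t1) * snd (g \<xi>)" using \<xi>(2) by (simp add: inner_prod_def)
    ultimately show ?thesis using that by (smt (verit) mult_pos_pos)
  qed
  have "\<exists>r>0. r \<le> s \<and> (\<forall>y. norm y < r \<longrightarrow> \<rho> (y, - s) < 0 \<and> 0 < \<rho> (y, s))"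
  proof -
    have z: "(0, 0) = (0 :: 'a \<times> real)" by (simp add: zero_prod_def)
    have sgn: "\<rho> (0, - s) < 0" "0 < \<rho> (0, s)" using mono[of 0 "-s" 0] mono[of 0 0 s] s \<rho>0 by (auto simp: z)
    have lim: "((\<lambda>y. \<rho> (y, t)) \<longlongrightarrow> \<rho> (0, t)) (nhds 0)" if "\<bar>t\<bar> \<le> s" for t
    proof -
      have "continuous_on (ball 0 s) (\<lambda>y. \<rho> (y, t))"
        by (rule continuous_on_compose2[OF c1_on_continuous[OF \<rho>d]]) (use small that in \<open>auto intro!: continuous_intros\<close>)
      then have "isCont (\<lambda>y. \<rho> (y, t)) 0"
        using s by (simp add: continuous_on_eq_continuous_at)
      then show ?thesis unfolding isCont_def
        using tendsto_at_iff_tendsto_nhds[of "\<lambda>y. \<rho> (y, t)" 0] by blast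
    qed
    have "\<forall>\<^sub>F y in nhds 0. \<rho> (y, - s) < 0" "\<forall>\<^sub>F y in nhds 0. 0 < \<rho> (y, s)"
      using order_tendstoD(2)[OF lim sgn(1)] order_tendstoD(1)[OF lim sgn(2)] s by auto
    then have "\<forall>\<^sub>F y in nhds 0. \<rho> (y, - s) < 0 \<and> 0 < \<rho> (y, s)" by (rule eventually_conj)
    then obtain r where "r > 0" "\<And>y. norm y < r \<Longrightarrow> \<rho> (y, - s) < 0 \<and> 0 < \<rho> (y, s)"
      by (auto simp: eventually_nhds_metric)
    then show ?thesis using s by (intro exI[of _ "min r s"]) auto
  qed
  then obtain r where r: "r > 0" "r \<le> s" "\<And>y. norm y < r \<Longrightarrow> \<rho> (y, - s) < 0" "\<And>y. norm y < r \<Longrightarrow> 0 < \<rho> (y, s)"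
    by blast
  have "\<exists>t. \<bar>t\<bar> \<le> s \<and> \<rho> (y, t) = 0" if "norm y < r" for y
  proof -
    have "continuous_on {-s..s} (\<lambda>t. \<rho> (y, t))"
      by (rule continuous_on_compose2[OF c1_on_continuous[OF \<rho>d]])
        (use small r that in \<open>auto intro!: continuous_intros\<close>)
    then have "\<exists>t. - s \<le> t \<and> t \<le> s \<and> \<rho> (y, t) = 0"
      using r that s by (intro IVT') (auto intro: less_imp_le)
    then show ?thesis by (auto simp: abs_le_iff)
  qed
  then obtain h where h: "\<And>y. norm y < r \<Longrightarrow> \<bar>h y\<bar> \<le> s" "\<And>y. norm y < r \<Longrightarrow> \<rho> (y, h y) = 0"
    by metis
  have below: "\<rho> (y, t) < 0 \<longleftrightarrow> t < h y" if "norm y < r" "\<bar>t\<bar> \<le> s" for y t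
    using mono[of y t "h y"] mono[of y "h y" t] h[OF that(1)] that r
    by (cases t "h y" rule: linorder_cases) auto
  \<comment> \<open>The slope formula of implicit differentiation, kept as a function of all points
    so that it can be evaluated off the graph.\<close>
  define G where "G z = (- 1 / snd (g z)) *\<^sub>R fst (g z)" for z
  have cG: "continuous_on (ball 0 d) G"
    unfolding G_def using gs c by (intro continuous_intros continuous_on_subset[OF cg dU]) (force simp: less_le)
  have Gle: "norm (G z) \<le> \<epsilon>" if "norm z < d" for z
  proof -
    have "norm (G z) = norm (fst (g z)) / snd (g z)" using gs[OF that] c by (simp add: G_def)
    also have "\<dots> \<le> (\<epsilon> * c) / c" using gs[OF that] gf[OF that] c \<epsilon> by (intro frac_le) auto
    finally show ?thesis using c by simp
  qed
  \<comment> \<open>The mean value theorem between two points of the graph, at both of which \<rho>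
    vanishes, solved for the difference of heights. The intermediate point lies on the
    chord.\<close>
  have hd: "\<exists>\<xi>\<in>closed_segment (y, h y) (y', h y'). norm \<xi> < d \<and> h y' - h y = (y' - y) \<bullet> G \<xi>"
    if "norm y < r" "norm y' < r" for y y'
  proof -
    have sub: "closed_segment (y, h y) (y', h y') \<subseteq> ball 0 d"
      by (intro closed_segment_subset) (use small h r that in auto)
    then obtain \<xi> where \<xi>: "\<xi> \<in> closed_segment (y, h y) (y', h y')"
       "\<rho> (y', h y') - \<rho> (y, h y) = ((y', h y') - (y, h y)) \<bullet> g \<xi>"
      by (rule c1_mvt[OF \<rho>d])
    have n: "norm \<xi> < d" using \<xi> sub by auto
    have "(y' - y) \<bullet> fst (g \<xi>) + (h y' - h y) * snd (g \<xi>) = 0"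
      using \<xi>(2) h that by (simp add: inner_prod_def)
    then have "(h y' - h y) * snd (g \<xi>) = - ((y' - y) \<bullet> fst (g \<xi>))" by linarith
    then have "h y' - h y = (y' - y) \<bullet> G \<xi>"
      using gs[OF n] c by (simp add: G_def field_simps)
    then show ?thesis using \<xi> n by blast
  qed
  have lip: "\<bar>h y' - h y\<bar> \<le> \<epsilon> * norm (y' - y)" if "norm y < r" "norm y' < r" for y y'
  proof -
    obtain \<xi> where \<xi>: "norm \<xi> < d" "h y' - h y = (y' - y) \<bullet> G \<xi>" using hd[OF \<open>norm y < r\<close> \<open>norm y' < r\<close>] by blast
    have "\<bar>(y' - y) \<bullet> G \<xi>\<bar> \<le> norm (y' - y) * norm (G \<xi>)" by (rule Cauchy_Schwarz_ineq2)
    also have "\<dots> \<le> norm (y' - y) * \<epsilon>" by (intro mult_left_mono Gle \<xi>) auto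
    finally show ?thesis using \<xi> by (simp add: mult.commute)
  qed
  define dh where "dh y = G (y, h y)" for y
  have chh: "continuous_on (ball 0 r) h"
    using lip \<epsilon> by (intro lipschitz_on_continuous_on[of \<epsilon>] lipschitz_onI) (auto simp: dist_norm dist_commute)
  have inb: "norm (y, h y) < d" if "norm y < r" for y using small h r that by auto
  have c1: "c1_on (ball 0 r) h dh"
    unfolding c1_on_def
  proof
    show "continuous_on (ball 0 r) dh" unfolding dh_def
      by (rule continuous_on_compose2[OF cG]) (use inb in \<open>auto intro!: continuous_intros chh\<close>)
    show "\<forall>y\<in>ball 0 r. GDERIV h y :> dh y"
      unfolding gderiv_def has_derivative_at_alt
    proof (intro ballI conjI allI impI)
      show "bounded_linear (\<lambda>v. v \<bullet> dh y)" for y by (rule bounded_linear_inner_left)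
      fix y :: 'a and e :: real assume y: "y \<in> ball 0 r" and e: "0 < e"
      have "continuous_on (ball 0 d) G" by (rule cG)
      then have "\<exists>\<delta>>0. \<forall>z\<in>ball 0 d. dist z (y, h y) < \<delta> \<longrightarrow> dist (G z) (G (y, h y)) < e"
        using inb[of y] y e unfolding continuous_on_iff by auto
      then obtain \<delta> where \<delta>: "\<delta> > 0" "\<And>z. norm z < d \<Longrightarrow> dist z (y, h y) < \<delta> \<Longrightarrow> dist (G z) (G (y, h y)) < e"
        by auto
      \<comment> \<open>Moving \<open>y\<close> moves the point on the graph by at most the factor
        \<open>1 + \<epsilon>\<close>, and the intermediate point lies between the two ends.\<close>
      define \<delta>' where "\<delta>' = min (r - norm y) (\<delta> / (1 + \<epsilon>))"
      have "\<delta>' > 0" using y \<delta> \<epsilon> by (auto simp: \<delta>'_def)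
      moreover have "norm (h y' - h y - (y' - y) \<bullet> dh y) \<le> e * norm (y' - y)" if y': "norm (y' - y) < \<delta>'" for y'
      proof -
        have "norm y' < r" using y' norm_triangle_ineq2[of y' y] by (auto simp: \<delta>'_def)
        then obtain \<xi> where \<xi>: "\<xi> \<in> closed_segment (y, h y) (y', h y')" "norm \<xi> < d" "h y' - h y = (y' - y) \<bullet> G \<xi>"
          using hd[of y y'] y by auto
        have "norm (\<xi> - (y, h y)) \<le> norm ((y', h y') - (y, h y))" by (rule segment_bound1[OF \<xi>(1)])
        also have "\<dots> \<le> norm (y' - y) + \<bar>h y' - h y\<bar>" using norm_Pair_le[of "y' - y" "h y' - h y"] by simp
        also have "\<dots> \<le> (1 + \<epsilon>) * norm (y' - y)" using lip[of y y'] y \<open>norm y' < r\<close> by (simp add: algebra_simps)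
        also have "\<dots> < \<delta>" using y' \<epsilon> by (auto simp: \<delta>'_def field_simps)
        finally have "dist (G \<xi>) (G (y, h y)) < e" by (intro \<delta>(2) \<xi>) (simp add: dist_norm)
        then have "norm (G \<xi> - dh y) \<le> e" by (simp add: dist_norm dh_def)
        have "norm (h y' - h y - (y' - y) \<bullet> dh y) = \<bar>(y' - y) \<bullet> (G \<xi> - dh y)\<bar>"
          by (simp add: \<xi>(3) inner_diff_right)
        also have "\<dots> \<le> norm (y' - y) * norm (G \<xi> - dh y)" by (rule Cauchy_Schwarz_ineq2)
        also have "\<dots> \<le> norm (y' - y) * e" by (intro mult_left_mono) (fact, simp)
        finally show ?thesis by (simp add: mult.commute)
      qed
      ultimately show "\<exists>d>0. \<forall>y'. norm (y' - y) < d \<longrightarrow> norm (h y' - h y - (y' - y) \<bullet> dh y) \<le> e * norm (y' - y)"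
        by blast
    qed
  qed
  show ?thesis
  proof (rule that[OF r(1) s _ c1])
    show "ball 0 r \<times> {- s..s} \<subseteq> U" using small r dU by (auto simp: subset_iff)
    show "norm (dh y) \<le> \<epsilon>" if "norm y < r" for y using Gle[OF inb[OF that]] by (simp add: dh_def)
  qed (rule below)
qed

text \<open>The hyperplane orthogonal to \<nu> has the dimension of \<open>'a\<close> and is
  therefore an isometric image of it; the real factor is mapped to the normal line.\<close>

lemma adapted_isometry:
  fixes \<nu> :: "'b::euclidean_space"
  assumes dim: "DIM('b) = Suc DIM('a::euclidean_space)" and \<nu>: "norm \<nu> = 1"
  obtains Q :: "'a::euclidean_space \<times> real \<Rightarrow> 'b" where "linear Q" "\<And>z. norm (Q z) = norm z" "surj Q" "Q (0, 1) = \<nu>"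
proof -
  have \<nu>\<nu>: "\<nu> \<bullet> \<nu> = 1" using \<nu> by (simp add: norm_eq_1)
  have "dim (UNIV :: 'a set) = dim {x. \<nu> \<bullet> x = 0}"
    using \<nu> dim by (subst dim_hyperplane) auto
  then obtain f :: "'a \<Rightarrow> 'b" where f: "linear f" "range f = {x. \<nu> \<bullet> x = 0}" "\<And>y. norm (f y) = norm y"
    using isometries_subspaces[OF subspace_UNIV subspace_hyperplane[of \<nu>]] by (metis UNIV_I)
  define Q where "Q z = f (fst z) + snd z *\<^sub>R \<nu>" for z
  have lin: "linear Q"
    by (rule linearI) (simp_all add: Q_def linear_add[OF f(1)] linear_scale[OF f(1)] algebra_simps)
  have nf: "\<nu> \<bullet> f y = 0" for y using f(2) by auto
  have "norm (Q z) = norm z" for z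
  proof -
    have "(norm (Q z))\<^sup>2 = (norm (f (fst z)))\<^sup>2 + (snd z)\<^sup>2"
      unfolding Q_def power2_norm_eq_inner
      using nf[of "fst z"] \<nu>\<nu> by (simp add: inner_add_left inner_add_right inner_commute[of "f (fst z)" \<nu>] power2_eq_square)
    also have "\<dots> = (norm z)\<^sup>2" by (simp add: f(3) norm_prod_def)
    finally show ?thesis by (simp add: power2_eq_iff_nonneg)
  qed
  moreover have "surj Q"
    unfolding surj_def
  proof
    fix x
    have "\<nu> \<bullet> (x - (x \<bullet> \<nu>) *\<^sub>R \<nu>) = 0" by (simp add: inner_diff_right \<nu>\<nu> inner_commute[of x \<nu>])
    then have "x - (x \<bullet> \<nu>) *\<^sub>R \<nu> \<in> range f" using f(2) by simp
    then obtain y where "x - (x \<bullet> \<nu>) *\<^sub>R \<nu> = f y" by blast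
    then have "f y = x - (x \<bullet> \<nu>) *\<^sub>R \<nu>" by (rule sym)
    then show "\<exists>z. x = Q z" by (intro exI[of _ "(y, x \<bullet> \<nu>)"]) (simp add: Q_def)
  qed
  moreover have "Q (0, 1) = \<nu>" by (simp add: Q_def linear_0[OF f(1)])
  ultimately show ?thesis using lin that by blast
qed

text \<open>A positive value would persist near \<open>x\<close> and keep \<Omega> away, while a
  negative one would put \<open>x\<close> into the open set \<Omega>.\<close>

lemma zero_on_frontier:
  assumes \<Omega>: "open \<Omega>" and W: "open W" and \<rho>: "continuous_on W \<rho>"
    and neg: "\<Omega> \<inter> W = {x \<in> W. \<rho> x < (0::real)}" and x: "x \<in> frontier \<Omega>" "x \<in> W"
  shows "\<rho> x = 0"
proof (rule ccontr)
  assume "\<rho> x \<noteq> 0"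
  moreover have "x \<notin> \<Omega>" "x \<in> closure \<Omega>" using x \<Omega> by (auto simp: frontier_def interior_open)
  ultimately have "0 < \<rho> x" using neg x by force
  have "open (W \<inter> \<rho> -` {0<..})" using \<rho> W by (intro continuous_open_preimage) auto
  moreover have "x \<in> W \<inter> \<rho> -` {0<..}" using \<open>0 < \<rho> x\<close> x by auto
  ultimately have "W \<inter> \<rho> -` {0<..} \<inter> \<Omega> \<noteq> {}"
    using \<open>x \<in> closure \<Omega>\<close> by (meson disjoint_iff open_Int_closure_eq_empty)
  then obtain x' where x': "x' \<in> \<Omega>" "x' \<in> W" "0 < \<rho> x'" by auto
  then have "x' \<in> {x \<in> W. \<rho> x < 0}" using neg by blast
  then show False using x' by simp
qed

locale onto_isometry =
  fixes Q :: "'a::euclidean_space \<Rightarrow> 'b::euclidean_space"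
  assumes linear_Q: "linear Q" and norm_Q: "norm (Q z) = norm z" and surj_Q: "surj Q"
begin

lemma inner_Q: "Q z \<bullet> Q w = z \<bullet> w"
  by (simp add: dot_norm linear_add[OF linear_Q, symmetric] norm_Q)

lemma inj_Q: "inj Q"
  unfolding linear_injective_0[OF linear_Q] using norm_Q by (metis norm_eq_zero)

lemma Q_inv [simp]: "Q (inv Q x) = x"
  by (rule surj_f_inv_f[OF surj_Q])

lemma inv_Q_inner: "Q z \<bullet> x = z \<bullet> inv Q x"
  by (metis inner_Q Q_inv)

lemma inner_inv_Q: "inv Q x \<bullet> inv Q y = x \<bullet> y"
  by (metis inner_Q Q_inv)

lemma dist_Q: "dist (p + Q z) (p + Q w) = dist z w"
  by (simp add: dist_norm linear_diff[OF linear_Q, symmetric] norm_Q)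

lemma continuous_Q: "continuous_on A Q"
  using linear_Q linear_conv_bounded_linear linear_continuous_on by blast

lemma continuous_inv_Q: "continuous_on A (inv Q)"
proof (rule lipschitz_on_continuous_on[of 1], rule lipschitz_onI)
  show "dist (inv Q x) (inv Q y) \<le> 1 * dist x y" for x y
    using dist_Q[of 0 "inv Q x" "inv Q y"] by simp
qed simp

lemma distr_lborel_Q:
  assumes "DIM('a) = DIM('b)"
  shows "distr lborel borel (\<lambda>z. p + Q z) = lborel"
proof (rule distr_lborel_isometry[OF assms dist_Q])
  show "surj (\<lambda>z. p + Q z)"
    unfolding surj_def
  proof
    fix x show "\<exists>z. x = p + Q z" by (rule exI[of _ "inv Q (x - p)"]) simp
  qed
qed

lemma c1_on_compose_Q:
  assumes f: "c1_on W f g"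
  shows "c1_on {z. p + Q z \<in> W} (\<lambda>z. f (p + Q z)) (\<lambda>z. inv Q (g (p + Q z)))"
  unfolding c1_on_def gderiv_def
proof (intro conjI ballI)
  show "continuous_on {z. p + Q z \<in> W} (\<lambda>z. inv Q (g (p + Q z)))"
    by (rule continuous_on_compose2[OF continuous_inv_Q[of UNIV]],
        rule continuous_on_compose2[OF c1_on_continuous_gradient[OF f]])
      (auto intro!: continuous_intros continuous_Q)
  fix z assume z: "z \<in> {z. p + Q z \<in> W}"
  have "bounded_linear Q" using linear_Q linear_conv_bounded_linear by blast
  then have "((\<lambda>z. p + Q z) has_derivative Q) (at z)"
    using has_derivative_add[OF has_derivative_const[of p] bounded_linear_imp_has_derivative[of Q]] by simp
  moreover have "(f has_derivative (\<lambda>v. v \<bullet> g (p + Q z))) (at (p + Q z))"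
    using GDERIV_has_derivative[OF c1_onD[OF f]] z by simp
  ultimately have "((\<lambda>z. f (p + Q z)) has_derivative (\<lambda>v. Q v \<bullet> g (p + Q z))) (at z)"
    by (rule has_derivative_compose)
  then show "((\<lambda>z. f (p + Q z)) has_derivative (\<lambda>v. v \<bullet> inv Q (g (p + Q z)))) (at z)"
    by (simp add: inv_Q_inner)
qed

end

locale graph_chart = onto_isometry Q
  for Q :: "'a::euclidean_space \<times> real \<Rightarrow> 'b::euclidean_space" +
  fixes p :: 'b and r \<epsilon> :: real
    and h :: "'a \<Rightarrow> real" and dh :: "'a \<Rightarrow> 'a" and \<Omega> :: "'b set"
  assumes dim: "DIM('b) = Suc DIM('a)"
    and r: "r > 0" and \<epsilon>: "\<epsilon> \<ge> 0" and h: "c1_on UNIV h dh"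
    and norm_dh: "norm y < r \<Longrightarrow> norm (dh y) \<le> \<epsilon>"
    and open_\<Omega>: "open \<Omega>"
    and below: "norm z < r \<Longrightarrow> p + Q z \<in> \<Omega> \<longleftrightarrow> snd z < h (fst z)"
begin

definition graph :: "'a \<Rightarrow> 'b" where "graph y = p + Q (y, h y)"

definition coord :: "'b \<Rightarrow> 'a \<times> real" where "coord x = inv Q (x - p)"

text \<open>The outward normal of the region below the graph, not normalized: its length is the area
  density of the graph over the tangent plane.\<close>

definition conormal :: "'a \<Rightarrow> 'b" where "conormal y = Q (- dh y, 1)"

lemma coord_chart [simp]: "coord (p + Q z) = z"
  by (simp add: coord_def inj_Q)

lemma chart_coord [simp]: "p + Q (coord x) = x"
  by (simp add: coord_def)

lemma norm_coord: "norm (coord x) = dist x p"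
  by (metis chart_coord norm_Q add_diff_cancel_left' dist_norm)

lemma dist_coord: "dist (coord x) (coord y) = dist x y"
  using dist_Q[of p "coord x" "coord y"] by simp

lemma continuous_h: "continuous_on A h"
  by (rule continuous_on_subset[OF c1_on_continuous[OF h]]) simp

lemma continuous_dh: "continuous_on A dh"
  by (rule continuous_on_subset[OF c1_on_continuous_gradient[OF h]]) simp

lemma continuous_coord: "continuous_on A coord"
  by (rule lipschitz_on_continuous_on[of 1]) (auto intro!: lipschitz_onI simp: dist_coord)

lemma continuous_graph: "continuous_on A graph"
  unfolding graph_def by (intro continuous_intros continuous_on_compose2[OF continuous_Q] continuous_h) auto

text \<open>Points of the graph are limits of points below it, and a point above the graph has a
  neighbourhood that misses \<Omega>.\<close>

lemma frontier_iff:
  assumes "norm z < r"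
  shows "p + Q z \<in> frontier \<Omega> \<longleftrightarrow> snd z = h (fst z)"
proof -
  have fr: "frontier \<Omega> = closure \<Omega> - \<Omega>" using open_\<Omega> by (simp add: frontier_def interior_open)
  have lim: "p + Q z \<in> closure \<Omega>" if eq: "snd z = h (fst z)"
  proof -
    define x where "x n = p + Q (fst z, snd z - 1 / real (Suc n))" for n
    have z: "(\<lambda>n. (fst z, snd z - 1 / real (Suc n))) \<longlonglongrightarrow> (fst z, snd z - 0)"
      by (intro tendsto_intros LIMSEQ_Suc[OF lim_1_over_n])
    have "isCont Q w" for w
      using continuous_Q[of UNIV] by (simp add: continuous_on_eq_continuous_at del: split_paired_All)
    then have "isCont (\<lambda>z. p + Q z) (fst z, snd z - 0)" by (intro continuous_intros)
    from isCont_tendsto_compose[OF this z] have "x \<longlonglongrightarrow> p + Q z"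
      unfolding x_def[abs_def] by (simp only: diff_zero prod.collapse)
    moreover have "\<forall>\<^sub>F n in sequentially. x n \<in> \<Omega>"
    proof -
      have "(\<lambda>n. norm (fst z, snd z - 1 / real (Suc n))) \<longlonglongrightarrow> norm (fst z, snd z - 0)"
        by (intro tendsto_norm z)
      then have "\<forall>\<^sub>F n in sequentially. norm (fst z, snd z - 1 / real (Suc n)) < r"
        using assms by (intro order_tendstoD(2)) simp_all
      then show ?thesis
        by eventually_elim (simp add: x_def below eq)
    qed
    moreover have "\<forall>\<^sub>F n in sequentially. x n \<in> closure \<Omega>"
      using calculation(2) by eventually_elim (use closure_subset in blast)
    ultimately show ?thesis by (intro Lim_in_closed_set[of "closure \<Omega>" x sequentially]) auto
  qed
  have above: "p + Q z \<notin> closure \<Omega>" if gt: "h (fst z) < snd z"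
  proof -
    let ?V = "coord -` ({w. norm w < r} \<inter> {w. h (fst w) < snd w})"
    have "open ?V"
      by (intro open_vimage continuous_coord open_Int open_Collect_less continuous_intros
          continuous_on_compose2[OF continuous_h]) auto
    moreover have "p + Q z \<in> ?V" using assms gt by simp
    moreover have "?V \<inter> \<Omega> = {}"
    proof -
      have "x \<notin> \<Omega>" if "x \<in> ?V" for x using below[of "coord x"] that by auto
      then show ?thesis by blast
    qed
    ultimately show ?thesis by (meson disjoint_iff open_Int_closure_eq_empty)
  qed
  show ?thesis using below[OF assms] lim above fr by (cases "snd z" "h (fst z)" rule: linorder_cases) auto
qed

lemma frontier_in_ball: "frontier \<Omega> \<inter> ball p r = graph ` {y. norm (y, h y) < r}"
proof (intro equalityI subsetI)
  fix x assume x: "x \<in> frontier \<Omega> \<inter> ball p r"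
  then have "norm (coord x) < r" by (simp add: norm_coord dist_commute)
  moreover from this have "snd (coord x) = h (fst (coord x))" using frontier_iff[of "coord x"] x by simp
  ultimately have "(fst (coord x), h (fst (coord x))) = coord x" by (simp add: prod_eq_iff)
  with \<open>norm (coord x) < r\<close> show "x \<in> graph ` {y. norm (y, h y) < r}"
    by (intro image_eqI[of _ _ "fst (coord x)"]) (simp_all add: graph_def)
next
  fix x assume "x \<in> graph ` {y. norm (y, h y) < r}"
  then obtain y where y: "x = graph y" "norm (y, h y) < r" by auto
  then have "dist p x = norm (y, h y)" by (metis graph_def norm_coord coord_chart dist_commute)
  then show "x \<in> frontier \<Omega> \<inter> ball p r" using y frontier_iff[of "(y, h y)"] by (simp add: graph_def)
qed

lemma conormal_nonzero: "conormal y \<noteq> 0"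
  using norm_Q[of "(- dh y, 1)"] unfolding conormal_def by (metis norm_eq_zero prod.inject zero_neq_one zero_prod_def)

lemma norm_conormal: "1 \<le> norm (conormal y)" "norm y < r \<Longrightarrow> norm (conormal y) \<le> 1 + \<epsilon>"
  using norm_snd_le[of "1::real" "- dh y"] norm_Pair_le[of "- dh y" "1::real"] norm_dh[of y]
  by (auto simp: conormal_def norm_Q)

text \<open>A defining function vanishes along the graph, so its gradient annihilates the tangent vectors
  \<open>Q (w, w \<bullet> dh y)\<close>; it is negative below the graph, which fixes the sign.\<close>

lemma gradient_of_defining_function:
  assumes y: "norm (y, h y) < r" and W: "open W" "graph y \<in> W"
    and zero: "\<And>x. x \<in> frontier \<Omega> \<Longrightarrow> x \<in> W \<Longrightarrow> \<rho> x = 0"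
    and neg: "\<And>x. x \<in> \<Omega> \<Longrightarrow> x \<in> W \<Longrightarrow> \<rho> x < 0"
    and g: "GDERIV \<rho> (graph y) :> g" "g \<noteq> 0"
  shows "sgn g = sgn (conormal y)"
proof -
  have der: "(\<rho> has_derivative (\<lambda>v. v \<bullet> g)) (at (graph y))" by (rule GDERIV_has_derivative[OF g(1)])
  have bQ: "bounded_linear Q" using linear_Q linear_conv_bounded_linear by blast
  have tangent: "Q (w, w \<bullet> dh y) \<bullet> g = 0" for w
  proof -
    have "(h has_derivative (\<lambda>v. v \<bullet> dh y)) (at (y + 0 *\<^sub>R w))"
      using GDERIV_has_derivative[OF c1_onD[OF h]] by simp
    moreover have l: "((\<lambda>s. y + s *\<^sub>R w) has_derivative (\<lambda>s. s *\<^sub>R w)) (at 0)"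
      by (auto intro!: derivative_eq_intros)
    ultimately have "((\<lambda>s. h (y + s *\<^sub>R w)) has_derivative (\<lambda>s. (s *\<^sub>R w) \<bullet> dh y)) (at 0)"
      by (rule has_derivative_compose[rotated])
    then have "((\<lambda>s. graph (y + s *\<^sub>R w)) has_derivative (\<lambda>s. Q (s *\<^sub>R w, (s *\<^sub>R w) \<bullet> dh y))) (at 0)"
      unfolding graph_def using l
      by (auto intro!: derivative_eq_intros bounded_linear.has_derivative[OF bQ])
    then have "((\<lambda>s. \<rho> (graph (y + s *\<^sub>R w))) has_derivative (\<lambda>s. Q (s *\<^sub>R w, (s *\<^sub>R w) \<bullet> dh y) \<bullet> g)) (at 0)"
      by (rule has_derivative_compose[where g = \<rho>]) (use der in simp)
    moreover have "Q (s *\<^sub>R w, (s *\<^sub>R w) \<bullet> dh y) = s *\<^sub>R Q (w, w \<bullet> dh y)" for s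
      using linear_scale[OF linear_Q, of s "(w, w \<bullet> dh y)"] by simp
    ultimately have "((\<lambda>s. \<rho> (graph (y + s *\<^sub>R w))) has_real_derivative (Q (w, w \<bullet> dh y) \<bullet> g)) (at 0)"
      by (simp add: has_field_derivative_def mult.commute[of _ "Q (w, w \<bullet> dh y) \<bullet> g"])
    moreover have "\<forall>\<^sub>F s in nhds 0. \<rho> (graph (y + s *\<^sub>R w)) = 0"
    proof -
      let ?V = "{s. norm (y + s *\<^sub>R w, h (y + s *\<^sub>R w)) < r} \<inter> (\<lambda>s. graph (y + s *\<^sub>R w)) -` W"
      have "open ?V"
        by (intro open_Int open_Collect_less open_vimage W(1) continuous_intros
            continuous_on_compose2[OF continuous_h] continuous_on_compose2[OF continuous_graph]) auto
      moreover have "0 \<in> ?V" using y W by simp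
      moreover have "\<rho> (graph (y + s *\<^sub>R w)) = 0" if "s \<in> ?V" for s
        using zero[of "graph (y + s *\<^sub>R w)"] frontier_in_ball that by blast
      ultimately show ?thesis unfolding eventually_nhds by blast
    qed
    then have "((\<lambda>s. \<rho> (graph (y + s *\<^sub>R w))) has_real_derivative (Q (w, w \<bullet> dh y) \<bullet> g)) (at 0) \<longleftrightarrow>
      ((\<lambda>s::real. 0) has_real_derivative (Q (w, w \<bullet> dh y) \<bullet> g)) (at 0)"
      by (intro DERIV_cong_ev) auto
    ultimately show ?thesis using DERIV_unique[OF _ DERIV_const] by blast
  qed
  obtain a b where ab: "g = Q (a, b)" using surj_Q by (metis prod.collapse surjD)
  have "a + b *\<^sub>R dh y = 0"
  proof -
    have "w \<bullet> (a + b *\<^sub>R dh y) = 0" for w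
      using tangent[of w] by (simp add: ab inner_Q inner_add_right mult.commute)
    then show ?thesis by (metis inner_eq_zero_iff)
  qed
  then have "a = b *\<^sub>R (- dh y)" by (simp add: eq_neg_iff_add_eq_0)
  then have gb: "g = b *\<^sub>R conormal y"
    using linear_scale[OF linear_Q, of b "(- dh y, 1)"] by (simp add: ab conormal_def)
  have "0 \<le> b"
  proof (rule ccontr)
    assume "\<not> 0 \<le> b"
    define e where "e = Q (0, 1 :: real)"
    have eg: "e \<bullet> g = b" by (simp add: e_def ab inner_Q)
    have "((\<lambda>s. graph y + s *\<^sub>R e) has_derivative (\<lambda>s. s *\<^sub>R e)) (at 0)"
      by (auto intro!: derivative_eq_intros)
    then have "((\<lambda>s. \<rho> (graph y + s *\<^sub>R e)) has_derivative (\<lambda>s. (s *\<^sub>R e) \<bullet> g)) (at 0)"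
      by (rule has_derivative_compose[where g = \<rho>]) (use der in simp)
    then have "((\<lambda>s. \<rho> (graph y + s *\<^sub>R e)) has_real_derivative b) (at 0)"
      by (simp add: has_field_derivative_def eg mult.commute[of _ b])
    then obtain d where d: "d > 0" "\<And>s. 0 < s \<Longrightarrow> s < d \<Longrightarrow> \<rho> (graph y + 0 *\<^sub>R e) < \<rho> (graph y + (0 - s) *\<^sub>R e)"
      using DERIV_neg_dec_left[of "\<lambda>s. \<rho> (graph y + s *\<^sub>R e)" b 0] \<open>\<not> 0 \<le> b\<close> by force
    have "graph y \<in> frontier \<Omega>" using frontier_in_ball y by blast
    then have \<rho>0: "\<rho> (graph y) = 0" using zero W by blast
    let ?V = "{s. norm (y, h y - s) < r} \<inter> (\<lambda>s. graph y + (0 - s) *\<^sub>R e) -` W"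
    have "open ?V"
      by (intro open_Int open_Collect_less open_vimage W(1) continuous_intros)
    moreover have "0 \<in> ?V" using y W by simp
    ultimately obtain d' where d': "d' > 0" "ball 0 d' \<subseteq> ?V" by (rule openE)
    define s where "s = min d d' / 2"
    have s: "0 < s" "s < d" "s \<in> ball 0 d'" using d d' by (auto simp: s_def)
    have sV: "s \<in> ?V" using d' s by blast
    have "graph y + (0 - s) *\<^sub>R e = p + Q (y, h y - s)"
    proof -
      have "Q (y, h y - s) = Q ((y, h y) - s *\<^sub>R (0, 1))" by simp
      also have "\<dots> = Q (y, h y) - s *\<^sub>R e" unfolding e_def
        by (simp only: linear_diff[OF linear_Q] linear_scale[OF linear_Q])
      finally show ?thesis by (simp add: graph_def)
    qed
    moreover have "p + Q (y, h y - s) \<in> \<Omega>" using below[of "(y, h y - s)"] sV s by simp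
    ultimately have "\<rho> (graph y + (0 - s) *\<^sub>R e) < 0" using neg sV by auto
    then show False using d(2)[OF s(1,2)] \<rho>0 by simp
  qed
  moreover have "b \<noteq> 0" using g(2) gb by auto
  ultimately show ?thesis using gb by (simp add: sgn_scaleR)
qed

end

text \<open>The implicit function is available only near 0; multiplied by a bump it becomes a global
  height function that is unchanged near the center.\<close>

lemma graph_chart_exists:
  fixes \<Omega> :: "'b::euclidean_space set"
  assumes dim: "DIM('b) = Suc DIM('a::euclidean_space)" and \<Omega>: "open \<Omega>"
    and W: "open W" "p \<in> W" and \<rho>: "c1_on W \<rho> g" "\<rho> p = 0" "g p \<noteq> 0"
    and neg: "\<Omega> \<inter> W = {x \<in> W. \<rho> x < 0}" and \<epsilon>: "\<epsilon> > 0"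
  obtains Q :: "'a::euclidean_space \<times> real \<Rightarrow> 'b" and r h dh where "graph_chart Q p r \<epsilon> h dh \<Omega>" "ball p r \<subseteq> W"
proof -
  have "norm (sgn (g p)) = 1" using \<rho>(3) by (simp add: norm_sgn)
  then obtain Q :: "'a \<times> real \<Rightarrow> 'b" where Q: "linear Q" "\<And>z. norm (Q z) = norm z" "surj Q" "Q (0, 1) = sgn (g p)"
    using adapted_isometry[OF dim] by blast
  interpret onto_isometry Q using Q by (simp add: onto_isometry_def)
  define U where "U = {z. p + Q z \<in> W}"
  have 1: "c1_on U (\<lambda>z. \<rho> (p + Q z)) (\<lambda>z. inv Q (g (p + Q z)))"
    unfolding U_def by (rule c1_on_compose_Q[OF \<rho>(1)])
  have 2: "open U"
  proof -
    have "continuous_on UNIV (\<lambda>z. p + Q z)" by (intro continuous_intros continuous_Q)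
    from open_vimage[OF W(1) this] show ?thesis by (simp add: U_def vimage_def)
  qed
  have Q0: "Q 0 = 0" by (rule linear_0[OF Q(1)])
  have "Q (norm (g p) *\<^sub>R (0, 1)) = g p"
    by (simp only: linear_scale[OF Q(1)] Q(4)) (simp add: sgn_div_norm \<rho>(3))
  then have "inv Q (g p) = norm (g p) *\<^sub>R (0, 1)" using inj_Q by (metis inv_f_f)
  then have 3: "fst (inv Q (g (p + Q 0))) = 0" "snd (inv Q (g (p + Q 0))) > 0"
    using \<rho>(3) by (simp_all add: Q0)
  have 4: "\<rho> (p + Q 0) = 0" "0 \<in> U" using \<rho>(2) W(2) by (simp_all add: Q0 U_def)
  obtain r0 s h0 dh0 where G: "r0 > 0" "s > 0" "ball 0 r0 \<times> {-s..s} \<subseteq> U" "c1_on (ball 0 r0) h0 dh0"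
    "\<And>y. norm y < r0 \<Longrightarrow> norm (dh0 y) \<le> \<epsilon>"
    "\<And>y t. norm y < r0 \<Longrightarrow> \<bar>t\<bar> \<le> s \<Longrightarrow> \<rho> (p + Q (y, t)) < 0 \<longleftrightarrow> t < h0 y"
    using implicit_graph[OF 1 2 4(2,1) 3 \<epsilon>] by blast
  obtain M :: real where "\<And>(p::'a) r. r > 0 \<Longrightarrow> \<exists>g. c1_on UNIV (bump p r) g \<and> (\<forall>x. norm (g x) \<le> M / r)"
    by (rule bump_c1) blast
  then obtain b' where b: "c1_on UNIV (bump (0::'a) (r0 / 4)) b'" using G(1) by (metis divide_pos_pos zero_less_numeral)
  \<comment> \<open>The bump is 1 up to radius \<open>r0 / 4\<close> and 0 from
    \<open>r0 / 2\<close> on, well inside the domain of \<open>h0\<close>.\<close>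
  define h where "h y = (if y \<in> ball 0 r0 then bump 0 (r0 / 4) y * h0 y else 0)" for y
  define dh where "dh y = (if y \<in> ball 0 r0 then bump 0 (r0 / 4) y *\<^sub>R dh0 y + h0 y *\<^sub>R b' y else 0)" for y
  have h: "c1_on UNIV h dh"
    unfolding h_def dh_def
  proof (rule c1_on_extend_zero)
    show "c1_on (ball 0 r0) (\<lambda>y. bump 0 (r0 / 4) y * h0 y) (\<lambda>y. bump 0 (r0 / 4) y *\<^sub>R dh0 y + h0 y *\<^sub>R b' y)"
      by (rule c1_on_mult[OF c1_on_subset[OF b] G(4)]) simp
    show "closed (cball (0::'a) (r0 / 2))" "cball (0::'a) (r0 / 2) \<subseteq> ball 0 r0" using G(1) by auto
    show "bump 0 (r0 / 4) x * h0 x = 0" if "x \<in> ball 0 r0 - cball 0 (r0 / 2)" for x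
      using bump_eq_0[of "r0 / 4" x 0] that G(1) by simp
  qed simp
  have heq: "h y = h0 y" if "norm y < r0 / 4" for y
    using that G(1) by (simp add: h_def bump_eq_1)
  have dheq: "dh y = dh0 y" if "norm y < r0 / 4" for y
  proof (rule GDERIV_unique)
    show "GDERIV h y :> dh y" by (rule c1_onD[OF h]) simp
    have "GDERIV h0 y :> dh0 y" using that G(1) by (intro c1_onD[OF G(4)]) auto
    then show "GDERIV h y :> dh0 y"
      by (rule GDERIV_transform[of _ _ _ "ball 0 (r0 / 4)"]) (use that heq in auto)
  qed
  \<comment> \<open>The first bound makes \<open>h\<close> agree with \<open>h0\<close>; the second
    keeps the vertical coordinate where the sign of \<rho> is controlled.\<close>
  define r where "r = min (r0 / 4) s"
  have inU: "norm (fst z) < r0" "\<bar>snd z\<bar> \<le> s" "norm (fst z) < r0 / 4" "p + Q z \<in> W" if "norm z < r" for z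
  proof -
    have *: "norm (fst z) < r" "\<bar>snd z\<bar> < r"
      using norm_fst_le[of "fst z" "snd z"] norm_snd_le[of "snd z" "fst z"] that by auto
    then show "norm (fst z) < r0" "\<bar>snd z\<bar> \<le> s" "norm (fst z) < r0 / 4" using G(1) by (auto simp: r_def)
    then have "z \<in> ball 0 r0 \<times> {-s..s}" by (cases z) (auto simp: abs_le_iff)
    then show "p + Q z \<in> W" using G(3) unfolding U_def by blast
  qed
  have "graph_chart Q p r \<epsilon> h dh \<Omega>"
  proof unfold_locales
    show "r > 0" using G by (simp add: r_def)
    show "norm (dh y) \<le> \<epsilon>" if "norm y < r" for y using that dheq[of y] G(1) G(5)[of y] by (simp add: r_def)
    show "p + Q z \<in> \<Omega> \<longleftrightarrow> snd z < h (fst z)" if "norm z < r" for z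
      using G(6)[OF inU(1,2)[OF that]] inU(4)[OF that] heq[OF inU(3)[OF that]] neg by auto
  qed (use dim \<Omega> \<epsilon> h in auto)
  moreover have "ball p r \<subseteq> W"
  proof
    fix x assume "x \<in> ball p r"
    then have "norm (inv Q (x - p)) < r"
      by (metis Q(2) Q_inv dist_norm dist_commute mem_ball)
    from inU(4)[OF this] show "x \<in> W" by simp
  qed
  ultimately show ?thesis by (rule that)
qed

section \<open>Flux and Hausdorff integrals in a chart\<close>

lemma nn_integral_le_cmult_measure:
  assumes "sets M = sets N" "\<And>A. A \<in> sets M \<Longrightarrow> emeasure M A \<le> c * emeasure N A" "f \<in> borel_measurable N"
  shows "nn_integral M f \<le> c * nn_integral N f"
proof -
  have "nn_integral M f \<le> nn_integral (scale_measure c N) f"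
    by (intro nn_integral_mono_measure) (use assms in \<open>auto simp: le_measure\<close>)
  then show ?thesis using assms(3) by (simp add: nn_integral_scale_measure)
qed

context graph_chart
begin

lemma continuous_conormal: "continuous_on A conormal"
  unfolding conormal_def by (intro continuous_on_compose2[OF continuous_Q] continuous_intros continuous_dh) auto

lemma dist_graph: "dist (graph y) p = norm (y, h y)"
  by (metis graph_def norm_coord coord_chart)

lemma coord_graph [simp]: "coord (graph y) = (y, h y)"
  by (simp add: graph_def)

text \<open>Each component of \<open>\<eta> * Z\<close> is extended by zero from the ball,
  transported by the isometry and integrated below the global graph. The right side is an integral
  over the tangent plane with the unnormalized normal, so no surface measure enters yet.\<close>

theorem divergence_theorem:
  assumes \<eta>: "c1_on UNIV \<eta> d\<eta>" and supp: "\<And>x. s < dist x p \<Longrightarrow> \<eta> x = 0" and s: "s < r"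
    and Z: "\<And>e. e \<in> Basis \<Longrightarrow> c1_on (ball p r) (\<lambda>x. Z x \<bullet> e) (dZ e)"
  shows "(LINT x|lborel. indicator \<Omega> x * (d\<eta> x \<bullet> Z x + \<eta> x * (\<Sum>e\<in>Basis. dZ e x \<bullet> e))) =
    (LINT y|lborel. \<eta> (graph y) * (Z (graph y) \<bullet> conormal y))"
proof -
  define F where "F e x = (if x \<in> ball p r then \<eta> x * (Z x \<bullet> e) else 0)" for e x
  define F' where "F' e x = (if x \<in> ball p r then \<eta> x *\<^sub>R dZ e x + (Z x \<bullet> e) *\<^sub>R d\<eta> x else 0)" for e x
  have [measurable]: "\<Omega> \<in> sets borel" using open_\<Omega> by auto
  have F: "c1_on UNIV (F e) (F' e)" if "e \<in> Basis" for e
    unfolding F_def F'_def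
  proof (rule c1_on_extend_zero)
    show "c1_on (ball p r) (\<lambda>x. \<eta> x * (Z x \<bullet> e)) (\<lambda>x. \<eta> x *\<^sub>R dZ e x + (Z x \<bullet> e) *\<^sub>R d\<eta> x)"
      by (rule c1_on_mult[OF c1_on_subset[OF \<eta>] Z[OF that]]) simp
    show "closed (cball p s)" "cball p s \<subseteq> ball p r" using s by auto
    show "\<eta> x * (Z x \<bullet> e) = 0" if "x \<in> ball p r - cball p s" for x
      using supp[of x] that by (simp add: dist_commute)
  qed simp
  have F'0: "F' e x = 0" if "x \<notin> ball p r" for e x using that by (simp add: F'_def)
  have c: "c1_on UNIV (\<lambda>z. F e (p + Q z)) (\<lambda>z. inv Q (F' e (p + Q z)))" if "e \<in> Basis" for e
    using c1_on_compose_Q[OF F[OF that], of p] by simp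
  have dQ: "dist (p + Q z) p = norm z" for z by (metis coord_chart norm_coord)
  have z0: "F e (p + Q z) = 0" if "r < norm z" for e z
    using dQ[of z] that by (simp add: F_def dist_commute)
  have intl: "integrable lborel (\<lambda>x. F' e x \<bullet> e)" if "e \<in> Basis" for e
  proof (rule integrable_continuous_bounded_support)
    show "continuous_on UNIV (\<lambda>x. F' e x \<bullet> e)"
      by (intro continuous_intros c1_on_continuous_gradient[OF F[OF that]])
    show "F' e x \<bullet> e = 0" if "norm p + r < norm x" for x
      using norm_triangle_ineq2[of x p] that by (subst F'0) (auto simp: dist_norm norm_minus_commute)
  qed
  have intl': "integrable lborel (\<lambda>x. indicator \<Omega> x * (F' e x \<bullet> e))" if "e \<in> Basis" for e
    using integrable_mult_indicator[OF _ intl[OF that], of \<Omega>] by simp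
  have intr: "integrable lborel (\<lambda>y. (conormal y \<bullet> e) * F e (graph y))" if "e \<in> Basis" for e
  proof (rule integrable_continuous_bounded_support)
    show "continuous_on UNIV (\<lambda>y. (conormal y \<bullet> e) * F e (graph y))"
      by (intro continuous_intros continuous_conormal continuous_on_compose2[OF c1_on_continuous[OF F[OF that]]]
          continuous_graph) auto
    show "(conormal y \<bullet> e) * F e (graph y) = 0" if "r < norm y" for y
      using dist_graph[of y] norm_fst_le[of y "h y"] that by (simp add: F_def dist_commute)
  qed
  have one: "(LINT x|lborel. indicator \<Omega> x * (F' e x \<bullet> e)) = (LINT y|lborel. (conormal y \<bullet> e) * F e (graph y))"
    if "e \<in> Basis" for e
  proof -
    have [measurable]: "F' e \<in> borel_measurable borel"
      by (rule borel_measurable_continuous_onI[OF c1_on_continuous_gradient[OF F[OF that]]])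
    have [measurable]: "Q \<in> borel_measurable borel" by (rule borel_measurable_continuous_onI[OF continuous_Q])
    have "(LINT x|lborel. indicator \<Omega> x * (F' e x \<bullet> e)) =
      (LINT x|distr lborel borel (\<lambda>z. p + Q z). indicator \<Omega> x * (F' e x \<bullet> e))"
      using dim by (simp add: distr_lborel_Q)
    also have "\<dots> = (LINT z|lborel. indicator \<Omega> (p + Q z) * (F' e (p + Q z) \<bullet> e))"
      by (rule integral_distr) measurable
    also have "\<dots> = (LINT z|lborel. indicator {z. snd z < h (fst z)} z * (inv Q (F' e (p + Q z)) \<bullet> inv Q e))"
    proof (rule Bochner_Integration.integral_cong[OF refl])
      fix z
      show "indicator \<Omega> (p + Q z) * (F' e (p + Q z) \<bullet> e) =
        indicator {z. snd z < h (fst z)} z * (inv Q (F' e (p + Q z)) \<bullet> inv Q e)"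
      proof (cases "norm z < r")
        case True then show ?thesis using below[OF True] by (simp add: inner_inv_Q indicator_def)
      next
        case False
        then have "F' e (p + Q z) = 0" using dQ[of z] by (intro F'0) (simp add: dist_commute)
        then show ?thesis by (simp add: inner_inv_Q)
      qed
    qed
    also have "\<dots> = (LINT y|lborel. (snd (inv Q e) - dh y \<bullet> fst (inv Q e)) * F e (p + Q (y, h y)))"
      by (rule divergence_below_graph[OF h c[OF that] z0])
    also have "\<dots> = (LINT y|lborel. (conormal y \<bullet> e) * F e (graph y))"
      by (intro Bochner_Integration.integral_cong refl) (simp add: conormal_def inv_Q_inner inner_prod_def graph_def)
    finally show ?thesis .
  qed
  have "(LINT x|lborel. indicator \<Omega> x * (d\<eta> x \<bullet> Z x + \<eta> x * (\<Sum>e\<in>Basis. dZ e x \<bullet> e))) =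
      (LINT x|lborel. (\<Sum>e\<in>Basis. indicator \<Omega> x * (F' e x \<bullet> e)))"
  proof (intro Bochner_Integration.integral_cong refl)
    fix x
    have "(\<Sum>e\<in>Basis. F' e x \<bullet> e) = d\<eta> x \<bullet> Z x + \<eta> x * (\<Sum>e\<in>Basis. dZ e x \<bullet> e)"
    proof (cases "x \<in> ball p r")
      case True
      have "d\<eta> x \<bullet> Z x = (\<Sum>e\<in>Basis. (Z x \<bullet> e) * (d\<eta> x \<bullet> e))"
        using euclidean_inner[of "Z x" "d\<eta> x"] by (simp add: inner_commute)
      then show ?thesis using True
        by (simp add: F'_def inner_add_left sum.distrib sum_distrib_left)
    next
      case False
      then have "s < dist x p" using s by (simp add: dist_commute)
      moreover have "open {x. s < dist x p}" by (intro open_Collect_less continuous_intros)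
      ultimately have "d\<eta> x = 0"
        using supp by (intro c1_on_gradient_zero[OF \<eta>, of "{x. s < dist x p}"]) auto
      then show ?thesis using supp[OF \<open>s < dist x p\<close>] False by (simp add: F'0)
    qed
    then show "indicator \<Omega> x * (d\<eta> x \<bullet> Z x + \<eta> x * (\<Sum>e\<in>Basis. dZ e x \<bullet> e)) =
       (\<Sum>e\<in>Basis. indicator \<Omega> x * (F' e x \<bullet> e))"
      by (simp add: sum_distrib_left[symmetric])
  qed
  also have "\<dots> = (\<Sum>e\<in>Basis. LINT x|lborel. indicator \<Omega> x * (F' e x \<bullet> e))"
    by (rule Bochner_Integration.integral_sum) (rule intl')
  also have "\<dots> = (\<Sum>e\<in>Basis. LINT y|lborel. (conormal y \<bullet> e) * F e (graph y))"
    by (intro sum.cong refl one)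
  also have "\<dots> = (LINT y|lborel. (\<Sum>e\<in>Basis. (conormal y \<bullet> e) * F e (graph y)))"
    by (rule Bochner_Integration.integral_sum[symmetric]) (rule intr)
  also have "\<dots> = (LINT y|lborel. \<eta> (graph y) * (Z (graph y) \<bullet> conormal y))"
  proof (intro Bochner_Integration.integral_cong refl)
    fix y
    have "F e (graph y) = \<eta> (graph y) * (Z (graph y) \<bullet> e)" for e
      using supp[of "graph y"] s by (auto simp: F_def dist_commute)
    then have "(\<Sum>e\<in>Basis. (conormal y \<bullet> e) * F e (graph y)) =
      (\<Sum>e\<in>Basis. \<eta> (graph y) * ((Z (graph y) \<bullet> e) * (conormal y \<bullet> e)))"
      by (simp add: ac_simps)
    also have "\<dots> = \<eta> (graph y) * (Z (graph y) \<bullet> conormal y)"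
      by (simp add: sum_distrib_left[symmetric] euclidean_inner[symmetric])
    finally show "(\<Sum>e\<in>Basis. (conormal y \<bullet> e) * F e (graph y)) = \<eta> (graph y) * (Z (graph y) \<bullet> conormal y)" .
  qed
  finally show ?thesis .
qed

lemma lipschitz_graph: "(1 + \<epsilon>)-lipschitz_on (ball 0 r) graph"
proof (rule lipschitz_onI)
  fix x y :: 'a assume xy: "x \<in> ball 0 r" "y \<in> ball 0 r"
  have "closed_segment y x \<subseteq> ball 0 r" using xy by (intro closed_segment_subset) auto
  moreover obtain \<xi> where "\<xi> \<in> closed_segment y x" "h x - h y = (x - y) \<bullet> dh \<xi>"
    by (rule c1_mvt[OF h subset_UNIV])
  ultimately have \<xi>: "\<xi> \<in> ball 0 r" "h x - h y = (x - y) \<bullet> dh \<xi>" by auto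
  have "\<bar>h x - h y\<bar> \<le> norm (x - y) * norm (dh \<xi>)" unfolding \<xi>(2) by (rule Cauchy_Schwarz_ineq2)
  also have "\<dots> \<le> norm (x - y) * \<epsilon>" using \<xi> norm_dh[of \<xi>] by (intro mult_left_mono) auto
  finally have "norm (x - y, h x - h y) \<le> norm (x - y) + norm (x - y) * \<epsilon>"
    using norm_Pair_le[of "x - y" "h x - h y"] by simp
  moreover have "dist (graph x) (graph y) = norm (x - y, h x - h y)"
    unfolding graph_def dist_Q by (simp add: dist_norm)
  ultimately show "dist (graph x) (graph y) \<le> (1 + \<epsilon>) * dist x y" by (simp add: dist_norm algebra_simps)
qed (use \<epsilon> in simp)

text \<open>The graph map is \<open>(1 + \<epsilon>)\<close>-Lipschitz on the relevant ball, and its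
  inverse, the projection to the tangent plane, is 1-Lipschitz. This compares the two measures set
  by set, hence also their integrals.\<close>

theorem hausdorff_integral_graph:
  fixes \<phi> :: "'b \<Rightarrow> ennreal"
  assumes [measurable]: "S \<in> sets borel" "\<phi> \<in> borel_measurable borel"
    and S: "S \<inter> ball p r = frontier \<Omega> \<inter> ball p r"
    and \<phi>: "\<And>x. x \<notin> ball p r \<Longrightarrow> \<phi> x = 0"
  shows "(\<integral>\<^sup>+y. \<phi> (graph y) \<partial>lborel) \<le> (\<integral>\<^sup>+x. indicator S x * \<phi> x \<partial>hausdorff_measure DIM('a))"
    and "(\<integral>\<^sup>+x. indicator S x * \<phi> x \<partial>hausdorff_measure DIM('a)) \<le>
      ennreal ((1 + \<epsilon>) ^ DIM('a)) * (\<integral>\<^sup>+y. \<phi> (graph y) \<partial>lborel)"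
proof -
  let ?H = "hausdorff_measure DIM('a) :: 'b measure"
  define D where "D = {y. norm (y, h y) < r}"
  define S' where "S' = S \<inter> ball p r"
  define \<pi> where "\<pi> x = fst (coord x)" for x
  have [measurable]: "D \<in> sets borel" unfolding D_def
    by (intro borel_open open_Collect_less continuous_intros continuous_h)
  have [measurable]: "S' \<in> sets borel" by (simp add: S'_def)
  have [measurable]: "graph \<in> borel_measurable borel" by (rule borel_measurable_continuous_onI[OF continuous_graph])
  have [measurable]: "\<pi> \<in> borel_measurable borel"
    unfolding \<pi>_def by (intro borel_measurable_continuous_onI continuous_intros continuous_coord)
  have S'g: "S' = graph ` D" unfolding S'_def S frontier_in_ball D_def ..
  have \<pi>g [simp]: "\<pi> (graph y) = y" for y by (simp add: \<pi>_def)
  have Dr: "D \<subseteq> ball 0 r" using norm_fst_le order_le_less_trans by (fastforce simp: D_def)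
  \<comment> \<open>Both sides become measures on the tangent plane: Lebesgue measure on
    \<open>D\<close>, and the projection of Hausdorff measure on the boundary piece.\<close>
  define M1 where "M1 = density (lborel :: 'a measure) (indicator D)"
  define M2 where "M2 = distr (density ?H (indicator S')) borel \<pi>"
  have sets: "sets M1 = sets M2" by (simp add: M1_def M2_def)
  have e1: "emeasure M1 A = hausdorff_outer_measure DIM('a) (D \<inter> A)" if "A \<in> sets borel" for A
    using that by (simp add: M1_def emeasure_restricted hausdorff_outer_measure_lborel)
  have e2: "emeasure M2 A = hausdorff_outer_measure DIM('a) (graph ` (D \<inter> A))" if [measurable]: "A \<in> sets borel" for A
  proof -
    have pA: "\<pi> -` A \<in> sets borel" using measurable_sets[of \<pi> borel borel A] by simp
    have "emeasure M2 A = emeasure (density ?H (indicator S')) (\<pi> -` A)"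
      unfolding M2_def by (subst emeasure_distr) (auto simp: measurable_cong_sets[OF sets_density refl])
    also have "\<dots> = emeasure ?H (S' \<inter> \<pi> -` A)"
      using pA by (intro emeasure_restricted) auto
    also have "\<dots> = hausdorff_outer_measure DIM('a) (S' \<inter> \<pi> -` A)"
      using pA by (intro emeasure_hausdorff_measure) auto
    also have "S' \<inter> \<pi> -` A = graph ` (D \<inter> A)" by (auto simp: S'g)
    finally show ?thesis .
  qed
  have "1-lipschitz_on X \<pi>" for X
  proof (rule lipschitz_onI)
    fix x y
    have "dist (\<pi> x) (\<pi> y) \<le> dist (coord x) (coord y)"
      unfolding \<pi>_def by (rule dist_fst_le)
    then show "dist (\<pi> x) (\<pi> y) \<le> 1 * dist x y" by (simp add: dist_coord)
  qed simp
  from hausdorff_outer_measure_lipschitz_le[OF this]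
  have "hausdorff_outer_measure DIM('a) (\<pi> ` (graph ` (D \<inter> A))) \<le> hausdorff_outer_measure DIM('a) (graph ` (D \<inter> A))" for A
    by simp
  then have le1: "emeasure M1 A \<le> 1 * emeasure M2 A" if "A \<in> sets M1" for A
    using that e1[of A] e2[of A] by (simp add: M1_def image_image)
  have le2: "emeasure M2 A \<le> ennreal ((1 + \<epsilon>) ^ DIM('a)) * emeasure M1 A" if "A \<in> sets M2" for A
    using that e1[of A] e2[of A] Dr \<epsilon>
      hausdorff_outer_measure_lipschitz_le[OF lipschitz_on_subset[OF lipschitz_graph], of "D \<inter> A" "DIM('a)"]
    by (auto simp: M2_def)
  have i1: "(\<integral>\<^sup>+y. \<phi> (graph y) \<partial>M1) = (\<integral>\<^sup>+y. \<phi> (graph y) \<partial>lborel)"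
    unfolding M1_def by (subst nn_integral_density)
      (auto intro!: nn_integral_cong simp: indicator_def D_def dist_graph[symmetric] dist_commute \<phi>)
  have i2: "(\<integral>\<^sup>+y. \<phi> (graph y) \<partial>M2) = (\<integral>\<^sup>+x. indicator S x * \<phi> x \<partial>?H)"
  proof -
    have "(\<integral>\<^sup>+y. \<phi> (graph y) \<partial>M2) = (\<integral>\<^sup>+x. \<phi> (graph (\<pi> x)) \<partial>density ?H (indicator S'))"
      unfolding M2_def by (rule nn_integral_distr) (simp_all add: measurable_cong_sets[OF sets_density refl])
    also have "\<dots> = (\<integral>\<^sup>+x. indicator S' x * \<phi> (graph (\<pi> x)) \<partial>?H)"
      by (rule nn_integral_density) simp_all
    also have "\<dots> = (\<integral>\<^sup>+x. indicator S x * \<phi> x \<partial>?H)"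
    proof (rule nn_integral_cong)
      fix x
      show "indicator S' x * \<phi> (graph (\<pi> x)) = indicator S x * \<phi> x"
      proof (cases "x \<in> S'")
        case True
        then have "graph (\<pi> x) = x" "x \<in> S" by (auto simp: S'g S'_def[symmetric], auto simp: S'_def)
        then show ?thesis using True by simp
      next
        case False
        then show ?thesis using \<phi>[of x] by (cases "x \<in> S") (auto simp: S'_def)
      qed
    qed
    finally show ?thesis .
  qed
  have m: "(\<lambda>y. \<phi> (graph y)) \<in> borel_measurable M1" "(\<lambda>y. \<phi> (graph y)) \<in> borel_measurable M2"
    by (simp_all add: M1_def M2_def measurable_cong_sets[OF sets_density refl])
  show "(\<integral>\<^sup>+y. \<phi> (graph y) \<partial>lborel) \<le> (\<integral>\<^sup>+x. indicator S x * \<phi> x \<partial>?H)"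
    using nn_integral_le_cmult_measure[OF sets le1 m(2)] by (simp add: i1 i2)
  show "(\<integral>\<^sup>+x. indicator S x * \<phi> x \<partial>?H) \<le> ennreal ((1 + \<epsilon>) ^ DIM('a)) * (\<integral>\<^sup>+y. \<phi> (graph y) \<partial>lborel)"
    using nn_integral_le_cmult_measure[OF sets[symmetric] le2 m(1)] by (simp add: i1 i2)
qed

end

subsection \<open>Smooth functions\<close>

definition grad :: "('a::euclidean_space \<Rightarrow> real) \<Rightarrow> 'a \<Rightarrow> 'a" where
  "grad f x = (\<Sum>e\<in>Basis. frechet_derivative f (at x) e *\<^sub>R e)"

lemma grad_inner_Basis: "e \<in> Basis \<Longrightarrow> grad f x \<bullet> e = frechet_derivative f (at x) e"
  by (simp add: grad_def inner_sum_left_Basis)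

lemma Ck_on_imp_continuous_on: "Ck_on k U f \<Longrightarrow> continuous_on U f"
  by (cases k) (auto intro!: continuous_at_imp_continuous_on differentiable_imp_continuous_within)

lemma differentiable_imp_GDERIV_grad:
  assumes "f differentiable (at x)"
  shows "GDERIV f x :> grad f x"
proof -
  have d: "(f has_derivative frechet_derivative f (at x)) (at x)"
    using assms frechet_derivative_works by blast
  have l: "linear (frechet_derivative f (at x))" by (rule has_derivative_linear[OF d])
  have "frechet_derivative f (at x) v = v \<bullet> grad f x" for v
  proof -
    have "frechet_derivative f (at x) v = frechet_derivative f (at x) (\<Sum>e\<in>Basis. (v \<bullet> e) *\<^sub>R e)"
      by (simp add: euclidean_representation)
    also have "\<dots> = v \<bullet> grad f x"
      by (simp add: linear_sum[OF l] linear_scale[OF l] grad_def inner_sum_right mult.commute)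
    finally show ?thesis .
  qed
  then have "frechet_derivative f (at x) = (\<lambda>v. v \<bullet> grad f x)" by auto
  with d show ?thesis by (simp add: gderiv_def)
qed

lemma Ck_on_imp_c1_on:
  assumes "Ck_on (Suc k) U f"
  shows "c1_on U f (grad f)"
proof -
  have "continuous_on U (\<lambda>x. frechet_derivative f (at x) e)" if "e \<in> Basis" for e
    using assms that by (auto intro: Ck_on_imp_continuous_on[where k = k])
  then have "continuous_on U (grad f)"
    unfolding grad_def[abs_def] by (intro continuous_intros) auto
  then show ?thesis
    using assms by (auto simp: c1_on_def intro: differentiable_imp_GDERIV_grad)
qed

lemma Ck_on_imp_c1_on_grad:
  assumes "Ck_on (Suc (Suc k)) U f" "e \<in> Basis"
  shows "c1_on U (\<lambda>x. grad f x \<bullet> e) (grad (\<lambda>x. frechet_derivative f (at x) e))"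
  using assms Ck_on_imp_c1_on[of k U "\<lambda>x. frechet_derivative f (at x) e"]
  by (simp add: grad_inner_Basis)

lemma frechet_derivative_cong_open:
  assumes "g differentiable (at x)" "open V" "x \<in> V" "\<And>y. y \<in> V \<Longrightarrow> g y = f y"
  shows "frechet_derivative f (at x) = frechet_derivative g (at x)"
  using frechet_derivative_transform_within_open[OF assms] by simp

lemma grad_cong_open:
  assumes "g differentiable (at x)" "open V" "x \<in> V" "\<And>y. y \<in> V \<Longrightarrow> g y = f y"
  shows "grad f x = grad g x"
  by (simp add: grad_def frechet_derivative_cong_open[OF assms])

lemma laplacian_cong_open:
  assumes g: "Ck_on 2 V g" and V: "open V" "x \<in> V" "\<And>y. y \<in> V \<Longrightarrow> g y = f y"
  shows "laplacian f x = laplacian g x"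
proof -
  have g2: "Ck_on (Suc (Suc 0)) V g" using g by (simp only: numeral_2_eq_2)
  have 1: "frechet_derivative f (at y) = frechet_derivative g (at y)" if "y \<in> V" for y
    by (rule frechet_derivative_cong_open) (use g2 V that in auto)
  have "frechet_derivative (\<lambda>y. frechet_derivative f (at y) e) (at x) =
        frechet_derivative (\<lambda>y. frechet_derivative g (at y) e) (at x)" if "e \<in> Basis" for e
    by (rule frechet_derivative_cong_open[OF _ V(1,2)]) (use g2 V that 1 in auto)
  then show ?thesis by (simp add: laplacian_def)
qed

lemma Ck_on_subset: "Ck_on k U f \<Longrightarrow> V \<subseteq> U \<Longrightarrow> Ck_on k V f"
  by (induction k arbitrary: f) (auto intro: continuous_on_subset)

text \<open>On an open set a local extension coincides with \<open>f\<close> in a whole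
  neighbourhood, so \<open>f\<close> inherits its derivative.\<close>

lemma smooth_on_open_c1:
  assumes "open U" "smooth_on U f"
  shows "c1_on U f (grad f)"
proof -
  have "GDERIV f p :> grad f p \<and> isCont (grad f) p" if p: "p \<in> U" for p
  proof -
    obtain V g where V: "open V" "p \<in> V" "\<forall>k. Ck_on k V g" "\<forall>x\<in>U \<inter> V. g x = f x"
      using assms(2) p unfolding smooth_on_def by blast
    have c: "c1_on V g (grad g)" using V(3) Ck_on_imp_c1_on by blast
    have o: "open (U \<inter> V)" "p \<in> U \<inter> V" using assms V p by auto
    have d: "g differentiable (at x)" if "x \<in> V" for x
      using GDERIV_has_derivative[OF c1_onD[OF c that]] by (auto simp: differentiable_def)
    have ge: "grad f x = grad g x" if "x \<in> U \<inter> V" for x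
      by (rule grad_cong_open[OF d o(1)]) (use that V in auto)
    have "GDERIV f p :> grad g p"
      by (rule GDERIV_transform[OF c1_onD[OF c V(2)] o]) (use V in auto)
    moreover have "isCont (grad g) p"
      using c1_on_continuous_gradient[OF c] V by (simp add: continuous_on_eq_continuous_at)
    then have "isCont (grad f) p"
      using ge o by (subst isCont_cong[where g = "grad g"]) (auto simp: eventually_nhds)
    ultimately show ?thesis using ge o by simp
  qed
  then show ?thesis unfolding c1_on_def by (auto intro: continuous_at_imp_continuous_on)
qed

subsection \<open>Smooth test functions\<close>

primrec times_differentiable :: "nat \<Rightarrow> (real \<Rightarrow> real) \<Rightarrow> bool" where
  "times_differentiable 0 f \<longleftrightarrow> True"
| "times_differentiable (Suc n) f \<longleftrightarrow>
    (\<exists>f'. (\<forall>t. (f has_real_derivative f' t) (at t)) \<and> times_differentiable n f')"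

lemma times_differentiable_SucI:
  "(\<And>t. (f has_real_derivative f' t) (at t)) \<Longrightarrow> times_differentiable n f' \<Longrightarrow> times_differentiable (Suc n) f"
  by auto

lemma times_differentiable_Suc: "times_differentiable (Suc n) f \<Longrightarrow> times_differentiable n f"
  by (induction n arbitrary: f) auto

lemma times_differentiable_add:
  "times_differentiable n f \<Longrightarrow> times_differentiable n g \<Longrightarrow> times_differentiable n (\<lambda>t. f t + g t)"
proof (induction n arbitrary: f g)
  case (Suc n)
  then obtain f' g' where "\<And>t. (f has_real_derivative f' t) (at t)" "times_differentiable n f'"
    "\<And>t. (g has_real_derivative g' t) (at t)" "times_differentiable n g'" by auto
  then show ?case using Suc.IH[of f' g']
    by (auto intro!: exI[of _ "\<lambda>t. f' t + g' t"] DERIV_add)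
qed simp

lemma times_differentiable_mult:
  "times_differentiable n f \<Longrightarrow> times_differentiable n g \<Longrightarrow> times_differentiable n (\<lambda>t. f t * g t)"
proof (induction n arbitrary: f g)
  case (Suc n)
  then obtain f' g' where *: "\<And>t. (f has_real_derivative f' t) (at t)" "times_differentiable n f'"
    "\<And>t. (g has_real_derivative g' t) (at t)" "times_differentiable n g'" by auto
  have "times_differentiable n (\<lambda>t. f' t * g t + g' t * f t)"
    using Suc * by (intro times_differentiable_add Suc.IH times_differentiable_Suc[of n f] times_differentiable_Suc[of n g]) auto
  with DERIV_mult[OF *(1,3)] show ?case by (rule times_differentiable_SucI)
qed simp

lemma times_differentiable_const: "times_differentiable n (\<lambda>t. c)"
proof (induction n arbitrary: c)
  case (Suc n) then show ?case by (auto intro!: exI[of _ "\<lambda>t. 0"])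
qed simp

lemma times_differentiable_affine:
  "times_differentiable n f \<Longrightarrow> times_differentiable n (\<lambda>t. f (a * t + b))"
proof (induction n arbitrary: f)
  case (Suc n)
  then obtain f' where *: "\<And>t. (f has_real_derivative f' t) (at t)" "times_differentiable n f'" by auto
  have "((\<lambda>t. f (a * t + b)) has_real_derivative f' (a * t + b) * a) (at t)" for t
    by (rule DERIV_chain2[OF *(1)]) (auto intro!: derivative_eq_intros)
  moreover have "times_differentiable n (\<lambda>t. f' (a * t + b) * a)"
    by (intro times_differentiable_mult times_differentiable_const Suc.IH *)
  ultimately show ?case by (rule times_differentiable_SucI)
qed simp

text \<open>The classical flat function \<open>exp (- 1 / t)\<close> times negative powers of
  \<open>t\<close>. Differentiation leads to combinations of members of the same family, so
  smoothness follows by induction for all \<open>m\<close> at once.\<close>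

definition flat_exp :: "nat \<Rightarrow> real \<Rightarrow> real" where
  "flat_exp m t = (if t \<le> 0 then 0 else (1 / t) ^ m / exp (1 / t))"

lemma flat_exp_tendsto_0: "(flat_exp m \<longlongrightarrow> 0) (at 0)"
proof -
  have "((\<lambda>t. (1 / t) ^ m / exp (1 / t)) \<longlongrightarrow> 0) (at_right (0::real))"
    by (rule filterlim_compose[OF tendsto_power_div_exp_0])
      (simp add: filterlim_inverse_at_top_right[unfolded inverse_eq_divide])
  then have "(flat_exp m \<longlongrightarrow> 0) (at_right 0)"
    by (rule Lim_transform_eventually) (auto simp: flat_exp_def eventually_at_filter)
  moreover have "(flat_exp m \<longlongrightarrow> 0) (at_left 0)"
    by (rule Lim_transform_eventually[OF tendsto_const]) (auto simp: flat_exp_def eventually_at_filter)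
  ultimately show ?thesis by (simp add: filterlim_split_at)
qed

lemma flat_exp_derivative:
  "(flat_exp m has_real_derivative (- real m * flat_exp (m + 1) t + flat_exp (m + 2) t)) (at t)"
proof -
  consider "t > 0" | "t < 0" | "t = 0" by linarith
  then show ?thesis
  proof cases
    case 1
    have "((\<lambda>t. (1 / t) ^ m / exp (1 / t)) has_real_derivative (- real m * flat_exp (m + 1) t + flat_exp (m + 2) t)) (at t)"
    proof -
      have "((\<lambda>t. (1 / t) ^ m * exp (- (1 / t))) has_real_derivative
         real m * (1 / t) ^ (m - 1) * (- 1 / t\<^sup>2) * exp (- (1 / t)) + (1 / t) ^ m * (exp (- (1 / t)) * (1 / t\<^sup>2))) (at t)"
        using 1 by (auto intro!: derivative_eq_intros simp: power2_eq_square)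
      moreover have "real m * (1 / t) ^ (m - 1) * (- 1 / t\<^sup>2) * exp (- (1 / t)) + (1 / t) ^ m * (exp (- (1 / t)) * (1 / t\<^sup>2))
          = - real m * flat_exp (m + 1) t + flat_exp (m + 2) t"
        using 1 by (cases m) (simp_all add: flat_exp_def exp_minus power2_eq_square field_simps)
      ultimately show ?thesis by (simp add: exp_minus divide_inverse)
    qed
    then show ?thesis
      by (rule has_field_derivative_transform_within_open[where S = "{0<..}"]) (use 1 in \<open>auto simp: flat_exp_def\<close>)
  next
    case 2
    have "((\<lambda>t. 0) has_real_derivative (- real m * flat_exp (m + 1) t + flat_exp (m + 2) t)) (at t)"
      using 2 by (simp add: flat_exp_def)
    then show ?thesis
      by (rule has_field_derivative_transform_within_open[where S = "{..<0}"]) (use 2 in \<open>auto simp: flat_exp_def\<close>)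
  next
    case 3
    have "\<forall>\<^sub>F h in at (0::real). flat_exp (m + 1) h = (flat_exp m h - flat_exp m 0) / h"
      by (auto simp: eventually_at_filter flat_exp_def)
    then have "((\<lambda>h. (flat_exp m h - flat_exp m 0) / h) \<longlongrightarrow> 0) (at (0::real))"
      by (rule Lim_transform_eventually[OF flat_exp_tendsto_0])
    then show ?thesis using 3 by (simp add: has_field_derivative_iff flat_exp_def)
  qed
qed

lemma times_differentiable_flat_exp: "times_differentiable n (flat_exp m)"
proof (induction n arbitrary: m)
  case (Suc n)
  have "times_differentiable n (\<lambda>t. - real m * flat_exp (m + 1) t + flat_exp (m + 2) t)"
    by (intro times_differentiable_add times_differentiable_mult times_differentiable_const Suc.IH)
  with flat_exp_derivative show ?case by (rule times_differentiable_SucI)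
qed simp

text \<open>A partial derivative replaces one factor by its derivative and leaves a product of the
  same shape. One derivative more than \<open>k\<close> is requested so that the last one is still
  continuous.\<close>

lemma Ck_on_coordinate_product:
  assumes "\<And>e. e \<in> Basis \<Longrightarrow> times_differentiable (Suc k) (b e)"
  shows "Ck_on k UNIV (\<lambda>x::'a::euclidean_space. \<Prod>e\<in>Basis. b e (x \<bullet> e))"
  using assms
proof (induction k arbitrary: b)
  case 0
  have cb: "continuous_on UNIV (b e)" if "e \<in> Basis" for e
    using 0[OF that] by (auto intro: DERIV_isCont intro!: continuous_at_imp_continuous_on)
  have "continuous_on UNIV (\<lambda>x::'a. b e (x \<bullet> e))" if "e \<in> Basis" for e
    by (rule continuous_on_compose2[OF cb[OF that]])
      (simp_all add: linear_continuous_on bounded_linear_inner_left)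
  then show ?case by (simp add: continuous_on_prod)
next
  case (Suc k)
  have "\<exists>b'. \<forall>e\<in>Basis. (\<forall>t. (b e has_real_derivative b' e t) (at t)) \<and> times_differentiable (Suc k) (b' e)"
  proof (rule bchoice, rule ballI)
    fix e :: 'a assume "e \<in> Basis"
    from Suc.prems[OF this]
    show "\<exists>b'. (\<forall>t. (b e has_real_derivative b' t) (at t)) \<and> times_differentiable (Suc k) b'"
      by (simp only: times_differentiable.simps(2)[of "Suc k"])
  qed
  then obtain b' where b': "\<And>e t. e \<in> Basis \<Longrightarrow> (b e has_real_derivative b' e t) (at t)"
    "\<And>e. e \<in> Basis \<Longrightarrow> times_differentiable (Suc k) (b' e)" by auto
  let ?f = "\<lambda>x::'a. \<Prod>e\<in>Basis. b e (x \<bullet> e)"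
  have der: "(?f has_derivative (\<lambda>v. \<Sum>i\<in>Basis. (b' i (x \<bullet> i) * (v \<bullet> i)) * (\<Prod>j\<in>Basis - {i}. b j (x \<bullet> j)))) (at x)" for x
  proof (rule has_derivative_prod)
    fix i :: 'a assume i: "i \<in> Basis"
    have "((\<lambda>x. b i (x \<bullet> i)) has_derivative (\<lambda>v. b' i (x \<bullet> i) * (v \<bullet> i))) (at x)"
      by (rule has_derivative_compose[OF bounded_linear_imp_has_derivative[OF bounded_linear_inner_left]])
        (use b'(1)[OF i] in \<open>simp add: has_field_derivative_def\<close>)
    then show "((\<lambda>x. b i (x \<bullet> i)) has_derivative (\<lambda>v. b' i (x \<bullet> i) * (v \<bullet> i))) (at x)" .
  qed
  have fr: "frechet_derivative ?f (at x) e = (\<Prod>i\<in>Basis. (b(e := b' e)) i (x \<bullet> i))" if e: "e \<in> Basis" for x e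
  proof -
    have "frechet_derivative ?f (at x) e = (\<Sum>i\<in>Basis. (b' i (x \<bullet> i) * (e \<bullet> i)) * (\<Prod>j\<in>Basis - {i}. b j (x \<bullet> j)))"
      by (subst frechet_derivative_at[OF der, symmetric]) (rule refl)
    also have "\<dots> = (\<Sum>i\<in>Basis. if i = e then b' e (x \<bullet> e) * (\<Prod>j\<in>Basis - {e}. b j (x \<bullet> j)) else 0)"
      by (intro sum.cong) (auto simp: inner_Basis e)
    also have "\<dots> = b' e (x \<bullet> e) * (\<Prod>j\<in>Basis - {e}. b j (x \<bullet> j))" using e by simp
    also have "\<dots> = (\<Prod>i\<in>Basis. (b(e := b' e)) i (x \<bullet> i))"
      by (subst prod.remove[OF finite_Basis e]) (auto intro!: arg_cong2[where f = "(*)"] prod.cong)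
    finally show ?thesis .
  qed
  show ?case
  proof (simp only: Ck_on.simps, intro conjI ballI)
    show "?f differentiable (at x)" for x using der[of x] by (auto simp: differentiable_def)
    fix e :: 'a assume e: "e \<in> Basis"
    have "Ck_on k UNIV (\<lambda>x::'a. \<Prod>i\<in>Basis. (b(e := b' e)) i (x \<bullet> i))"
      by (rule Suc.IH) (use b'(2) times_differentiable_Suc[OF Suc.prems] in auto)
    then show "Ck_on k UNIV (\<lambda>x. frechet_derivative ?f (at x) e)" using fr[OF e] by simp
  qed
qed

text \<open>Test functions have to be smooth to all orders, which \<open>bump\<close> is not. In
  each coordinate a product of two flat functions is positive exactly on an interval around the
  coordinate of \<open>p\<close>, so the product over the basis is positive exactly on a
  cube.\<close>

lemma smooth_bump_exists:
  fixes p :: "'a::euclidean_space"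
  assumes "r > 0"
  obtains \<phi> :: "'a \<Rightarrow> real" where "smooth_on UNIV \<phi>" "\<And>x. 0 \<le> \<phi> x" "open {x. \<phi> x \<noteq> 0}" "\<phi> p \<noteq> 0"
    "closure {x. \<phi> x \<noteq> 0} \<subseteq> cball p r"
proof -
  \<comment> \<open>With this half side length the cube lies in the ball of radius \<open>r\<close>,
    because the norm is at most the sum of the absolute coordinates.\<close>
  define \<delta> where "\<delta> = r / real DIM('a)"
  have \<delta>: "\<delta> > 0" using assms by (simp add: \<delta>_def)
  define b where "b e t = flat_exp 0 ((1 / \<delta>) * t + (1 - (p \<bullet> e) / \<delta>)) * flat_exp 0 ((- 1 / \<delta>) * t + (1 + (p \<bullet> e) / \<delta>))" for e t
  define \<phi> where "\<phi> x = (\<Prod>e\<in>Basis. b e (x \<bullet> e))" for x :: 'a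
  have "times_differentiable n (b e)" for n e
    unfolding b_def by (intro times_differentiable_mult times_differentiable_affine times_differentiable_flat_exp)
  then have "Ck_on k UNIV \<phi>" for k unfolding \<phi>_def by (intro Ck_on_coordinate_product)
  then have s: "smooth_on UNIV \<phi>" unfolding smooth_on_def by (auto intro!: exI[of _ UNIV] exI[of _ \<phi>])
  have fe: "0 \<le> flat_exp 0 t" "flat_exp 0 t \<noteq> 0 \<longleftrightarrow> 0 < t" for t by (auto simp: flat_exp_def)
  have b0: "0 \<le> b e t" "b e t \<noteq> 0 \<longleftrightarrow> \<bar>t - p \<bullet> e\<bar> < \<delta>" for e t
  proof -
    have "(1 / \<delta>) * t + (1 - (p \<bullet> e) / \<delta>) = (\<delta> + (t - p \<bullet> e)) / \<delta>"
      "(- 1 / \<delta>) * t + (1 + (p \<bullet> e) / \<delta>) = (\<delta> - (t - p \<bullet> e)) / \<delta>"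
      using \<delta> by (simp_all add: field_simps)
    then have b: "b e t = flat_exp 0 ((\<delta> + (t - p \<bullet> e)) / \<delta>) * flat_exp 0 ((\<delta> - (t - p \<bullet> e)) / \<delta>)"
      by (simp only: b_def)
    show "0 \<le> b e t" unfolding b by (intro mult_nonneg_nonneg fe)
    have "b e t \<noteq> 0 \<longleftrightarrow> 0 < (\<delta> + (t - p \<bullet> e)) / \<delta> \<and> 0 < (\<delta> - (t - p \<bullet> e)) / \<delta>"
      unfolding b using fe(2) by simp
    also have "\<dots> \<longleftrightarrow> \<bar>t - p \<bullet> e\<bar> < \<delta>" using \<delta> by (auto simp: zero_less_divide_iff)
    finally show "b e t \<noteq> 0 \<longleftrightarrow> \<bar>t - p \<bullet> e\<bar> < \<delta>" .
  qed
  have nz: "\<phi> x \<noteq> 0 \<longleftrightarrow> (\<forall>e\<in>Basis. \<bar>x \<bullet> e - p \<bullet> e\<bar> < \<delta>)" for x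
    by (auto simp: \<phi>_def b0)
  have "{x. \<phi> x \<noteq> 0} \<subseteq> cball p r"
  proof
    fix x assume "x \<in> {x. \<phi> x \<noteq> 0}"
    then have x: "\<And>e. e \<in> Basis \<Longrightarrow> \<bar>(x - p) \<bullet> e\<bar> \<le> \<delta>" by (auto simp: nz inner_diff_left less_imp_le)
    have "norm (x - p) \<le> (\<Sum>e\<in>Basis. \<bar>(x - p) \<bullet> e\<bar>)" by (rule norm_le_l1)
    also have "\<dots> \<le> (\<Sum>e\<in>(Basis::'a set). \<delta>)" by (intro sum_mono x)
    also have "\<dots> = r" by (simp add: \<delta>_def)
    finally show "x \<in> cball p r" by (simp add: dist_norm norm_minus_commute)
  qed
  then have cl: "closure {x. \<phi> x \<noteq> 0} \<subseteq> cball p r" by (rule closure_minimal) simp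
  have "continuous_on UNIV \<phi>" using \<open>\<And>k. Ck_on k UNIV \<phi>\<close> Ck_on_imp_continuous_on by blast
  then have "open (\<phi> -` (- {0}))" by (intro open_vimage) auto
  then have op: "open {x. \<phi> x \<noteq> 0}" by (simp add: vimage_def)
  show ?thesis
  proof (rule that[OF s _ op _ cl])
    show "0 \<le> \<phi> x" for x by (simp add: \<phi>_def prod_nonneg b0)
    show "\<phi> p \<noteq> 0" using \<delta> by (simp add: nz)
  qed
qed

section \<open>From the weak to the classical gradient\<close>

text \<open>The classical derivative is continuous, so if it exceeded the essential bound of
  \<open>g\<close> somewhere, it would do so on a ball. A test function supported there has the same
  integral against both derivatives, which contradicts the strict inequality.\<close>

lemma weak_derivative_bound:
  fixes u :: "'a::euclidean_space \<Rightarrow> real"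
  assumes \<Omega>: "open \<Omega>" "bounded \<Omega>" and u: "c1_on \<Omega> u gu"
    and g: "weak_derivative \<Omega> e u g" and L: "Lp_space \<infinity> \<Omega> g"
  shows "\<exists>C. \<forall>x\<in>\<Omega>. \<bar>gu x \<bullet> e\<bar> \<le> C"
proof -
  have gm: "g \<in> borel_measurable (lebesgue_on \<Omega>)" using L by (simp add: Lp_space_def)
  obtain C where C: "AE x in lebesgue_on \<Omega>. \<bar>g x\<bar> \<le> C" using L by (auto simp: Lp_space_def)
  have \<Omega>l: "\<Omega> \<in> lmeasurable" using \<Omega> by (rule lmeasurable_open[rotated])
  have \<Omega>s: "\<Omega> \<in> sets lebesgue" using \<Omega>l by auto
  \<comment> \<open>The sign \<sigma> treats the upper and the lower bound together.\<close>
  have main: False if p: "p \<in> \<Omega>" "C < \<sigma> * (gu p \<bullet> e)" and \<sigma>: "\<bar>\<sigma>\<bar> = 1" for p and \<sigma> :: real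
  proof -
    have "open (\<Omega> \<inter> (\<lambda>x. \<sigma> * (gu x \<bullet> e)) -` {C<..})"
      using \<Omega>(1) by (intro continuous_open_preimage continuous_intros c1_on_continuous_gradient[OF u]) auto
    moreover have "p \<in> \<Omega> \<inter> (\<lambda>x. \<sigma> * (gu x \<bullet> e)) -` {C<..}" using p by simp
    ultimately obtain r where r: "r > 0" "cball p r \<subseteq> \<Omega> \<inter> (\<lambda>x. \<sigma> * (gu x \<bullet> e)) -` {C<..}"
      by (meson open_contains_cball)
    obtain \<phi> :: "'a \<Rightarrow> real" where \<phi>: "smooth_on UNIV \<phi>" "\<And>x. 0 \<le> \<phi> x" "open {x. \<phi> x \<noteq> 0}" "\<phi> p \<noteq> 0"
      "closure {x. \<phi> x \<noteq> 0} \<subseteq> cball p r" by (rule smooth_bump_exists[OF r(1), of p]) blast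
    have supp: "\<phi> x = 0" if "x \<notin> cball p r" for x 
      using subset_trans[OF closure_subset \<phi>(5)] that by auto
    have test: "test_function \<Omega> \<phi>"
      unfolding test_function_def
    proof (intro conjI \<phi>(1))
      have "{x. \<phi> x \<noteq> 0} \<subseteq> cball p r" by (rule subset_trans[OF closure_subset \<phi>(5)])
      then show "compact (closure {x. \<phi> x \<noteq> 0})"
        unfolding compact_closure by (rule bounded_subset[OF bounded_cball])
      show "closure {x. \<phi> x \<noteq> 0} \<subseteq> \<Omega>" using \<phi>(5) r(2) by blast
    qed
    have c\<phi>: "c1_on UNIV \<phi> (grad \<phi>)" by (rule smooth_on_open_c1[OF open_UNIV \<phi>(1)])
    have fr: "frechet_derivative \<phi> (at x) e = grad \<phi> x \<bullet> e" for x
      by (subst frechet_derivative_at[OF GDERIV_has_derivative[OF c1_onD[OF c\<phi> UNIV_I]], symmetric])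
        (rule inner_commute)
    have g0: "grad \<phi> x = 0" if "x \<notin> cball p r" for x
      by (rule c1_on_gradient_zero[OF c\<phi>, of "- cball p r"]) (use that supp in auto)
    \<comment> \<open>Classical integration by parts: the product, extended by zero, has a compactly
      supported gradient, whose integral vanishes.\<close>
    define F where "F x = (if x \<in> \<Omega> then u x * \<phi> x else 0)" for x
    define F' where "F' x = (if x \<in> \<Omega> then u x *\<^sub>R grad \<phi> x + \<phi> x *\<^sub>R gu x else 0)" for x
    have cF: "c1_on UNIV F F'"
      unfolding F_def F'_def
      by (rule c1_on_extend_zero[OF c1_on_mult[OF u c1_on_subset[OF c\<phi>]], of "cball p r"])
        (use \<Omega> r supp in auto)
    have far: "x \<notin> cball p r" if "norm p + r < norm x" for x
      using norm_triangle_ineq2[of x p] that by (auto simp: dist_norm norm_minus_commute)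
    have int0: "(LINT x|lborel. F' x \<bullet> e) = 0"
      by (rule integral_gradient_zero[OF cF, of "norm p + r"]) (use far supp in \<open>auto simp: F_def\<close>)
    define A where "A x = (if x \<in> \<Omega> then u x * (grad \<phi> x \<bullet> e) else 0)" for x
    define B where "B x = (if x \<in> \<Omega> then \<phi> x * (gu x \<bullet> e) else 0)" for x
    have integ: "integrable lborel (\<lambda>x. if x \<in> \<Omega> then k x else 0)" "continuous_on UNIV (\<lambda>x. if x \<in> \<Omega> then k x else 0)"
      if k: "continuous_on \<Omega> k" "\<And>x. x \<in> \<Omega> \<Longrightarrow> x \<notin> cball p r \<Longrightarrow> k x = 0" for k :: "'a \<Rightarrow> real"
    proof -
      have "continuous_on \<Omega> (\<lambda>x. if x \<in> \<Omega> then k x else 0)"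
        using continuous_on_cong[of \<Omega> \<Omega> "\<lambda>x. if x \<in> \<Omega> then k x else 0" k] k(1) by auto
      moreover have "continuous_on (- cball p r) (\<lambda>x. if x \<in> \<Omega> then k x else 0)"
        using continuous_on_cong[of "- cball p r" "- cball p r" "\<lambda>x. if x \<in> \<Omega> then k x else 0" "\<lambda>x. 0"] k(2) by auto
      ultimately have "continuous_on (\<Omega> \<union> - cball p r) (\<lambda>x. if x \<in> \<Omega> then k x else 0)"
        using \<Omega>(1) by (intro continuous_on_open_Un) auto
      moreover have "\<Omega> \<union> - cball p r = UNIV" using r by auto
      ultimately show c: "continuous_on UNIV (\<lambda>x. if x \<in> \<Omega> then k x else 0)" by simp
      show "integrable lborel (\<lambda>x. if x \<in> \<Omega> then k x else 0)"
        by (rule integrable_continuous_bounded_support[OF c, of "norm p + r"]) (use far k in auto)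
    qed
    have iA: "integrable lborel A" unfolding A_def
      by (rule integ) (use g0 in \<open>auto intro!: continuous_intros c1_on_continuous[OF u]
         continuous_on_subset[OF c1_on_continuous_gradient[OF c\<phi>]]\<close>)
    have iB: "integrable lborel B" unfolding B_def
      by (rule integ) (use supp in \<open>auto intro!: continuous_intros c1_on_continuous_gradient[OF u]
         continuous_on_subset[OF c1_on_continuous[OF c\<phi>]]\<close>)
    have "F' x \<bullet> e = A x + B x" for x by (simp add: F'_def A_def B_def inner_add_left)
    then have AB: "(LINT x|lborel. A x) + (LINT x|lborel. B x) = 0" using int0 iA iB by simp
    have to_on: "(LINT x|lborel. (if x \<in> \<Omega> then k x else 0)) = (LINT x|lebesgue_on \<Omega>. k x)"
      "integrable (lebesgue_on \<Omega>) k"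
      if "integrable lborel (\<lambda>x. if x \<in> \<Omega> then k x else 0)" for k :: "'a \<Rightarrow> real"
    proof -
      have eq: "(\<lambda>x. if x \<in> \<Omega> then k x else 0) = (\<lambda>x. indicator \<Omega> x *\<^sub>R k x)" by (auto simp: indicator_def)
      have m: "(\<lambda>x. indicator \<Omega> x *\<^sub>R k x) \<in> borel_measurable lborel"
        using borel_measurable_integrable[OF that] unfolding eq .
      have i: "integrable lebesgue (\<lambda>x. indicator \<Omega> x *\<^sub>R k x)"
        using that unfolding eq integrable_completion[OF m] .
      show "integrable (lebesgue_on \<Omega>) k"
        by (subst integrable_restrict_space) (use \<Omega>s i in auto)
      show "(LINT x|lborel. (if x \<in> \<Omega> then k x else 0)) = (LINT x|lebesgue_on \<Omega>. k x)"
        unfolding eq integral_completion[OF m, symmetric]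
        by (subst integral_restrict_space) (use \<Omega>s in auto)
    qed
    have eA: "(LINT x|lborel. A x) = (LINT x|lebesgue_on \<Omega>. u x * frechet_derivative \<phi> (at x) e)"
      unfolding fr using to_on(1)[OF iA[unfolded A_def[abs_def]]] by (simp add: A_def[abs_def])
    have eB: "(LINT x|lborel. B x) = (LINT x|lebesgue_on \<Omega>. \<phi> x * (gu x \<bullet> e))"
      and iB': "integrable (lebesgue_on \<Omega>) (\<lambda>x. \<phi> x * (gu x \<bullet> e))"
      using to_on[OF iB[unfolded B_def[abs_def]]] by (simp_all add: B_def[abs_def])
    have "(LINT x|lebesgue_on \<Omega>. u x * frechet_derivative \<phi> (at x) e) = - (LINT x|lebesgue_on \<Omega>. g x * \<phi> x)"
      using g test unfolding weak_derivative_def by blast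
    then have eq: "(LINT x|lebesgue_on \<Omega>. \<phi> x * (gu x \<bullet> e)) = (LINT x|lebesgue_on \<Omega>. g x * \<phi> x)"
      using AB eA eB by linarith
    have \<phi>m: "\<phi> \<in> borel_measurable (lebesgue_on \<Omega>)"
      using borel_measurable_continuous_onI[OF c1_on_continuous[OF c\<phi>]]
      by (intro measurable_restrict_space1) (auto intro: measurable_completion)
    have i\<phi>: "integrable (lebesgue_on \<Omega>) \<phi>"
      by (rule to_on(2), rule integ(1))
        (use supp in \<open>auto intro!: continuous_on_subset[OF c1_on_continuous[OF c\<phi>]]\<close>)
    have ig: "integrable (lebesgue_on \<Omega>) (\<lambda>x. g x * \<phi> x)"
    proof (rule Bochner_Integration.integrable_bound[of _ "\<lambda>x. C * \<phi> x"])
      show "integrable (lebesgue_on \<Omega>) (\<lambda>x. C * \<phi> x)" using i\<phi> by simp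
      show "(\<lambda>x. g x * \<phi> x) \<in> borel_measurable (lebesgue_on \<Omega>)" using gm \<phi>m by simp
      show "AE x in lebesgue_on \<Omega>. norm (g x * \<phi> x) \<le> norm (C * \<phi> x)"
        using C by eventually_elim (auto simp: abs_mult intro!: mult_right_mono)
    qed
    define D where "D x = \<sigma> * (\<phi> x * (gu x \<bullet> e) - g x * \<phi> x)" for x
    have iD: "integrable (lebesgue_on \<Omega>) D" unfolding D_def using iB' ig by simp
    have D0: "(LINT x|lebesgue_on \<Omega>. D x) = 0" unfolding D_def using iB' ig eq by simp
    \<comment> \<open>An integrand that is nonnegative and has integral zero vanishes almost
      everywhere; here this would force \<phi> to vanish almost everywhere, although it is nonzero
      on a nonempty open set.\<close>
    have AEpos: "AE x in lebesgue_on \<Omega>. 0 \<le> D x \<and> (\<phi> x \<noteq> 0 \<longrightarrow> 0 < D x)"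
      using C AE_space
    proof eventually_elim
      case (elim x)
      have "D x = \<phi> x * (\<sigma> * (gu x \<bullet> e) - \<sigma> * g x)" by (simp add: D_def algebra_simps)
      moreover have "0 < \<sigma> * (gu x \<bullet> e) - \<sigma> * g x" if "\<phi> x \<noteq> 0"
      proof -
        have "x \<in> cball p r" using supp that by blast
        then have "C < \<sigma> * (gu x \<bullet> e)" using r by auto
        moreover have "\<sigma> * g x \<le> C" 
          using elim(1) \<sigma> abs_ge_self[of "\<sigma> * g x"] by (simp add: abs_mult)
        ultimately show ?thesis by linarith
      qed
      ultimately show ?case using \<phi>(2)[of x] by (cases "\<phi> x = 0") (simp_all add: less_le)
    qed
    then have "AE x in lebesgue_on \<Omega>. D x = 0"
    proof -
      have "AE x in lebesgue_on \<Omega>. 0 \<le> D x" using AEpos by eventually_elim simp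
      from integral_nonneg_eq_0_iff_AE[OF iD this] D0 show ?thesis by simp
    qed
    then have "AE x in lebesgue_on \<Omega>. \<phi> x = 0" using AEpos by eventually_elim auto
    then have "AE x in lebesgue. x \<in> \<Omega> \<longrightarrow> \<phi> x = 0" using \<Omega>s by (simp add: AE_restrict_space_iff)
    moreover have "x \<in> \<Omega>" if "\<phi> x \<noteq> 0" for x using supp[of x] r that by blast
    ultimately have "AE x in lebesgue. \<phi> x = 0" by (auto elim: eventually_mono)
    then have "{x. \<phi> x \<noteq> 0} \<in> null_sets lebesgue"
      using \<phi>(3) by (subst (asm) AE_iff_null) (auto simp: borel_open)
    then have "negligible {x. \<phi> x \<noteq> 0}" by (simp add: negligible_iff_null_sets)
    then show False using open_not_negligible[OF \<phi>(3)] \<phi>(4) by blast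
  qed
  have "\<bar>gu x \<bullet> e\<bar> \<le> C" if "x \<in> \<Omega>" for x
  proof -
    have "\<not> C < gu x \<bullet> e" "\<not> C < - (gu x \<bullet> e)"
      using main[OF that, of 1] main[OF that, of "-1"] by auto
    then show ?thesis by linarith
  qed
  then show ?thesis by blast
qed

section \<open>Null sets of low dimension\<close>

text \<open>The subspace is an isometric image of a proper subspace of \<open>'a\<close>, and that
  one is Lebesgue null.\<close>

lemma hausdorff_null_subspace:
  fixes L :: "'b::euclidean_space set"
  assumes L: "subspace L" and d: "dim L < DIM('a::euclidean_space)"
  shows "hausdorff_outer_measure DIM('a) L = 0"
proof -
  obtain L' :: "'a set" where L': "subspace L'" "dim L' = dim L"
    using choose_subspace_of_subspace[of "dim L" "UNIV :: 'a set"] d by (auto simp: dim_UNIV)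
  obtain f where f: "linear f" "f ` L' = L" "\<And>x. x \<in> L' \<Longrightarrow> norm (f x) = norm x"
    using isometries_subspaces[OF L'(1) L L'(2)] by metis
  have "1-lipschitz_on L' f"
  proof (rule lipschitz_onI)
    fix x y assume "x \<in> L'" "y \<in> L'"
    then have "x - y \<in> L'" using L'(1) by (rule subspace_diff[rotated])
    then show "dist (f x) (f y) \<le> 1 * dist x y"
      using f(3)[of "x - y"] by (simp add: dist_norm linear_diff[OF f(1)])
  qed simp
  from hausdorff_outer_measure_lipschitz_le[OF this, of "DIM('a)"]
  have "hausdorff_outer_measure DIM('a) L \<le> hausdorff_outer_measure DIM('a) L'" by (simp add: f(2))
  also have "\<dots> = 0" using d L'(2) by (intro hausdorff_outer_measure_negligible negligible_lowdim) simp
  finally show ?thesis by simp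
qed

lemma Ck_on_locally_lipschitz:
  fixes \<Psi> :: "'a::euclidean_space \<Rightarrow> 'b::real_normed_vector"
  assumes \<Psi>: "Ck_on 1 V \<Psi>" and V: "open V" "q \<in> V"
  obtains \<rho> B where "\<rho> > 0" "B > 0" "ball q \<rho> \<subseteq> V" "B-lipschitz_on (ball q \<rho>) \<Psi>"
proof -
  obtain \<rho> where \<rho>: "\<rho> > 0" "cball q \<rho> \<subseteq> V" using V by (meson open_contains_cball)
  have diff: "\<Psi> differentiable (at x)" if "x \<in> V" for x using \<Psi> that by simp
  have "\<exists>C\<ge>0. \<forall>x\<in>cball q \<rho>. norm (frechet_derivative \<Psi> (at x) e) \<le> C" if e: "e \<in> Basis" for e
  proof -
    have "compact ((\<lambda>x. frechet_derivative \<Psi> (at x) e) ` cball q \<rho>)"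
      using \<Psi> e \<rho> by (intro compact_continuous_image) (auto intro: continuous_on_subset)
    then have "bounded ((\<lambda>x. frechet_derivative \<Psi> (at x) e) ` cball q \<rho>)" by (rule compact_imp_bounded)
    then obtain C where "\<forall>x\<in>cball q \<rho>. norm (frechet_derivative \<Psi> (at x) e) \<le> C"
      unfolding bounded_iff by blast
    then show ?thesis by (intro exI[of _ "max 0 C"]) (auto simp: le_max_iff_disj)
  qed
  then obtain C where C: "\<And>e. e \<in> Basis \<Longrightarrow> 0 \<le> C e"
    "\<And>e x. e \<in> Basis \<Longrightarrow> x \<in> cball q \<rho> \<Longrightarrow> norm (frechet_derivative \<Psi> (at x) e) \<le> C e"
    by metis
  \<comment> \<open>The partial derivatives bound the operator norm through the coordinates of the
    argument; the summand 1 makes the Lipschitz constant positive.\<close>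
  define B where "B = 1 + (\<Sum>e\<in>Basis. C e)"
  have B: "B > 0" unfolding B_def by (intro add_pos_nonneg sum_nonneg C) auto
  have "norm (\<Psi> x - \<Psi> y) \<le> B * norm (x - y)" if "x \<in> ball q \<rho>" "y \<in> ball q \<rho>" for x y
  proof (rule differentiable_bound[where S = "ball q \<rho>" and f' = "\<lambda>x. frechet_derivative \<Psi> (at x)"])
    fix z assume z: "z \<in> ball q \<rho>"
    then have zc: "z \<in> cball q \<rho>" by simp
    have d: "(\<Psi> has_derivative frechet_derivative \<Psi> (at z)) (at z)"
      using diff[of z] zc \<rho> frechet_derivative_works by blast
    then show "(\<Psi> has_derivative frechet_derivative \<Psi> (at z)) (at z within ball q \<rho>)"
      by (rule has_derivative_at_withinI)
    have l: "linear (frechet_derivative \<Psi> (at z))" by (rule has_derivative_linear[OF d])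
    show "onorm (frechet_derivative \<Psi> (at z)) \<le> B"
    proof (rule onorm_le)
      fix v
      have "frechet_derivative \<Psi> (at z) v = frechet_derivative \<Psi> (at z) (\<Sum>e\<in>Basis. (v \<bullet> e) *\<^sub>R e)"
        by (simp add: euclidean_representation)
      also have "\<dots> = (\<Sum>e\<in>Basis. (v \<bullet> e) *\<^sub>R frechet_derivative \<Psi> (at z) e)"
        by (simp add: linear_sum[OF l] linear_scale[OF l])
      also have "norm \<dots> \<le> (\<Sum>e\<in>Basis. norm v * C e)"
      proof (rule sum_norm_le)
        fix e :: 'a assume e: "e \<in> Basis"
        show "norm ((v \<bullet> e) *\<^sub>R frechet_derivative \<Psi> (at z) e) \<le> norm v * C e"
          using Basis_le_norm[OF e, of v] C(2)[OF e zc] by (auto intro!: mult_mono)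
      qed
      also have "\<dots> \<le> B * norm v" by (simp add: B_def sum_distrib_right[symmetric] distrib_right mult.commute[of "norm v"])
      finally show "norm (frechet_derivative \<Psi> (at z) v) \<le> B * norm v" .
    qed
  qed (use that in auto)
  then have "B-lipschitz_on (ball q \<rho>) \<Psi>" using B by (intro lipschitz_onI) (auto simp: dist_norm)
  moreover have "ball q \<rho> \<subseteq> V" using \<rho> ball_subset_cball by blast
  ultimately show ?thesis using that \<rho>(1) B by blast
qed

text \<open>Locally the set is contained in a Lipschitz image of a piece of a
  \<open>d\<close>-dimensional subspace, and by compactness finitely many such pieces
  suffice.\<close>

lemma hausdorff_null_submanifold:
  fixes M :: "'b::euclidean_space set"
  assumes M: "smooth_submanifold d M" "compact M" and d: "d < DIM('a::euclidean_space)"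
  shows "hausdorff_outer_measure DIM('a) M = 0"
proof -
  have "\<exists>W. open W \<and> p \<in> W \<and> hausdorff_outer_measure DIM('a) (M \<inter> W) = 0" if p: "p \<in> M" for p
  proof -
    obtain U V :: "'b set" and \<Phi> \<Psi> L where
      U: "open U" "p \<in> U" "open V" "homeomorphism U V \<Phi> \<Psi>" "smooth_on V \<Psi>"
      "subspace L" "dim L = d" "\<Phi> ` (M \<inter> U) = V \<inter> L"
      using M(1) p unfolding smooth_submanifold_def by meson
    have q: "\<Phi> p \<in> V" using U by (auto simp: homeomorphism_def)
    then obtain V' \<Psi>' where V': "open V'" "\<Phi> p \<in> V'" "\<forall>k. Ck_on k V' \<Psi>'" "\<forall>x\<in>V \<inter> V'. \<Psi>' x = \<Psi> x"
      using U(5) unfolding smooth_on_def by blast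
    have "Ck_on 1 (V \<inter> V') \<Psi>'" using V'(3) Ck_on_subset by blast
    moreover have "open (V \<inter> V')" "\<Phi> p \<in> V \<inter> V'" using U V' q by auto
    ultimately obtain \<rho> B where \<rho>: "\<rho> > 0" "B > 0" "ball (\<Phi> p) \<rho> \<subseteq> V \<inter> V'" "B-lipschitz_on (ball (\<Phi> p) \<rho>) \<Psi>'"
      by (rule Ck_on_locally_lipschitz)
    define W where "W = U \<inter> \<Phi> -` ball (\<Phi> p) \<rho>"
    have "continuous_on U \<Phi>" using U(4) by (simp add: homeomorphism_def)
    then have "open W" unfolding W_def using U(1) by (intro continuous_open_preimage) auto
    moreover have "p \<in> W" using U \<rho> by (simp add: W_def)
    moreover have "hausdorff_outer_measure DIM('a) (M \<inter> W) = 0"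
    proof -
      have "M \<inter> W \<subseteq> \<Psi>' ` (ball (\<Phi> p) \<rho> \<inter> L)"
      proof
        fix x assume x: "x \<in> M \<inter> W"
        then have "\<Phi> x \<in> ball (\<Phi> p) \<rho>" "x \<in> U" "\<Phi> x \<in> L" using U(8) by (auto simp: W_def)
        moreover have "\<Psi>' (\<Phi> x) = x"
          using calculation \<rho>(3) V'(4) U(4) unfolding homeomorphism_def by (metis subsetD)
        ultimately show "x \<in> \<Psi>' ` (ball (\<Phi> p) \<rho> \<inter> L)" by (metis IntI image_eqI)
      qed
      then have "hausdorff_outer_measure DIM('a) (M \<inter> W) \<le> hausdorff_outer_measure DIM('a) (\<Psi>' ` (ball (\<Phi> p) \<rho> \<inter> L))"
        by (rule hausdorff.mono)
      also have "\<dots> \<le> ennreal (B ^ DIM('a)) * hausdorff_outer_measure DIM('a) (ball (\<Phi> p) \<rho> \<inter> L)"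
        by (rule hausdorff_outer_measure_lipschitz_le[OF lipschitz_on_subset[OF \<rho>(4)] \<rho>(2)]) simp
      also have "hausdorff_outer_measure DIM('a) (ball (\<Phi> p) \<rho> \<inter> L) \<le> hausdorff_outer_measure DIM('a) L"
        by (rule hausdorff.mono) simp
      also have "hausdorff_outer_measure DIM('a) L = 0"
        using hausdorff_null_subspace[where 'a = 'a, OF U(6)] U(7) d by simp
      finally show ?thesis by (simp add: mult_left_mono)
    qed
    ultimately show ?thesis by blast
  qed
  then obtain W where W: "\<And>p. p \<in> M \<Longrightarrow> open (W p)" "\<And>p. p \<in> M \<Longrightarrow> p \<in> W p"
    "\<And>p. p \<in> M \<Longrightarrow> hausdorff_outer_measure DIM('a) (M \<inter> W p) = 0" by metis
  have cov: "M \<subseteq> (\<Union>p\<in>M. W p)" using W(2) by blast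
  obtain D where D: "D \<subseteq> M" "finite D" "M \<subseteq> (\<Union>p\<in>D. W p)"
    by (rule compactE_image[OF M(2) W(1) cov])
  have "hausdorff_outer_measure DIM('a) (\<Union>p\<in>D'. M \<inter> W p) = 0" if "finite D'" "D' \<subseteq> M" for D'
    using that
  proof (induction D' rule: finite_induct)
    case (insert p D')
    have "hausdorff_outer_measure DIM('a) ((M \<inter> W p) \<union> (\<Union>p\<in>D'. M \<inter> W p)) \<le>
      hausdorff_outer_measure DIM('a) (M \<inter> W p) + hausdorff_outer_measure DIM('a) (\<Union>p\<in>D'. M \<inter> W p)"
      by (rule hausdorff.subadditive_Un)
    then show ?case using insert W by simp
  qed simp
  from this[OF D(2,1)] have "hausdorff_outer_measure DIM('a) (\<Union>p\<in>D. M \<inter> W p) = 0" .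
  moreover have "M = (\<Union>p\<in>D. M \<inter> W p)" using D by blast
  ultimately show ?thesis by simp
qed

section \<open>Cutoffs around sets of zero capacity\<close>

text \<open>The cutoff is the product of the functions \<open>1 - bump\<close>. All factors lie
  between 0 and 1, so the product rule bounds its gradient by the sum of the single
  gradients.\<close>

lemma cutoff_finite_balls:
  fixes x :: "'i \<Rightarrow> 'b::euclidean_space"
  assumes bump: "\<And>(p::'b) r. r > 0 \<Longrightarrow> \<exists>g. c1_on UNIV (bump p r) g \<and> (\<forall>x. norm (g x) \<le> M / r)"
    and I: "finite I" "\<And>i. i \<in> I \<Longrightarrow> r i > 0"
  shows "\<exists>\<eta> d\<eta>. c1_on UNIV \<eta> d\<eta> \<and> (\<forall>z. 0 \<le> \<eta> z \<and> \<eta> z \<le> 1) \<and>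
    (\<forall>i\<in>I. \<forall>z. dist z (x i) \<le> r i \<longrightarrow> \<eta> z = 0) \<and>
    (\<forall>z. (\<forall>i\<in>I. 2 * r i \<le> dist z (x i)) \<longrightarrow> \<eta> z = 1) \<and>
    (\<forall>z. norm (d\<eta> z) \<le> (\<Sum>i\<in>I. M / r i * indicator (cball (x i) (2 * r i)) z))"
  using I
proof (induction I rule: finite_induct)
  case empty
  then show ?case by (intro exI[of _ "\<lambda>z. 1"] exI[of _ "\<lambda>z. 0"]) (auto simp: c1_on_const)
next
  case (insert j I)
  then obtain \<eta> d\<eta> where \<eta>: "c1_on UNIV \<eta> d\<eta>" "\<And>z. 0 \<le> \<eta> z" "\<And>z. \<eta> z \<le> 1"
    "\<And>i z. i \<in> I \<Longrightarrow> dist z (x i) \<le> r i \<Longrightarrow> \<eta> z = 0"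
    "\<And>z. (\<And>i. i \<in> I \<Longrightarrow> 2 * r i \<le> dist z (x i)) \<Longrightarrow> \<eta> z = 1"
    "\<And>z. norm (d\<eta> z) \<le> (\<Sum>i\<in>I. M / r i * indicator (cball (x i) (2 * r i)) z)"
    by auto
  have r: "r j > 0" using insert by auto
  obtain g where g: "c1_on UNIV (bump (x j) (r j)) g" "\<And>z. norm (g z) \<le> M / r j" using bump[OF r] by blast
  have g0: "g z = 0" if "z \<notin> cball (x j) (2 * r j)" for z
    by (rule c1_on_gradient_zero[OF g(1), of "- cball (x j) (2 * r j)" 0])
      (use that r in \<open>auto intro!: bump_eq_0 simp: dist_commute\<close>)
  have gb: "norm (g z) \<le> M / r j * indicator (cball (x j) (2 * r j)) z" for z
    using g(2)[of z] g0[of z] by (auto simp: indicator_def)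
  let ?\<eta> = "\<lambda>z. \<eta> z * (1 - bump (x j) (r j) z)"
  let ?d = "\<lambda>z. \<eta> z *\<^sub>R (0 - g z) + (1 - bump (x j) (r j) z) *\<^sub>R d\<eta> z"
  have c: "c1_on UNIV ?\<eta> ?d"
    by (intro c1_on_mult[OF \<eta>(1) c1_on_diff[OF c1_on_const g(1)]])
  have b: "0 \<le> bump (x j) (r j) z" "bump (x j) (r j) z \<le> 1" for z by (rule bump_range)+
  show ?case
  proof (intro exI[of _ ?\<eta>] exI[of _ ?d] conjI allI ballI impI c)
    fix z
    show "0 \<le> ?\<eta> z" using \<eta>(2) b by simp
    show "?\<eta> z \<le> 1" using \<eta>(2,3) b by (simp add: mult_le_one)
    show "?\<eta> z = 0" if "i \<in> insert j I" "dist z (x i) \<le> r i" for i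
      using that \<eta>(4)[of i z] bump_eq_1[OF r, of z "x j"] by auto
    show "?\<eta> z = 1" if "\<forall>i\<in>insert j I. 2 * r i \<le> dist z (x i)"
      using that \<eta>(5)[of z] bump_eq_0[OF r, of z "x j"] by auto
    have "norm (?d z) \<le> \<eta> z * norm (g z) + (1 - bump (x j) (r j) z) * norm (d\<eta> z)"
      using norm_triangle_ineq[of "\<eta> z *\<^sub>R (0 - g z)" "(1 - bump (x j) (r j) z) *\<^sub>R d\<eta> z"] \<eta>(2)[of z] b[of z] by simp
    also have "\<dots> \<le> 1 * norm (g z) + 1 * norm (d\<eta> z)"
      using \<eta>(3)[of z] b[of z] by (intro add_mono mult_right_mono) auto
    also have "\<dots> \<le> M / r j * indicator (cball (x j) (2 * r j)) z + (\<Sum>i\<in>I. M / r i * indicator (cball (x i) (2 * r i)) z)"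
      using gb[of z] \<eta>(6)[of z] by simp
    finally show "norm (?d z) \<le> (\<Sum>i\<in>insert j I. M / r i * indicator (cball (x i) (2 * r i)) z)"
      using insert by simp
  qed
qed

text \<open>A bump of radius \<open>r\<close> has a gradient of order \<open>1 / r\<close> on a ball
  of volume of order \<open>r ^ (d + 1)\<close>, so its contribution in \<open>L1\<close> is of
  order \<open>r ^ d\<close>. A set of zero \<open>d\<close>-dimensional measure has covers for
  which the sum of these is as small as desired.\<close>

lemma capacity_cutoff:
  fixes K :: "'b::euclidean_space set"
  assumes K: "compact K" "hausdorff_outer_measure d K = 0" and d: "DIM('b) = Suc d" and e: "e > 0"
  obtains \<eta> d\<eta> V where "c1_on UNIV \<eta> d\<eta>" "\<And>z. 0 \<le> \<eta> z" "\<And>z. \<eta> z \<le> 1" "open V" "K \<subseteq> V"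
    "\<And>z. z \<in> V \<Longrightarrow> \<eta> z = 0" "(\<integral>\<^sup>+z. ennreal (norm (d\<eta> z)) \<partial>lborel) \<le> ennreal e"
    "\<And>z. (\<And>y. y \<in> K \<Longrightarrow> e < dist z y) \<Longrightarrow> \<eta> z = 1"
proof -
  obtain M where M: "M \<ge> 0"
    "\<And>(p::'b) r. r > 0 \<Longrightarrow> \<exists>g. c1_on UNIV (bump p r) g \<and> (\<forall>x. norm (g x) \<le> M / r)"
    by (rule bump_c1) blast
  \<comment> \<open>\<open>c * r ^ d\<close> is the gradient bound \<open>M / r\<close> times the
    volume of the ball of radius \<open>2 * r\<close>.\<close>
  define c where "c = M * unit_ball_vol (real DIM('b)) * 2 ^ DIM('b)"
  have c: "c \<ge> 0" using M(1) by (simp add: c_def)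
  \<comment> \<open>The radii will satisfy a bound \<open>2 * e1\<close> on the sum of
    \<open>r i ^ d\<close>: one \<open>e1\<close> for the diameters, one for their
    enlargement.\<close>
  define e1 where "e1 = e / (2 * (c + 1))"
  have e1: "e1 > 0" "c * (2 * e1) \<le> e" using c e by (auto simp: e1_def field_simps)
  define w where "w = unit_ball_vol (real d) / 2 ^ d"
  have w: "w > 0" by (simp add: w_def)
  have gw: "hausdorff_gauge d C = ennreal (w * diameter C ^ d)" if "C \<noteq> {}" for C :: "'b set"
    using that by (simp add: hausdorff_gauge_def w_def power_divide)
  have "hausdorff_content d (e / 8) K \<le> hausdorff_outer_measure d K"
    by (rule hausdorff_outer_measure_upper) (use e in simp)
  also have "\<dots> < ennreal (w * e1)" using K(2) w e1 by simp
  finally obtain C :: "nat \<Rightarrow> 'b set" where C: "K \<subseteq> (\<Union>i. C i)" "\<And>i. bounded (C i)"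
    "\<And>i. diameter (C i) \<le> e / 8" "(\<Sum>i. hausdorff_gauge d (C i)) < ennreal (w * e1)"
    by (rule hausdorff_content_coverE) blast
  \<comment> \<open>Covering sets may have diameter 0 and are not open; a small enlargement turns
    them into balls of positive radius, at a total cost of at most \<open>e1\<close>.\<close>
  have "\<exists>t>0. t \<le> e / 8 \<and> (diameter (C i) + t) ^ d \<le> diameter (C i) ^ d + e1 * (1 / 2) ^ Suc i" for i
  proof -
    have "((\<lambda>t. (diameter (C i) + t) ^ d) \<longlongrightarrow> (diameter (C i) + 0) ^ d) (at_right 0)"
      by (intro tendsto_intros)
    moreover have "(diameter (C i) + 0) ^ d < diameter (C i) ^ d + e1 * (1 / 2) ^ Suc i" using e1 by simp
    ultimately have "\<forall>\<^sub>F t in at_right 0. (diameter (C i) + t) ^ d < diameter (C i) ^ d + e1 * (1 / 2) ^ Suc i"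
      by (rule order_tendstoD)
    moreover have "\<forall>\<^sub>F t in at_right 0. t \<in> {0<..<e / 8}"
      by (rule eventually_at_right_real) (use e in simp)
    ultimately have "\<forall>\<^sub>F t in at_right 0. t > 0 \<and> t \<le> e / 8 \<and> (diameter (C i) + t) ^ d \<le> diameter (C i) ^ d + e1 * (1 / 2) ^ Suc i"
      by eventually_elim auto
    then show ?thesis by (rule eventually_happens'[rotated]) simp
  qed
  then obtain t where t: "\<And>i. t i > 0" "\<And>i. t i \<le> e / 8"
    "\<And>i. (diameter (C i) + t i) ^ d \<le> diameter (C i) ^ d + e1 * (1 / 2) ^ Suc i" by metis
  define r where "r i = diameter (C i) + t i" for i
  \<comment> \<open>Diameter and enlargement are each at most \<open>e / 8\<close>. Since the
    centers lie in \<open>K\<close>, points farther than \<open>e\<close> from \<open>K\<close> are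
    outside all doubled balls.\<close>
  have r: "r i > 0" "2 * r i \<le> e / 2" for i
    using t(1)[of i] t(2)[of i] C(3)[of i] diameter_ge_0[OF C(2)[of i]] by (auto simp: r_def)
  define J where "J = {i. C i \<inter> K \<noteq> {}}"
  have "\<forall>i\<in>J. \<exists>z. z \<in> C i \<inter> K" by (auto simp: J_def)
  then obtain x where x: "\<And>i. i \<in> J \<Longrightarrow> x i \<in> C i" "\<And>i. i \<in> J \<Longrightarrow> x i \<in> K" by (metis IntD1 IntD2)
  have cov: "K \<subseteq> (\<Union>i\<in>J. ball (x i) (r i))"
  proof
    fix y assume y: "y \<in> K"
    then obtain i where i: "y \<in> C i" using C(1) by blast
    then have iJ: "i \<in> J" using y by (auto simp: J_def)
    have "dist (x i) y \<le> diameter (C i)" by (rule diameter_bounded_bound[OF C(2) x(1)[OF iJ] i])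
    also have "\<dots> < r i" using t(1) by (simp add: r_def)
    finally show "y \<in> (\<Union>i\<in>J. ball (x i) (r i))" using iJ by auto
  qed
  obtain I where I: "I \<subseteq> J" "finite I" "K \<subseteq> (\<Union>i\<in>I. ball (x i) (r i))"
    using compactE_image[OF K(1) _ cov] by blast
  obtain \<eta> d\<eta> where \<eta>: "c1_on UNIV \<eta> d\<eta>" "\<And>z. 0 \<le> \<eta> z" "\<And>z. \<eta> z \<le> 1"
    "\<And>i z. i \<in> I \<Longrightarrow> dist z (x i) \<le> r i \<Longrightarrow> \<eta> z = 0"
    "\<And>z. (\<And>i. i \<in> I \<Longrightarrow> 2 * r i \<le> dist z (x i)) \<Longrightarrow> \<eta> z = 1"
    "\<And>z. norm (d\<eta> z) \<le> (\<Sum>i\<in>I. M / r i * indicator (cball (x i) (2 * r i)) z)"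
    using cutoff_finite_balls[OF M(2) I(2), of r x] r(1) by auto
  have sumd: "(\<Sum>i\<in>I. diameter (C i) ^ d) \<le> e1"
  proof -
    have ne: "C i \<noteq> {}" if "i \<in> I" for i using x(1) I(1) that by auto
    have nn: "0 \<le> w * diameter (C i) ^ d" for i using w diameter_ge_0[OF C(2)[of i]] by simp
    have "ennreal (\<Sum>i\<in>I. w * diameter (C i) ^ d) = (\<Sum>i\<in>I. ennreal (w * diameter (C i) ^ d))"
      by (rule sum_ennreal[symmetric]) (rule nn)
    also have "\<dots> = (\<Sum>i\<in>I. hausdorff_gauge d (C i))" by (intro sum.cong refl gw[symmetric] ne)
    also have "\<dots> \<le> (\<Sum>i. hausdorff_gauge d (C i))" by (rule sum_le_suminf) (use I in auto)
    also have "\<dots> < ennreal (w * e1)" by (rule C(4))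
    finally have "(\<Sum>i\<in>I. w * diameter (C i) ^ d) < w * e1"
      using w e1 by (subst (asm) ennreal_less_iff) (auto intro: sum_nonneg nn)
    then have "w * (\<Sum>i\<in>I. diameter (C i) ^ d) < w * e1" by (simp add: sum_distrib_left)
    then show ?thesis using w by (simp add: mult_less_cancel_left_pos less_imp_le)
  qed
  have sumr: "(\<Sum>i\<in>I. r i ^ d) \<le> 2 * e1"
  proof -
    have "(\<Sum>i\<in>I. r i ^ d) \<le> (\<Sum>i\<in>I. diameter (C i) ^ d + e1 * (1 / 2) ^ Suc i)"
      unfolding r_def by (intro sum_mono t)
    also have "\<dots> = (\<Sum>i\<in>I. diameter (C i) ^ d) + e1 * (\<Sum>i\<in>I. (1 / 2) ^ Suc i)"
      by (simp add: sum.distrib sum_distrib_left)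
    also have "(\<Sum>i\<in>I. (1 / 2 :: real) ^ Suc i) \<le> 1"
    proof -
      have "summable (\<lambda>i. (1 / 2 :: real) ^ Suc i)" "(\<Sum>i. (1 / 2 :: real) ^ Suc i) = 1"
        using power_half_series unfolding sums_iff by blast+
      moreover have "(\<Sum>i\<in>I. (1 / 2 :: real) ^ Suc i) \<le> (\<Sum>i. (1 / 2) ^ Suc i)"
        by (rule sum_le_suminf) (use calculation(1) I(2) in auto)
      ultimately show ?thesis by linarith
    qed
    finally show ?thesis using sumd e1 by (simp add: mult_left_mono)
  qed
  have "(\<integral>\<^sup>+z. ennreal (norm (d\<eta> z)) \<partial>lborel) \<le>
      (\<integral>\<^sup>+z. (\<Sum>i\<in>I. ennreal (M / r i) * indicator (cball (x i) (2 * r i)) z) \<partial>lborel)"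
  proof (rule nn_integral_mono)
    fix z
    have "ennreal (norm (d\<eta> z)) \<le> ennreal (\<Sum>i\<in>I. M / r i * indicator (cball (x i) (2 * r i)) z)"
      by (intro ennreal_leI \<eta>)
    also have "\<dots> = (\<Sum>i\<in>I. ennreal (M / r i) * indicator (cball (x i) (2 * r i)) z)"
    proof -
      have "0 \<le> M / r i * indicator (cball (x i) (2 * r i)) z" for i
        using M(1) r(1)[of i] by (simp add: less_imp_le)
      then have "ennreal (\<Sum>i\<in>I. M / r i * indicator (cball (x i) (2 * r i)) z) =
        (\<Sum>i\<in>I. ennreal (M / r i * indicator (cball (x i) (2 * r i)) z))"
        by (intro sum_ennreal[symmetric])
      also have "\<dots> = (\<Sum>i\<in>I. ennreal (M / r i) * indicator (cball (x i) (2 * r i)) z)"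
        by (intro sum.cong refl) (auto simp: indicator_def)
      finally show ?thesis .
    qed
    finally show "ennreal (norm (d\<eta> z)) \<le> (\<Sum>i\<in>I. ennreal (M / r i) * indicator (cball (x i) (2 * r i)) z)" .
  qed
  also have "\<dots> = (\<Sum>i\<in>I. ennreal (M / r i) * emeasure lborel (cball (x i) (2 * r i)))"
    by (subst nn_integral_sum)
      (auto simp: nn_integral_cmult_indicator intro!: borel_measurable_times_ennreal borel_measurable_indicator)
  also have "\<dots> = (\<Sum>i\<in>I. ennreal (c * r i ^ d))"
  proof (rule sum.cong[OF refl])
    fix i
    have "emeasure lborel (cball (x i) (2 * r i)) = ennreal (unit_ball_vol (real DIM('b)) * (2 * r i) ^ DIM('b))"
      using r(1)[of i] by (intro emeasure_cball) simp
    then have "ennreal (M / r i) * emeasure lborel (cball (x i) (2 * r i)) =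
        ennreal (M / r i) * ennreal (unit_ball_vol (real DIM('b)) * (2 * r i) ^ DIM('b))"
      by (rule arg_cong)
    also have "\<dots> = ennreal (M / r i * (unit_ball_vol (real DIM('b)) * (2 * r i) ^ DIM('b)))"
      by (rule ennreal_mult'[symmetric]) (use M(1) r(1)[of i] in simp)
    also have "M / r i * (unit_ball_vol (real DIM('b)) * (2 * r i) ^ DIM('b)) = c * r i ^ d"
      using r(1)[of i] by (simp add: c_def d power_mult_distrib field_simps)
    finally show "ennreal (M / r i) * emeasure lborel (cball (x i) (2 * r i)) = ennreal (c * r i ^ d)" .
  qed
  also have "\<dots> = ennreal (c * (\<Sum>i\<in>I. r i ^ d))"
    using c r(1) by (simp add: sum_ennreal less_imp_le sum_distrib_left)
  also have "\<dots> \<le> ennreal e"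
    using mult_left_mono[OF sumr c] e1 by (intro ennreal_leI) linarith
  finally have int: "(\<integral>\<^sup>+z. ennreal (norm (d\<eta> z)) \<partial>lborel) \<le> ennreal e" .
  show ?thesis
  proof (rule that[OF \<eta>(1,2,3) _ I(3) _ int])
    show "open (\<Union>i\<in>I. ball (x i) (r i))" by auto
    show "\<eta> z = 0" if "z \<in> (\<Union>i\<in>I. ball (x i) (r i))" for z
    proof -
      obtain i where i: "i \<in> I" "z \<in> ball (x i) (r i)"
        using \<open>z \<in> (\<Union>i\<in>I. ball (x i) (r i))\<close> by blast
      then have "dist z (x i) \<le> r i" by (simp add: dist_commute)
      with i(1) show ?thesis by (rule \<eta>(4))
    qed
    show "\<eta> z = 1" if "\<And>y. y \<in> K \<Longrightarrow> e < dist z y" for z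
    proof (rule \<eta>(5))
      fix i assume "i \<in> I"
      then have "e < dist z (x i)" using x(2) I(1) by (intro that) auto
      then show "2 * r i \<le> dist z (x i)" using r(2)[of i] e by linarith
    qed
  qed
qed

section \<open>Weights and one-sided normal derivatives\<close>

definition weight :: "'b::euclidean_space \<Rightarrow> real \<Rightarrow> 'b \<Rightarrow> real" where
  "weight b k x = x \<bullet> b + k * (1 + x \<bullet> x) / 2"

definition weight_grad :: "'b::euclidean_space \<Rightarrow> real \<Rightarrow> 'b \<Rightarrow> 'b" where
  "weight_grad b k x = b + k *\<^sub>R x"

lemma weight_c1: "c1_on U (weight b k) (weight_grad b k)"
  unfolding c1_on_def weight_grad_def[abs_def] gderiv_def weight_def[abs_def]
  by (auto intro!: continuous_intros derivative_eq_intros simp: algebra_simps inner_commute)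

lemma weight_grad_c1: "c1_on U (\<lambda>x. weight_grad b k x \<bullet> e) (\<lambda>x. k *\<^sub>R e)"
  unfolding c1_on_def weight_grad_def gderiv_def
  by (auto intro!: continuous_intros derivative_eq_intros simp: inner_add_left)

text \<open>On the unit sphere \<open>k * (x \<bullet> x)\<close> and
  \<open>k * (1 + x \<bullet> x) / 2\<close> are both \<open>k\<close>.\<close>

lemma weight_grad_radial: "norm x = 1 \<Longrightarrow> weight_grad b k x \<bullet> x = weight b k x"
  by (simp add: weight_def weight_grad_def inner_add_left inner_commute[of b x] norm_eq_1)

lemma graph_chart_shrink: "graph_chart Q p r \<epsilon> h dh \<Omega> \<Longrightarrow> 0 < s \<Longrightarrow> s \<le> r \<Longrightarrow> graph_chart Q p s \<epsilon> h dh \<Omega>"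
  by (auto simp: graph_chart_def graph_chart_axioms_def)

text \<open>Along \<open>v\<close> the defining function has the positive derivative
  \<open>norm g\<close>, so it is negative just before \<open>x\<close>. This ensures that the
  one-sided difference quotients see only values of \<open>u\<close> in \<Omega>.\<close>

lemma outward_unit_normal_inside:
  assumes "outward_unit_normal \<Omega> x v"
  shows "\<forall>\<^sub>F t in at_left 0. x + t *\<^sub>R v \<in> \<Omega>"
proof -
  obtain U \<rho> g where U: "open U" "x \<in> U" "\<rho> x = 0" "\<Omega> \<inter> U = {y \<in> U. \<rho> y < 0}" "GDERIV \<rho> x :> g"
    "g \<noteq> 0" "v = sgn g"
    using assms unfolding outward_unit_normal_def by blast
  have gv: "v \<bullet> g > 0" using U(6) by (simp add: U(7) sgn_div_norm)
  have "((\<lambda>s. \<rho> (x + s *\<^sub>R v)) has_derivative (\<lambda>s. (s *\<^sub>R v) \<bullet> g)) (at 0)"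
  proof (rule has_derivative_compose[where g = \<rho> and f = "\<lambda>s. x + s *\<^sub>R v"])
    show "((\<lambda>s. x + s *\<^sub>R v) has_derivative (\<lambda>s. s *\<^sub>R v)) (at 0)" by (auto intro!: derivative_eq_intros)
    show "(\<rho> has_derivative (\<lambda>w. w \<bullet> g)) (at (x + 0 *\<^sub>R v))" using GDERIV_has_derivative[OF U(5)] by simp
  qed
  then have "((\<lambda>s. \<rho> (x + s *\<^sub>R v)) has_real_derivative v \<bullet> g) (at 0)"
    by (simp add: has_field_derivative_def mult.commute[of _ "v \<bullet> g"])
  then obtain d where d: "d > 0" "\<And>s. 0 < s \<Longrightarrow> s < d \<Longrightarrow> \<rho> (x + (0 - s) *\<^sub>R v) < \<rho> (x + 0 *\<^sub>R v)"
    using DERIV_pos_inc_left[of "\<lambda>s. \<rho> (x + s *\<^sub>R v)" "v \<bullet> g" 0] gv by force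
  have "\<forall>\<^sub>F t in at_left 0. t \<in> {- d<..<0}" by (rule eventually_at_left_real) (use d in simp)
  then have 1: "\<forall>\<^sub>F t in at_left 0. \<rho> (x + t *\<^sub>R v) < 0"
  proof eventually_elim
    case (elim t) then show ?case using d(2)[of "- t"] U(3) by simp
  qed
  have "((\<lambda>t. x + t *\<^sub>R v) \<longlongrightarrow> x + 0 *\<^sub>R v) (at_left 0)" by (intro tendsto_intros)
  then have "\<forall>\<^sub>F t in at_left 0. x + t *\<^sub>R v \<in> U" using U(1,2) by (simp add: tendsto_def)
  with 1 show ?thesis by eventually_elim (use U(4) in blast)
qed

text \<open>This links the boundary conditions, stated by one-sided derivatives of \<open>u\<close>,
  to the gradient of a local smooth extension: the two functions agree on a short inward normal
  segment.\<close>

lemma normal_derivative_unique: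
  assumes "outward_unit_normal \<Omega> x v" "has_normal_derivative u x v d" "GDERIV g x :> D"
    and "open W" "x \<in> W" "\<And>y. y \<in> \<Omega> \<Longrightarrow> y \<in> W \<Longrightarrow> g y = u y" "g x = u x"
  shows "D \<bullet> v = d"
proof -
  have "((\<lambda>s. g (x + s *\<^sub>R v)) has_derivative (\<lambda>s. (s *\<^sub>R v) \<bullet> D)) (at 0)"
  proof (rule has_derivative_compose[where g = g and f = "\<lambda>s. x + s *\<^sub>R v"])
    show "((\<lambda>s. x + s *\<^sub>R v) has_derivative (\<lambda>s. s *\<^sub>R v)) (at 0)" by (auto intro!: derivative_eq_intros)
    show "(g has_derivative (\<lambda>w. w \<bullet> D)) (at (x + 0 *\<^sub>R v))" using GDERIV_has_derivative[OF assms(3)] by simp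
  qed
  then have "((\<lambda>s. g (x + s *\<^sub>R v)) has_real_derivative v \<bullet> D) (at 0)"
    by (simp add: has_field_derivative_def mult.commute[of _ "v \<bullet> D"])
  then have "((\<lambda>s. g (x + s *\<^sub>R v)) has_real_derivative v \<bullet> D) (at_left 0)"
    by (rule has_field_derivative_at_within)
  then have 1: "((\<lambda>s. (g (x + s *\<^sub>R v) - g x) / s) \<longlongrightarrow> v \<bullet> D) (at_left 0)"
    by (simp add: has_field_derivative_iff)
  have 2: "((\<lambda>s. (u (x + s *\<^sub>R v) - u x) / s) \<longlongrightarrow> d) (at_left 0)"
    using assms(2) by (simp add: has_normal_derivative_def has_field_derivative_iff)
  have "((\<lambda>t. x + t *\<^sub>R v) \<longlongrightarrow> x + 0 *\<^sub>R v) (at_left 0)" by (intro tendsto_intros)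
  then have "\<forall>\<^sub>F t in at_left 0. x + t *\<^sub>R v \<in> W" using assms(4,5) by (simp add: tendsto_def)
  with outward_unit_normal_inside[OF assms(1)]
  have "\<forall>\<^sub>F s in at_left 0. (u (x + s *\<^sub>R v) - u x) / s = (g (x + s *\<^sub>R v) - g x) / s"
    by eventually_elim (simp add: assms(6,7))
  from tendsto_cong[OF this] 2 have "((\<lambda>s. (g (x + s *\<^sub>R v) - g x) / s) \<longlongrightarrow> d) (at_left 0)" by simp
  with 1 show ?thesis using tendsto_unique[OF trivial_limit_at_left_real] by (metis inner_commute)
qed

lemma smooth_on_subset: "smooth_on A f \<Longrightarrow> B \<subseteq> A \<Longrightarrow> smooth_on B f"
  unfolding smooth_on_def
proof (rule ballI)
  fix p assume *: "\<forall>p\<in>A. \<exists>U g. open U \<and> p \<in> U \<and> (\<forall>k. Ck_on k U g) \<and> (\<forall>x\<in>A \<inter> U. g x = f x)"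
    "B \<subseteq> A" "p \<in> B"
  from bspec[OF *(1) subsetD[OF *(2,3)]] obtain U g
    where U: "open U \<and> p \<in> U \<and> (\<forall>k. Ck_on k U g) \<and> (\<forall>x\<in>A \<inter> U. g x = f x)" by (elim exE)
  have "\<forall>x\<in>B \<inter> U. g x = f x" using U *(2) by auto
  with U show "\<exists>U g. open U \<and> p \<in> U \<and> (\<forall>k. Ck_on k U g) \<and> (\<forall>x\<in>B \<inter> U. g x = f x)"
    by (intro exI[of _ U] exI[of _ g]) simp
qed

section \<open>Geometry of the mixed problem\<close>

text \<open>The Hoelder and Sobolev hypotheses appear here as bounds on \<open>u\<close> and its
  classical gradient. Positivity of the last coordinate is left to
  \<open>linear_weight_identity\<close>.\<close>

locale mixed_problem =
  fixes \<Omega> \<Sigma> T \<Lambda> :: "'b::euclidean_space set" and \<nu> :: "'b \<Rightarrow> 'b" and u :: "'b \<Rightarrow> real" and R :: real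
  assumes open_\<Omega>: "open \<Omega>" and \<Omega>_ball: "\<Omega> \<subseteq> ball 0 1" and \<Sigma>_ball: "\<Sigma> \<subseteq> ball 0 1"
    and T_def: "T = frontier \<Omega> - closure \<Sigma>" and T_sphere: "T \<subseteq> sphere 0 1"
    and frontier_eq: "frontier \<Omega> = closure \<Sigma> \<union> T"
    and \<Lambda>_def: "\<Lambda> = closure \<Sigma> \<inter> closure T" and closure_\<Sigma>: "closure \<Sigma> = \<Sigma> \<union> \<Lambda>"
    and normal: "\<And>x. x \<in> \<Sigma> \<union> T \<Longrightarrow> outward_unit_normal \<Omega> x (\<nu> x)"
    and smooth: "smooth_on (closure \<Omega> - \<Lambda>) u"
    and equation: "\<And>x. x \<in> \<Omega> \<Longrightarrow> laplacian u x = real DIM('b)"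
    and dirichlet: "\<And>x. x \<in> \<Sigma> \<Longrightarrow> u x = 0"
    and robin: "\<And>x. x \<in> T \<Longrightarrow> has_normal_derivative u x (\<nu> x) (u x)"
    and overdetermined: "\<And>x. x \<in> \<Sigma> \<Longrightarrow> has_normal_derivative u x (\<nu> x) R"
    and bounded_u: "\<exists>C. \<forall>x\<in>\<Omega>. \<bar>u x\<bar> \<le> C"
    and bounded_grad: "\<exists>C. \<forall>x\<in>\<Omega>. norm (grad u x) \<le> C"
begin

lemma \<Omega>_frontier: "\<Omega> \<inter> frontier \<Omega> = {}"
  using open_\<Omega> by (auto simp: frontier_def interior_open)

lemma closure_\<Omega>: "closure \<Omega> = \<Omega> \<union> \<Sigma> \<union> T \<union> \<Lambda>"
  using frontier_eq closure_\<Sigma> closure_Un_frontier[of \<Omega>] by auto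

lemma closed_\<Lambda>: "closed \<Lambda>"
  by (simp add: \<Lambda>_def closed_Int)

lemma \<Lambda>_sphere: "closure T \<subseteq> sphere 0 1" "\<Lambda> \<subseteq> sphere 0 1"
proof -
  show "closure T \<subseteq> sphere 0 1" using T_sphere by (rule closure_minimal) simp
  then show "\<Lambda> \<subseteq> sphere 0 1" by (auto simp: \<Lambda>_def)
qed

text \<open>The key separation is that \<Sigma> lies in the open ball whereas the closure of
  \<open>T\<close> lies in the sphere.\<close>

lemma disjoint_parts: "\<Sigma> \<inter> closure T = {}" "\<Sigma> \<inter> \<Lambda> = {}" "T \<inter> closure \<Sigma> = {}" "\<Omega> \<inter> \<Sigma> = {}" "\<Omega> \<inter> \<Lambda> = {}" "T \<inter> \<Lambda> = {}"
  "\<Sigma> \<subseteq> frontier \<Omega>" "T \<subseteq> frontier \<Omega>"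
proof -
  show 1: "\<Sigma> \<inter> closure T = {}" using \<Lambda>_sphere \<Sigma>_ball by fastforce
  show "\<Sigma> \<inter> \<Lambda> = {}" using 1 by (auto simp: \<Lambda>_def)
  show "T \<inter> closure \<Sigma> = {}" by (auto simp: T_def)
  then show "T \<inter> \<Lambda> = {}" by (auto simp: \<Lambda>_def)
  show "\<Sigma> \<subseteq> frontier \<Omega>" "T \<subseteq> frontier \<Omega>" using frontier_eq closure_\<Sigma> by auto
  then show "\<Omega> \<inter> \<Sigma> = {}" using \<Omega>_frontier by auto
  show "\<Omega> \<inter> \<Lambda> = {}" using \<Omega>_frontier frontier_eq closure_\<Sigma> by auto
qed

lemma T_regular: "x \<in> T \<Longrightarrow> x \<in> closure \<Omega> - \<Lambda>"
  using closure_\<Omega> disjoint_parts(6) by blast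

lemma \<Sigma>_measurable [measurable]: "\<Sigma> \<in> sets borel"
proof -
  have "\<Sigma> = closure \<Sigma> - \<Lambda>" using closure_\<Sigma> disjoint_parts(2) by blast
  moreover have "closure \<Sigma> - \<Lambda> \<in> sets borel" using closed_\<Lambda> by (intro sets.Diff borel_closed) auto
  ultimately show ?thesis by simp
qed

lemma \<Omega>_measurable [measurable]: "\<Omega> \<in> sets borel"
  using open_\<Omega> by simp

lemma isolate_\<Sigma>:
  assumes "p \<in> \<Sigma>"
  obtains s where "s > 0" "\<Sigma> \<inter> ball p s = frontier \<Omega> \<inter> ball p s"
proof -
  have "open (- closure T)" "p \<in> - closure T" using disjoint_parts(1) assms by auto
  then obtain s where s: "s > 0" "ball p s \<subseteq> - closure T" by (rule openE)
  moreover have "T \<subseteq> closure T" by (rule closure_subset)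
  moreover have "frontier \<Omega> = \<Sigma> \<union> \<Lambda> \<union> T" using frontier_eq closure_\<Sigma> by simp
  moreover have "\<Lambda> \<subseteq> closure T" by (simp add: \<Lambda>_def)
  ultimately have "\<Sigma> \<inter> ball p s = frontier \<Omega> \<inter> ball p s" by blast
  with s(1) show ?thesis by (rule that)
qed

lemma isolate_T:
  assumes "p \<in> T"
  obtains s where "s > 0" "frontier \<Omega> \<inter> ball p s \<subseteq> T" "\<Sigma> \<inter> ball p s = {}"
proof -
  have "open (- closure \<Sigma>)" "p \<in> - closure \<Sigma>" using disjoint_parts(3) assms by auto
  then obtain s where s: "s > 0" "ball p s \<subseteq> - closure \<Sigma>" by (rule openE)
  moreover have "\<Sigma> \<subseteq> closure \<Sigma>" by (rule closure_subset)
  ultimately show ?thesis using that[of s] frontier_eq by auto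
qed

lemma chart_exists:
  assumes dim: "DIM('b) = Suc DIM('a::euclidean_space)" and p: "p \<in> \<Sigma> \<union> T" and "\<epsilon> > 0"
  obtains Q :: "'a::euclidean_space \<times> real \<Rightarrow> 'b" and r h dh where "graph_chart Q p r \<epsilon> h dh \<Omega>"
proof -
  obtain U \<rho> g where U: "open U" "p \<in> U" "smooth_on U \<rho>" "\<rho> p = 0" "\<Omega> \<inter> U = {y \<in> U. \<rho> y < 0}"
    "GDERIV \<rho> p :> g" "g \<noteq> 0"
    using normal[OF p] unfolding outward_unit_normal_def by blast
  have c: "c1_on U \<rho> (grad \<rho>)" by (rule smooth_on_open_c1[OF U(1,3)])
  have "grad \<rho> p \<noteq> 0" using GDERIV_unique[OF c1_onD[OF c U(2)] U(6)] U(7) by simp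
  from graph_chart_exists[OF dim open_\<Omega> U(1,2) c U(4) this U(5) \<open>\<epsilon> > 0\<close>] that
  show ?thesis by metis
qed

text \<open>\<open>outward_unit_normal\<close> supplies a separate defining function at each
  boundary point, while the chart was built elsewhere; the direction of the gradient does not depend
  on the choice.\<close>

lemma normal_conormal:
  assumes "graph_chart Q p r \<epsilon> h dh \<Omega>" "norm (y, h y) < r" "graph_chart.graph Q p h y \<in> \<Sigma> \<union> T"
  shows "\<nu> (graph_chart.graph Q p h y) = sgn (graph_chart.conormal Q dh y)"
proof -
  interpret graph_chart Q p r \<epsilon> h dh \<Omega> by fact
  obtain U \<rho> g where U: "open U" "graph y \<in> U" "smooth_on U \<rho>" "\<Omega> \<inter> U = {y \<in> U. \<rho> y < 0}"
    "GDERIV \<rho> (graph y) :> g" "g \<noteq> 0" "\<nu> (graph y) = sgn g"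
    using normal[OF assms(3)] unfolding outward_unit_normal_def by blast
  have "continuous_on U \<rho>" by (rule c1_on_continuous[OF smooth_on_open_c1[OF U(1,3)]])
  then have "sgn g = sgn (conormal y)"
    by (intro gradient_of_defining_function[OF assms(2) U(1,2) _ _ U(5,6)] zero_on_frontier[OF open_\<Omega> U(1) _ U(4)])
      (use U(4) in auto)
  then show ?thesis using U(7) by simp
qed

text \<open>On \<open>T\<close> the function \<open>x \<bullet> x - 1\<close> is a one-sided defining function.\<close>

lemma normal_T:
  assumes dim: "DIM('b) = Suc DIM('a::euclidean_space)" and x: "x \<in> T"
  shows "\<nu> x = x"
proof -
  obtain Q :: "'a \<times> real \<Rightarrow> 'b" and r h dh where G: "graph_chart Q x r 1 h dh \<Omega>"
    by (rule chart_exists[OF dim _ zero_less_one, of x]) (use x in auto)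
  interpret graph_chart Q x r 1 h dh \<Omega> by (fact G)
  have "x \<in> frontier \<Omega> \<inter> ball x r" using x disjoint_parts(8) r by auto
  then obtain y where y: "x = graph y" "norm (y, h y) < r" unfolding frontier_in_ball by blast
  obtain s where s: "s > 0" "frontier \<Omega> \<inter> ball x s \<subseteq> T" by (rule isolate_T[OF x])
  have nx: "norm x = 1" using x T_sphere by auto
  have nu: "\<nu> x = sgn (conormal y)" using normal_conormal[OF G y(2)] x y(1) by simp
  have "((\<lambda>z. z \<bullet> z - 1) has_derivative (\<lambda>v. v \<bullet> (2 *\<^sub>R x))) (at x)"
    by (auto intro!: derivative_eq_intros simp: inner_commute)
  then have gd: "GDERIV (\<lambda>z. z \<bullet> z - 1) (graph y) :> 2 *\<^sub>R x" by (simp add: gderiv_def y(1)[symmetric])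
  have "sgn (2 *\<^sub>R x) = sgn (conormal y)"
  proof (rule gradient_of_defining_function[OF y(2) _ _ _ _ gd])
    show "open (ball x s)" "graph y \<in> ball x s" using s y(1) by auto
    show "z \<bullet> z - 1 = 0" if "z \<in> frontier \<Omega>" "z \<in> ball x s" for z
    proof -
      have "z \<in> T" using s(2) that by blast
      then have "norm z = 1" using T_sphere by auto
      then show ?thesis by (simp add: norm_eq_1)
    qed
    show "z \<bullet> z - 1 < 0" if "z \<in> \<Omega>" for z
    proof -
      have "norm z < 1" using \<Omega>_ball that by auto
      then have "(norm z)\<^sup>2 < 1" by (simp add: power_less_one_iff abs_square_less_1)
      then show ?thesis by (simp add: power2_norm_eq_inner)
    qed
    show "2 *\<^sub>R x \<noteq> 0" using nx by auto
  qed
  moreover have "sgn (2 *\<^sub>R x) = x" using nx by (simp add: sgn_scaleR sgn_div_norm)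
  ultimately show ?thesis using nu by simp
qed

lemma local_solution:
  assumes "p \<in> closure \<Omega> - \<Lambda>"
  obtains W g where "open W" "p \<in> W" "\<forall>k. Ck_on k W g" "\<And>x. x \<in> closure \<Omega> - \<Lambda> \<Longrightarrow> x \<in> W \<Longrightarrow> g x = u x"
  using smooth assms unfolding smooth_on_def by (metis IntI)

lemma solution_c1: "c1_on \<Omega> u (grad u)"
  using closure_\<Omega> disjoint_parts(5) by (intro smooth_on_open_c1[OF open_\<Omega>] smooth_on_subset[OF smooth]) auto

end

section \<open>Green's identity near a point\<close>

text \<open>Nonnegativity on \<Sigma> makes the surface flux of a nonnegative cutoff nonnegative, so
  that it can serve as a measure of error.\<close>

locale weighted_problem = mixed_problem \<Omega> \<Sigma> T \<Lambda> \<nu> u R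
  for \<Omega> \<Sigma> T \<Lambda> :: "'b::euclidean_space set" and \<nu> u R +
  fixes b :: 'b and k :: real
  assumes weight_nonneg: "x \<in> \<Sigma> \<Longrightarrow> 0 \<le> weight b k x"
begin

abbreviation "w \<equiv> weight b k"

abbreviation "dw \<equiv> weight_grad b k"

text \<open>Green's field \<open>w \<nabla>u - u \<nabla>w\<close> and its divergence. Its normal component is \<open>R w\<close> on \<open>\<Sigma>\<close> and, since
  both \<open>u\<close> and \<open>w\<close> satisfy the Robin condition, zero on \<open>T\<close>.\<close>

definition field :: "'b \<Rightarrow> 'b" where "field x = w x *\<^sub>R grad u x - u x *\<^sub>R dw x"

definition source :: "'b \<Rightarrow> real" where "source x = w x * real DIM('b) - u x * (k * real DIM('b))"

text \<open>The integral over \<Omega> of the divergence of \<open>\<eta> * field\<close>, expanded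
  by the product rule.\<close>

definition volume_flux :: "('b \<Rightarrow> real) \<Rightarrow> ('b \<Rightarrow> 'b) \<Rightarrow> real" where
  "volume_flux \<eta> d\<eta> = (LINT x|lborel. indicator \<Omega> x * (d\<eta> x \<bullet> field x + \<eta> x * source x))"

definition surface_flux :: "('b \<Rightarrow> real) \<Rightarrow> real" where
  "surface_flux \<eta> = (LINT x|surface_measure. indicator \<Sigma> x * (\<eta> x * w x))"

text \<open>The error bound is linear in \<eta>, so estimates for two cutoffs add up without any
  loss in \<delta>, however many pieces are glued.\<close>

definition flux_estimate :: "real \<Rightarrow> ('b \<Rightarrow> real) \<Rightarrow> ('b \<Rightarrow> 'b) \<Rightarrow> bool" where
  "flux_estimate \<delta> \<eta> d\<eta> \<longleftrightarrow> integrable surface_measure (\<lambda>x. indicator \<Sigma> x * (\<eta> x * w x)) \<and>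
     \<bar>volume_flux \<eta> d\<eta> - R * surface_flux \<eta>\<bar> \<le> \<delta> * surface_flux \<eta>"

text \<open>Near a boundary point \<open>u\<close> is replaced by a smooth extension
  \<open>g\<close>, which gives a field that is differentiable on a full neighbourhood. Its
  divergence is \<open>source\<close> only inside \<Omega>, where the differential equation
  holds.\<close>

lemma local_field:
  assumes "p \<in> closure \<Omega> - \<Lambda>"
  obtains W g dZ where "open W" "p \<in> W" "c1_on W g (grad g)"
    "\<And>x. x \<in> closure \<Omega> - \<Lambda> \<Longrightarrow> x \<in> W \<Longrightarrow> g x = u x"
    "\<And>e. e \<in> Basis \<Longrightarrow> c1_on W (\<lambda>x. (w x *\<^sub>R grad g x - g x *\<^sub>R dw x) \<bullet> e) (dZ e)"
    "\<And>x. x \<in> \<Omega> \<Longrightarrow> x \<in> W \<Longrightarrow> w x *\<^sub>R grad g x - g x *\<^sub>R dw x = field x"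
    "\<And>x. x \<in> \<Omega> \<Longrightarrow> x \<in> W \<Longrightarrow> (\<Sum>e\<in>Basis. dZ e x \<bullet> e) = source x"
proof -
  obtain W g where W: "open W" "p \<in> W" "\<forall>k. Ck_on k W g"
    "\<And>x. x \<in> closure \<Omega> - \<Lambda> \<Longrightarrow> x \<in> W \<Longrightarrow> g x = u x" by (rule local_solution[OF assms]) blast
  have g1: "c1_on W g (grad g)" using W(3) Ck_on_imp_c1_on by blast
  define H where "H e = grad (\<lambda>x. frechet_derivative g (at x) e)" for e
  have g2: "c1_on W (\<lambda>x. grad g x \<bullet> e) (H e)" if "e \<in> Basis" for e
    unfolding H_def using W(3) Ck_on_imp_c1_on_grad[OF _ that] by blast
  define dZ where "dZ e x = (w x *\<^sub>R H e x + (grad g x \<bullet> e) *\<^sub>R dw x) - (g x *\<^sub>R (k *\<^sub>R e) + (dw x \<bullet> e) *\<^sub>R grad g x)" for e x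
  have c: "c1_on W (\<lambda>x. (w x *\<^sub>R grad g x - g x *\<^sub>R dw x) \<bullet> e) (dZ e)" if "e \<in> Basis" for e
  proof -
    have "c1_on W (\<lambda>x. w x * (grad g x \<bullet> e) - g x * (dw x \<bullet> e)) (dZ e)"
      unfolding dZ_def
      by (intro c1_on_diff c1_on_mult weight_c1 weight_grad_c1 g1 g2 that)
    then show ?thesis by (simp add: inner_diff_left)
  qed
  have \<Omega>W: "open (\<Omega> \<inter> W)" using open_\<Omega> W by auto
  have eq: "g x = u x" if "x \<in> \<Omega> \<inter> W" for x
    using W(4)[of x] that closure_\<Omega> disjoint_parts(5) by auto
  have diff: "g differentiable (at x)" if "x \<in> W" for x
    using GDERIV_has_derivative[OF c1_onD[OF g1 that]] by (auto simp: differentiable_def)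
  have gg: "grad u x = grad g x" if "x \<in> \<Omega> \<inter> W" for x
    by (rule grad_cong_open[OF diff \<Omega>W]) (use that eq in auto)
  have lap: "laplacian g x = real DIM('b)" if "x \<in> \<Omega> \<inter> W" for x
  proof -
    have "laplacian u x = laplacian g x"
      by (rule laplacian_cong_open[OF _ \<Omega>W that eq]) (use W(3) Ck_on_subset in blast)
    then show ?thesis using equation that by simp
  qed
  have src: "(\<Sum>e\<in>Basis. dZ e x \<bullet> e) = source x" if x: "x \<in> \<Omega> \<inter> W" for x
  proof -
    \<comment> \<open>The mixed products of first derivatives cancel, as in Green's second
      identity.\<close>
    have "(\<Sum>e\<in>Basis. dZ e x \<bullet> e) =
      (\<Sum>e\<in>Basis. w x * (H e x \<bullet> e) - (g x * k) + ((grad g x \<bullet> e) * (dw x \<bullet> e) - (dw x \<bullet> e) * (grad g x \<bullet> e)))"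
      by (intro sum.cong refl) (simp add: dZ_def inner_diff_left inner_add_left inner_same_Basis)
    also have "\<dots> = w x * (\<Sum>e\<in>Basis. H e x \<bullet> e) - real DIM('b) * (g x * k)"
      by (simp add: sum_subtractf sum_distrib_left)
    also have "(\<Sum>e\<in>Basis. H e x \<bullet> e) = laplacian g x"
      unfolding laplacian_def H_def by (intro sum.cong refl) (simp add: grad_inner_Basis)
    finally show ?thesis using lap[OF x] eq[OF x] by (simp add: source_def)
  qed
  show ?thesis
    by (rule that[OF W(1,2) g1 W(4) c]) (use gg eq src in \<open>auto simp: field_def\<close>)
qed

lemma volume_flux_local:
  assumes \<eta>: "c1_on UNIV \<eta> d\<eta>" and supp: "\<And>x. s < dist x p \<Longrightarrow> \<eta> x = 0" and s: "s < r" "ball p r \<subseteq> W"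
    and Z: "\<And>x. x \<in> \<Omega> \<Longrightarrow> x \<in> W \<Longrightarrow> Z x = field x" "\<And>x. x \<in> \<Omega> \<Longrightarrow> x \<in> W \<Longrightarrow> (\<Sum>e\<in>Basis. dZ e x \<bullet> e) = source x"
  shows "volume_flux \<eta> d\<eta> = (LINT x|lborel. indicator \<Omega> x * (d\<eta> x \<bullet> Z x + \<eta> x * (\<Sum>e\<in>Basis. dZ e x \<bullet> e)))"
  unfolding volume_flux_def
proof (rule Bochner_Integration.integral_cong[OF refl])
  fix x
  show "indicator \<Omega> x * (d\<eta> x \<bullet> field x + \<eta> x * source x) =
    indicator \<Omega> x * (d\<eta> x \<bullet> Z x + \<eta> x * (\<Sum>e\<in>Basis. dZ e x \<bullet> e))"
  proof (cases "x \<in> ball p r")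
    case True
    then show ?thesis using Z[of x] s(2) by (auto simp: indicator_def)
  next
    case False
    then have "s < dist x p" using s by (simp add: dist_commute)
    moreover have "open {x. s < dist x p}" by (intro open_Collect_less continuous_intros)
    ultimately have "d\<eta> x = 0"
      using supp by (intro c1_on_gradient_zero[OF \<eta>, of "{x. s < dist x p}"]) auto
    then show ?thesis using supp[OF \<open>s < dist x p\<close>] by simp
  qed
qed

lemma flux_estimate_trivial:
  assumes "volume_flux \<eta> d\<eta> = 0" "\<And>x. x \<in> \<Sigma> \<Longrightarrow> \<eta> x = 0"
  shows "flux_estimate \<delta> \<eta> d\<eta>"
proof -
  have "(\<lambda>x. indicator \<Sigma> x * (\<eta> x * w x)) = (\<lambda>x. 0)" using assms(2) by (auto simp: indicator_def fun_eq_iff)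
  then show ?thesis using assms(1) by (simp add: flux_estimate_def surface_flux_def)
qed

text \<open>Inside \<Omega> there is no boundary and both fluxes vanish. Near \<open>T\<close> the
  boundary integrand is identically zero. Near \<Sigma> it is \<open>R * w\<close> times the length
  of the conormal, and the two ways of integrating it over the boundary differ by a factor close to
  1.\<close>

lemma local_estimate:
  assumes dim: "DIM('b) = Suc DIM('a::euclidean_space)" and p: "p \<in> closure \<Omega> - \<Lambda>" and \<delta>: "\<delta> > 0"
  shows "\<exists>r>0. \<forall>\<eta> d\<eta> s. c1_on UNIV \<eta> d\<eta> \<longrightarrow> (\<forall>x. 0 \<le> \<eta> x) \<longrightarrow> s < r \<longrightarrow>
    (\<forall>x. s < dist x p \<longrightarrow> \<eta> x = 0) \<longrightarrow> flux_estimate \<delta> \<eta> d\<eta>"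
proof -
  obtain W g dZ where W: "open W" "p \<in> W" "c1_on W g (grad g)"
    "\<And>x. x \<in> closure \<Omega> - \<Lambda> \<Longrightarrow> x \<in> W \<Longrightarrow> g x = u x"
    "\<And>e. e \<in> Basis \<Longrightarrow> c1_on W (\<lambda>x. (w x *\<^sub>R grad g x - g x *\<^sub>R dw x) \<bullet> e) (dZ e)"
    "\<And>x. x \<in> \<Omega> \<Longrightarrow> x \<in> W \<Longrightarrow> w x *\<^sub>R grad g x - g x *\<^sub>R dw x = field x"
    "\<And>x. x \<in> \<Omega> \<Longrightarrow> x \<in> W \<Longrightarrow> (\<Sum>e\<in>Basis. dZ e x \<bullet> e) = source x"
    by (rule local_field[OF p]) blast
  define Z where "Z x = w x *\<^sub>R grad g x - g x *\<^sub>R dw x" for x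
  obtain s0 where s0: "s0 > 0" "ball p s0 \<subseteq> W" using W(1,2) by (rule openE)
  have bdry: "Z x \<bullet> \<nu> x = w x * d" if x: "x \<in> \<Sigma> \<union> T" "x \<in> W" and d: "has_normal_derivative u x (\<nu> x) d"
    and z: "u x * (dw x \<bullet> \<nu> x) = 0" for x d
  proof -
    have xin: "x \<in> closure \<Omega> - \<Lambda>" using x closure_\<Omega> disjoint_parts by auto
    have "grad g x \<bullet> \<nu> x = d"
    proof (rule normal_derivative_unique[OF normal[OF x(1)] d c1_onD[OF W(3) x(2)] W(1) x(2)])
      show "g x = u x" using W(4) xin x by auto
      show "g y = u y" if "y \<in> \<Omega>" "y \<in> W" for y using W(4)[of y] that closure_\<Omega> disjoint_parts(5) by auto
    qed
    moreover have "g x = u x" using W(4) xin x by auto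
    ultimately show ?thesis using z by (simp add: Z_def inner_diff_left)
  qed
  have vf: "volume_flux \<eta> d\<eta> = (LINT y|lborel. \<eta> (graph_chart.graph Q p h y) *
      (Z (graph_chart.graph Q p h y) \<bullet> graph_chart.conormal Q dh y))"
    if ch: "graph_chart Q p r \<epsilon> h dh \<Omega>" and rW: "ball p r \<subseteq> W"
      and \<eta>: "c1_on UNIV \<eta> d\<eta>" "s < r" "\<And>x. s < dist x p \<Longrightarrow> \<eta> x = 0"
    for Q :: "'a \<times> real \<Rightarrow> 'b" and r \<epsilon> h dh \<eta> d\<eta> s
  proof -
    interpret graph_chart Q p r \<epsilon> h dh \<Omega> by (fact ch)
    have "volume_flux \<eta> d\<eta> = (LINT x|lborel. indicator \<Omega> x * (d\<eta> x \<bullet> Z x + \<eta> x * (\<Sum>e\<in>Basis. dZ e x \<bullet> e)))"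
      by (rule volume_flux_local[OF \<eta>(1,3,2) rW]) (use W Z_def in auto)
    also have "\<dots> = (LINT y|lborel. \<eta> (graph y) * (Z (graph y) \<bullet> conormal y))"
      by (rule divergence_theorem[OF \<eta>(1,3,2)]) (use c1_on_subset[OF W(5) rW] Z_def in auto)
    finally show ?thesis .
  qed
  consider "p \<in> \<Omega>" | "p \<in> T" | "p \<in> \<Sigma>" using p closure_\<Omega> by auto
  then show ?thesis
  proof cases
    case 1
    obtain s1 where s1: "s1 > 0" "ball p s1 \<subseteq> \<Omega>" using open_\<Omega> 1 by (rule openE)
    define r where "r = min s0 s1"
    have rr: "r > 0" "ball p r \<subseteq> W" "ball p r \<subseteq> \<Omega>" using s0 s1 by (auto simp: r_def)
    obtain e :: 'b where "e \<in> Basis" by (meson nonempty_Basis ex_in_conv)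
    then obtain Q :: "'a \<times> real \<Rightarrow> 'b" where Q: "linear Q" "\<And>z. norm (Q z) = norm z" "surj Q"
      using adapted_isometry[OF dim, of e] by (metis norm_Basis)
    text \<open>A constant graph above the ball is a chart without boundary.\<close>
    have ch: "graph_chart Q p r 0 (\<lambda>y. r) (\<lambda>y. 0) \<Omega>"
    proof (unfold_locales)
      fix z :: "'a \<times> real" assume z: "norm z < r"
      have "p + Q z \<in> ball p r" using z Q(2) by (simp add: dist_norm)
      moreover have "snd z < r" using norm_snd_le[of "snd z" "fst z"] z by auto
      ultimately show "p + Q z \<in> \<Omega> \<longleftrightarrow> snd z < r" using rr(3) by auto
    qed (use Q dim rr open_\<Omega> c1_on_const in \<open>auto simp: linear_iff\<close>)
    interpret graph_chart Q p r 0 "\<lambda>y. r" "\<lambda>y. 0" \<Omega> by (fact ch)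
    have "flux_estimate \<delta> \<eta> d\<eta>" if \<eta>: "c1_on UNIV \<eta> d\<eta>" "s < r" "\<And>x. s < dist x p \<Longrightarrow> \<eta> x = 0" for \<eta> d\<eta> s
    proof (rule flux_estimate_trivial)
      have "\<eta> (graph y) = 0" for y
        using \<eta>(3)[of "graph y"] \<eta>(2) dist_graph[of y] norm_snd_le[of r y] by auto
      moreover have "volume_flux \<eta> d\<eta> = (LINT y|lborel. \<eta> (graph y) * (Z (graph y) \<bullet> conormal y))"
        by (rule vf[OF ch rr(2) \<eta>])
      ultimately show "volume_flux \<eta> d\<eta> = 0" by simp
      show "\<eta> x = 0" if "x \<in> \<Sigma>" for x
      proof -
        have "x \<notin> ball p r" using that rr(3) disjoint_parts(4) by blast
        then show ?thesis using \<eta>(2) by (intro \<eta>(3)) (simp add: dist_commute)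
      qed
    qed
    then show ?thesis using rr(1) by blast
  next
    case 2
    obtain s1 where s1: "s1 > 0" "frontier \<Omega> \<inter> ball p s1 \<subseteq> T" "\<Sigma> \<inter> ball p s1 = {}" by (rule isolate_T[OF 2])
    obtain Q :: "'a \<times> real \<Rightarrow> 'b" and r0 h dh where G: "graph_chart Q p r0 1 h dh \<Omega>"
      by (rule chart_exists[OF dim _ zero_less_one, of p]) (use 2 in auto)
    have r0: "r0 > 0" using G by (simp add: graph_chart_def graph_chart_axioms_def)
    define r where "r = min r0 (min s0 s1)"
    have rr: "r > 0" "ball p r \<subseteq> W" "ball p r \<subseteq> ball p s1" "r \<le> r0" using s0 s1 r0 by (auto simp: r_def)
    have ch: "graph_chart Q p r 1 h dh \<Omega>" by (rule graph_chart_shrink[OF G rr(1,4)])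
    interpret graph_chart Q p r 1 h dh \<Omega> by (fact ch)
    have "flux_estimate \<delta> \<eta> d\<eta>" if \<eta>: "c1_on UNIV \<eta> d\<eta>" "s < r" "\<And>x. s < dist x p \<Longrightarrow> \<eta> x = 0" for \<eta> d\<eta> s
    proof (rule flux_estimate_trivial)
      have "\<eta> (graph y) * (Z (graph y) \<bullet> conormal y) = 0" for y
      proof (cases "norm (y, h y) < r")
        case True
        then have "graph y \<in> frontier \<Omega> \<inter> ball p r" unfolding frontier_in_ball by blast
        then have x: "graph y \<in> T" "graph y \<in> W" using s1(2) rr by auto
        have n1: "norm (graph y) = 1" using x T_sphere by auto
        have \<nu>x: "\<nu> (graph y) = graph y" by (rule normal_T[OF dim x(1)])
        have "grad g (graph y) \<bullet> graph y = u (graph y)"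
        proof -
          have xin: "graph y \<in> closure \<Omega> - \<Lambda>" using x closure_\<Omega> disjoint_parts by auto
          have "grad g (graph y) \<bullet> \<nu> (graph y) = u (graph y)"
          proof (rule normal_derivative_unique[OF normal robin[OF x(1)] c1_onD[OF W(3) x(2)] W(1) x(2)])
            show "g (graph y) = u (graph y)" using W(4) xin x by auto
            show "g z = u z" if "z \<in> \<Omega>" "z \<in> W" for z
              using W(4)[of z] that closure_\<Omega> disjoint_parts(5) by auto
          qed (use x in simp)
          then show ?thesis by (simp add: \<nu>x)
        qed
        moreover have "g (graph y) = u (graph y)" by (rule W(4)[OF T_regular[OF x(1)] x(2)])
        ultimately have "Z (graph y) \<bullet> graph y = 0"
          using weight_grad_radial[OF n1] by (simp add: Z_def inner_diff_left)
        moreover have "graph y = sgn (conormal y)"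
          using normal_conormal[OF ch True] x(1) \<nu>x by simp
        ultimately have "Z (graph y) \<bullet> sgn (conormal y) = 0" by simp
        then have "Z (graph y) \<bullet> conormal y = 0" using conormal_nonzero by (simp add: sgn_div_norm)
        then show ?thesis by simp
      next
        case False
        then show ?thesis using \<eta>(2) \<eta>(3)[of "graph y"] by (simp add: dist_graph)
      qed
      moreover have "volume_flux \<eta> d\<eta> = (LINT y|lborel. \<eta> (graph y) * (Z (graph y) \<bullet> conormal y))"
        by (rule vf[OF ch rr(2) \<eta>])
      ultimately show "volume_flux \<eta> d\<eta> = 0" by (simp only: Bochner_Integration.integral_zero)
      show "\<eta> x = 0" if "x \<in> \<Sigma>" for x
      proof -
        have "x \<notin> ball p r" using that rr(3) s1(3) by blast
        then show ?thesis using \<eta>(2) by (intro \<eta>(3)) (simp add: dist_commute)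
      qed
    qed
    then show ?thesis using rr(1) by blast
  next
    case 3
    \<comment> \<open>The comparison error is multiplied by \<open>R\<close> in the end; the 1
      guards against \<open>R = 0\<close>.\<close>
    define \<delta>' where "\<delta>' = \<delta> / (\<bar>R\<bar> + 1)"
    have \<delta>': "\<delta>' > 0" "\<bar>R\<bar> * \<delta>' \<le> \<delta>" using \<delta> by (auto simp: \<delta>'_def field_simps)
    \<comment> \<open>The power \<open>Suc DIM('a)\<close> dominates both factors that occur:
      \<open>(1 + \<epsilon>) ^ DIM('a)\<close> from Hausdorff measure and
      \<open>1 + \<epsilon>\<close> from the length of the conormal.\<close>
    obtain \<epsilon> where eps: "\<epsilon> > 0" "(1 + \<epsilon>) ^ Suc DIM('a) \<le> 1 + \<delta>'"
    proof -
      have "((\<lambda>\<epsilon>. (1 + \<epsilon>) ^ Suc DIM('a)) \<longlongrightarrow> (1 + 0) ^ Suc DIM('a)) (at_right (0::real))" by (intro tendsto_intros)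
      moreover have "(1 + 0) ^ Suc DIM('a) < 1 + \<delta>'" using \<delta>' by simp
      ultimately have "\<forall>\<^sub>F \<epsilon> in at_right 0. (1 + \<epsilon>) ^ Suc DIM('a) < 1 + \<delta>'" by (rule order_tendstoD)
      moreover have "\<forall>\<^sub>F \<epsilon> in at_right (0::real). \<epsilon> > 0" by (rule eventually_at_right_less)
      ultimately have "\<forall>\<^sub>F \<epsilon> in at_right 0. \<epsilon> > 0 \<and> (1 + \<epsilon>) ^ Suc DIM('a) \<le> 1 + \<delta>'" by eventually_elim auto
      then have "\<exists>\<epsilon>. \<epsilon> > 0 \<and> (1 + \<epsilon>) ^ Suc DIM('a) \<le> 1 + \<delta>'" by (rule eventually_happens'[rotated]) simp
      then show ?thesis using that by blast
    qed
    have pw: "(1 + \<epsilon>) ^ DIM('a) \<le> 1 + \<delta>'" "1 + \<epsilon> \<le> 1 + \<delta>'"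
    proof -
      have "(1 + \<epsilon>) ^ DIM('a) \<le> (1 + \<epsilon>) ^ Suc DIM('a)" "(1 + \<epsilon>) ^ 1 \<le> (1 + \<epsilon>) ^ Suc DIM('a)"
        using eps(1) by (intro power_increasing; simp)+
      then show "(1 + \<epsilon>) ^ DIM('a) \<le> 1 + \<delta>'" "1 + \<epsilon> \<le> 1 + \<delta>'" using eps(2) by auto
    qed
    obtain s1 where s1: "s1 > 0" "\<Sigma> \<inter> ball p s1 = frontier \<Omega> \<inter> ball p s1" by (rule isolate_\<Sigma>[OF 3])
    obtain Q :: "'a \<times> real \<Rightarrow> 'b" and r0 h dh where G: "graph_chart Q p r0 \<epsilon> h dh \<Omega>"
      by (rule chart_exists[OF dim _ eps(1), of p]) (use 3 in auto)
    have r0: "r0 > 0" using G by (simp add: graph_chart_def graph_chart_axioms_def)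
    define r where "r = min r0 (min s0 s1)"
    have rr: "r > 0" "ball p r \<subseteq> W" "ball p r \<subseteq> ball p s1" "r \<le> r0" using s0 s1 r0 by (auto simp: r_def)
    have ch: "graph_chart Q p r \<epsilon> h dh \<Omega>" by (rule graph_chart_shrink[OF G rr(1,4)])
    interpret graph_chart Q p r \<epsilon> h dh \<Omega> by (fact ch)
    have \<Sigma>r: "\<Sigma> \<inter> ball p r = frontier \<Omega> \<inter> ball p r" using s1(2) rr(3) by blast
    have "flux_estimate \<delta> \<eta> d\<eta>" if \<eta>: "c1_on UNIV \<eta> d\<eta>" "s < r" "\<And>x. s < dist x p \<Longrightarrow> \<eta> x = 0"
      and nn: "\<And>x. 0 \<le> \<eta> x" for \<eta> d\<eta> s
    proof -
      have c\<eta>: "continuous_on UNIV \<eta>" by (rule c1_on_continuous[OF \<eta>(1)])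
      have cw: "continuous_on UNIV w" by (rule c1_on_continuous[OF weight_c1])
      have in\<Sigma>: "graph y \<in> \<Sigma>" "graph y \<in> W" if "norm (y, h y) < r" for y
      proof -
        have "graph y \<in> frontier \<Omega> \<inter> ball p r" using that unfolding frontier_in_ball by blast
        then show "graph y \<in> \<Sigma>" "graph y \<in> W" using \<Sigma>r rr by auto
      qed
      have out0: "\<eta> (graph y) = 0" if "\<not> norm (y, h y) < r" for y
        using that \<eta>(2) \<eta>(3)[of "graph y"] by (simp add: dist_graph)
      define f where "f y = \<eta> (graph y) * w (graph y)" for y
      have f0: "0 \<le> f y" for y
        using nn weight_nonneg in\<Sigma>(1)[of y] out0[of y] by (cases "norm (y, h y) < r") (auto simp: f_def)
      have nc: "f y * norm (conormal y) \<le> (1 + \<epsilon>) * f y" "f y \<le> f y * norm (conormal y)" for y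
      proof -
        show "f y \<le> f y * norm (conormal y)" using norm_conormal(1)[of y] f0[of y] by (simp add: mult_le_cancel_left1)
        show "f y * norm (conormal y) \<le> (1 + \<epsilon>) * f y"
        proof (cases "norm (y, h y) < r")
          case True
          then have "norm y < r" using norm_fst_le[of y "h y"] by simp
          then have "f y * norm (conormal y) \<le> f y * (1 + \<epsilon>)" by (intro mult_left_mono norm_conormal(2) f0)
          then show ?thesis by (simp only: mult.commute)
        qed (simp add: f_def out0)
      qed
      have contf: "continuous_on UNIV f" unfolding f_def
        by (intro continuous_intros continuous_on_compose2[OF c\<eta>] continuous_on_compose2[OF cw] continuous_graph) auto
      have fsupp: "f y = 0" if "r < norm y" for y
        using out0[of y] that norm_fst_le[of y "h y"] by (auto simp: f_def)
      have intf: "integrable lborel f" by (rule integrable_continuous_bounded_support[OF contf fsupp])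
      have intfn: "integrable lborel (\<lambda>y. f y * norm (conormal y))"
        by (rule integrable_continuous_bounded_support[where K = r])
          (auto intro!: continuous_intros contf continuous_conormal simp: fsupp)
      \<comment> \<open>\<open>J\<close> is the integral over the tangent plane. Both
        \<open>I\<close>, the flux without the factor \<open>R\<close>, and the surface flux lie
        between \<open>J\<close> and \<open>(1 + \<delta>') * J\<close>, so they differ by at most
        \<open>\<delta>' * J\<close>.\<close>
      define J where "J = (LINT y|lborel. f y)"
      define I where "I = (LINT y|lborel. f y * norm (conormal y))"
      have J0: "0 \<le> J" unfolding J_def using f0 by (intro integral_nonneg_AE) auto
      have JI: "J \<le> I" unfolding I_def J_def by (rule integral_mono[OF intf intfn nc(2)])
      have IJ: "I \<le> (1 + \<epsilon>) * J" unfolding I_def J_def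
        using integral_mono[OF intfn integrable_mult_right[OF intf, of "1 + \<epsilon>"] nc(1)] by simp
      have "volume_flux \<eta> d\<eta> = R * I"
      proof -
        have "\<eta> (graph y) * (Z (graph y) \<bullet> conormal y) = R * (f y * norm (conormal y))" for y
        proof (cases "norm (y, h y) < r")
          case True
          note x = in\<Sigma>[OF True]
          have "Z (graph y) \<bullet> \<nu> (graph y) = w (graph y) * R"
            by (rule bdry[OF _ x(2) overdetermined[OF x(1)]]) (use x dirichlet in auto)
          moreover have "\<nu> (graph y) = sgn (conormal y)" using normal_conormal[OF ch True] x(1) by simp
          ultimately have "Z (graph y) \<bullet> sgn (conormal y) = w (graph y) * R" by simp
          then have "Z (graph y) \<bullet> conormal y = w (graph y) * R * norm (conormal y)"
            using conormal_nonzero[of y] by (simp add: sgn_div_norm field_simps)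
          then show ?thesis by (simp add: f_def)
        qed (simp add: f_def out0)
        moreover have "volume_flux \<eta> d\<eta> = (LINT y|lborel. \<eta> (graph y) * (Z (graph y) \<bullet> conormal y))"
          by (rule vf[OF ch rr(2) \<eta>])
        ultimately show ?thesis by (simp add: I_def)
      qed
      define \<phi> where "\<phi> x = ennreal (\<eta> x * w x)" for x
      have \<phi>m: "\<phi> \<in> borel_measurable borel" unfolding \<phi>_def
        by (intro measurable_compose[OF _ measurable_ennreal] borel_measurable_continuous_onI continuous_intros c\<eta> cw)
      have \<phi>0: "\<phi> x = 0" if "x \<notin> ball p r" for x
      proof -
        have "\<eta> x = 0" using \<eta>(2) that by (intro \<eta>(3)) (simp add: dist_commute)
        then show ?thesis by (simp add: \<phi>_def)
      qed
      let ?H = "surface_measure :: 'b measure"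
      have Hd: "?H = hausdorff_measure DIM('a)" using dim by (simp add: surface_measure_def)
      have nnJ: "(\<integral>\<^sup>+y. \<phi> (graph y) \<partial>lborel) = ennreal J"
        unfolding \<phi>_def J_def f_def[symmetric] by (rule nn_integral_eq_integral[OF intf]) (use f0 in auto)
      let ?F = "\<lambda>x. indicator \<Sigma> x * (\<eta> x * w x)"
      have F0: "0 \<le> ?F x" for x using nn weight_nonneg by (auto simp: indicator_def)
      have Fm: "?F \<in> borel_measurable ?H"
      proof -
        have [measurable]: "\<eta> \<in> borel_measurable borel" "w \<in> borel_measurable borel"
          using c\<eta> cw by (auto intro: borel_measurable_continuous_onI)
        have "?F \<in> borel_measurable borel" by measurable
        then show ?thesis by (simp add: surface_measure_def cong: measurable_cong_sets)
      qed
      have Feq: "(\<integral>\<^sup>+x. ennreal (?F x) \<partial>?H) = (\<integral>\<^sup>+x. indicator \<Sigma> x * \<phi> x \<partial>?H)"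
        by (intro nn_integral_cong) (auto simp: \<phi>_def indicator_def)
      have b1: "ennreal J \<le> (\<integral>\<^sup>+x. ennreal (?F x) \<partial>?H)"
        using hausdorff_integral_graph(1)[OF \<Sigma>_measurable \<phi>m \<Sigma>r \<phi>0]
        unfolding Feq unfolding Hd nnJ .
      have b2: "(\<integral>\<^sup>+x. ennreal (?F x) \<partial>?H) \<le> ennreal ((1 + \<epsilon>) ^ DIM('a) * J)"
      proof -
        have "(\<integral>\<^sup>+x. ennreal (?F x) \<partial>?H) \<le> ennreal ((1 + \<epsilon>) ^ DIM('a)) * ennreal J"
          using hausdorff_integral_graph(2)[OF \<Sigma>_measurable \<phi>m \<Sigma>r \<phi>0]
          unfolding Feq unfolding Hd nnJ .
        then show ?thesis using J0 eps(1) by (simp add: ennreal_mult)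
      qed
      have intF: "integrable ?H ?F"
      proof (rule integrableI_nonneg[OF Fm])
        show "AE x in ?H. 0 \<le> ?F x" using F0 by simp
        show "(\<integral>\<^sup>+x. ennreal (?F x) \<partial>?H) < \<infinity>" using b2 by (rule order_le_less_trans) simp
      qed
      have nnF: "(\<integral>\<^sup>+x. ennreal (?F x) \<partial>?H) = ennreal (surface_flux \<eta>)"
        unfolding surface_flux_def by (rule nn_integral_eq_integral[OF intF]) (use F0 in auto)
      have G0: "0 \<le> surface_flux \<eta>" unfolding surface_flux_def using F0 by (intro integral_nonneg_AE) auto
      have JG: "J \<le> surface_flux \<eta>" using b1 G0 unfolding nnF by simp
      have "surface_flux \<eta> \<le> (1 + \<epsilon>) ^ DIM('a) * J"
        using b2 J0 eps(1) unfolding nnF by (subst (asm) ennreal_le_iff) auto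
      also have "\<dots> \<le> (1 + \<delta>') * J" using pw(1) J0 by (intro mult_right_mono)
      finally have GJ: "surface_flux \<eta> \<le> (1 + \<delta>') * J" .
      have "I \<le> (1 + \<delta>') * J" using IJ mult_right_mono[OF pw(2) J0] by linarith
      then have "\<bar>I - surface_flux \<eta>\<bar> \<le> \<delta>' * J" using JI JG GJ by (simp add: abs_le_iff algebra_simps)
      also have "\<dots> \<le> \<delta>' * surface_flux \<eta>" using JG \<delta>'(1) by (intro mult_left_mono) auto
      finally have "\<bar>R\<bar> * \<bar>I - surface_flux \<eta>\<bar> \<le> \<bar>R\<bar> * (\<delta>' * surface_flux \<eta>)" by (intro mult_left_mono) auto
      also have "\<dots> \<le> \<delta> * surface_flux \<eta>" using mult_right_mono[OF \<delta>'(2) G0] by (simp add: mult.assoc)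
      finally have "\<bar>volume_flux \<eta> d\<eta> - R * surface_flux \<eta>\<bar> \<le> \<delta> * surface_flux \<eta>"
        using \<open>volume_flux \<eta> d\<eta> = R * I\<close> by (simp add: abs_mult[symmetric] right_diff_distrib)
      then show ?thesis using intF by (simp add: flux_estimate_def)
    qed
    then show ?thesis using rr(1) by blast
  qed
qed

end

section \<open>Gluing the local estimates\<close>

context mixed_problem
begin

lemma integrable_on_\<Omega>:
  assumes "continuous_on \<Omega> f" "\<And>x. x \<in> \<Omega> \<Longrightarrow> \<bar>f x\<bar> \<le> (B::real)"
  shows "integrable lborel (\<lambda>x. indicator \<Omega> x * f x)"
proof (rule Bochner_Integration.integrable_bound[where f = "\<lambda>x. indicator (cball (0::'b) 1) x *\<^sub>R B"])
  show "integrable lborel (\<lambda>x. indicator (cball (0::'b) 1) x *\<^sub>R B)"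
    by (intro borel_integrable_compact) auto
  show "(\<lambda>x. indicator \<Omega> x * f x) \<in> borel_measurable lborel"
    using borel_measurable_continuous_on_indicator[OF \<Omega>_measurable assms(1)] by simp
  show "AE x in lborel. norm (indicator \<Omega> x * f x) \<le> norm (indicator (cball (0::'b) 1) x *\<^sub>R B)"
  proof (rule AE_I2)
    fix x
    show "norm (indicator \<Omega> x * f x) \<le> norm (indicator (cball (0::'b) 1) x *\<^sub>R B)"
    proof (cases "x \<in> \<Omega>")
      case True
      then have "x \<in> cball 0 1" using \<Omega>_ball by auto
      then show ?thesis using True assms(2)[OF True] by simp
    qed simp
  qed
qed

lemma compact_closure_\<Omega>: "compact (closure \<Omega>)"
  using \<Omega>_ball bounded_subset[OF bounded_ball] by (auto simp: compact_closure)

lemma compact_\<Lambda>: "compact \<Lambda>"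
  using closed_\<Lambda> \<Lambda>_sphere(2) compact_sphere compact_Int_closed[of "sphere 0 1" \<Lambda>] by (simp add: Int_absorb1)

end

context weighted_problem
begin

lemma continuous_field: "continuous_on \<Omega> field" "continuous_on \<Omega> source"
  unfolding field_def[abs_def] source_def[abs_def]
  by (intro continuous_intros c1_on_continuous[OF weight_c1] c1_on_continuous_gradient[OF weight_c1]
      c1_on_continuous[OF solution_c1] c1_on_continuous_gradient[OF solution_c1])+

text \<open>Here the bounds on \<open>u\<close> and its gradient enter. The bound on the field is
  what makes the gradient of the edge cutoff negligible.\<close>

lemma field_bound: obtains C where "C \<ge> 0" "\<And>x. x \<in> \<Omega> \<Longrightarrow> norm (field x) \<le> C" "\<And>x. x \<in> \<Omega> \<Longrightarrow> \<bar>source x\<bar> \<le> C"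
proof -
  obtain A where A: "\<And>x. x \<in> \<Omega> \<Longrightarrow> \<bar>u x\<bar> \<le> A" using bounded_u by blast
  obtain B where B: "\<And>x. x \<in> \<Omega> \<Longrightarrow> norm (grad u x) \<le> B" using bounded_grad by blast
  obtain D where D: "D \<ge> 0" "\<And>x::'b. norm x \<le> 1 \<Longrightarrow> norm (w x) \<le> D"
    using continuous_on_bounded_on_cball[OF c1_on_continuous[OF weight_c1]] by blast
  obtain E where E: "E \<ge> 0" "\<And>x::'b. norm x \<le> 1 \<Longrightarrow> norm (dw x) \<le> E"
    using continuous_on_bounded_on_cball[OF c1_on_continuous_gradient[OF weight_c1]] by blast
  have n1: "norm x \<le> 1" if "x \<in> \<Omega>" for x using \<Omega>_ball that by (auto simp: less_imp_le)
  define C where "C = D * \<bar>B\<bar> + \<bar>A\<bar> * E + D * real DIM('b) + \<bar>A\<bar> * (\<bar>k\<bar> * real DIM('b))"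
  have "norm (field x) \<le> C" "\<bar>source x\<bar> \<le> C" if x: "x \<in> \<Omega>" for x
  proof -
    have p: "0 \<le> D * \<bar>B\<bar>" "0 \<le> \<bar>A\<bar> * E" "0 \<le> D * real DIM('b)" "0 \<le> \<bar>A\<bar> * (\<bar>k\<bar> * real DIM('b))"
      using D(1) E(1) by auto
    have "norm (field x) \<le> \<bar>w x\<bar> * norm (grad u x) + \<bar>u x\<bar> * norm (dw x)"
      unfolding field_def using norm_triangle_ineq4[of "w x *\<^sub>R grad u x" "u x *\<^sub>R dw x"] by simp
    also have "\<dots> \<le> D * \<bar>B\<bar> + \<bar>A\<bar> * E"
      using A[OF x] B[OF x] D(2)[OF n1[OF x]] E(2)[OF n1[OF x]] D(1) by (intro add_mono mult_mono) auto
    finally show "norm (field x) \<le> C" using p unfolding C_def by linarith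
    have "\<bar>source x\<bar> \<le> \<bar>w x\<bar> * real DIM('b) + \<bar>u x\<bar> * (\<bar>k\<bar> * real DIM('b))"
      unfolding source_def using abs_triangle_ineq4[of "w x * real DIM('b)" "u x * (k * real DIM('b))"]
      by (simp add: abs_mult)
    also have "\<dots> \<le> D * real DIM('b) + \<bar>A\<bar> * (\<bar>k\<bar> * real DIM('b))"
      using A[OF x] D(2)[OF n1[OF x]] by (intro add_mono mult_right_mono) auto
    finally show "\<bar>source x\<bar> \<le> C" using p unfolding C_def by linarith
  qed
  moreover have "C \<ge> 0" using D(1) E(1) by (simp add: C_def)
  ultimately show ?thesis by (intro that)
qed

lemma integrable_volume:
  assumes \<eta>: "c1_on UNIV \<eta> d\<eta>"
  shows "integrable lborel (\<lambda>x. indicator \<Omega> x * (d\<eta> x \<bullet> field x))"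
    and "integrable lborel (\<lambda>x. indicator \<Omega> x * (\<eta> x * source x))"
proof -
  obtain C where C: "C \<ge> 0" "\<And>x. x \<in> \<Omega> \<Longrightarrow> norm (field x) \<le> C" "\<And>x. x \<in> \<Omega> \<Longrightarrow> \<bar>source x\<bar> \<le> C"
    by (rule field_bound) blast
  obtain D where D: "D \<ge> 0" "\<And>x::'b. norm x \<le> 1 \<Longrightarrow> norm (\<eta> x) \<le> D"
    using continuous_on_bounded_on_cball[OF c1_on_continuous[OF \<eta>]] by blast
  obtain E where E: "E \<ge> 0" "\<And>x::'b. norm x \<le> 1 \<Longrightarrow> norm (d\<eta> x) \<le> E"
    using continuous_on_bounded_on_cball[OF c1_on_continuous_gradient[OF \<eta>]] by blast
  have n1: "norm x \<le> 1" if "x \<in> \<Omega>" for x using \<Omega>_ball that by (auto simp: less_imp_le)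
  show "integrable lborel (\<lambda>x. indicator \<Omega> x * (d\<eta> x \<bullet> field x))"
  proof (rule integrable_on_\<Omega>)
    show "continuous_on \<Omega> (\<lambda>x. d\<eta> x \<bullet> field x)"
      by (intro continuous_intros continuous_field continuous_on_subset[OF c1_on_continuous_gradient[OF \<eta>]]) auto
    show "\<bar>d\<eta> x \<bullet> field x\<bar> \<le> E * C" if "x \<in> \<Omega>" for x
      using Cauchy_Schwarz_ineq2[of "d\<eta> x" "field x"] mult_mono[OF E(2)[OF n1[OF that]] C(2)[OF that] E(1)]
      by simp
  qed
  show "integrable lborel (\<lambda>x. indicator \<Omega> x * (\<eta> x * source x))"
  proof (rule integrable_on_\<Omega>)
    show "continuous_on \<Omega> (\<lambda>x. \<eta> x * source x)"
      by (intro continuous_intros continuous_field continuous_on_subset[OF c1_on_continuous[OF \<eta>]]) auto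
    show "\<bar>\<eta> x * source x\<bar> \<le> D * C" if "x \<in> \<Omega>" for x
      using mult_mono[OF D(2)[OF n1[OF that]] C(3)[OF that] D(1)] by (simp add: abs_mult)
  qed
qed

lemma volume_flux_split:
  assumes \<eta>: "c1_on UNIV \<eta> d\<eta>"
  shows "volume_flux \<eta> d\<eta> = (LINT x|lborel. indicator \<Omega> x * (d\<eta> x \<bullet> field x)) +
    (LINT x|lborel. indicator \<Omega> x * (\<eta> x * source x))"
  unfolding volume_flux_def distrib_left
  by (rule Bochner_Integration.integral_add[OF integrable_volume[OF \<eta>]])

lemma flux_estimate_add:
  assumes c: "c1_on UNIV \<eta>1 d1" "c1_on UNIV \<eta>2 d2" and e: "flux_estimate \<delta> \<eta>1 d1" "flux_estimate \<delta> \<eta>2 d2"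
    and eq: "\<And>x. \<eta> x = \<eta>1 x + \<eta>2 x" "\<And>x. d\<eta> x = d1 x + d2 x"
  shows "flux_estimate \<delta> \<eta> d\<eta>"
proof -
  have c': "c1_on UNIV \<eta> d\<eta>" using c1_on_add[OF c] by (simp add: eq[abs_def])
  have i: "integrable surface_measure (\<lambda>x. indicator \<Sigma> x * (\<eta>1 x * w x))"
    "integrable surface_measure (\<lambda>x. indicator \<Sigma> x * (\<eta>2 x * w x))"
    using e by (auto simp: flux_estimate_def)
  have "volume_flux \<eta> d\<eta> = volume_flux \<eta>1 d1 + volume_flux \<eta>2 d2"
    unfolding volume_flux_split[OF c(1)] volume_flux_split[OF c(2)] volume_flux_split[OF c']
    using integrable_volume[OF c(1)] integrable_volume[OF c(2)]
    by (simp add: eq inner_add_left distrib_left distrib_right)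
  moreover have s: "(\<lambda>x. indicator \<Sigma> x * (\<eta> x * w x)) =
      (\<lambda>x. indicator \<Sigma> x * (\<eta>1 x * w x) + indicator \<Sigma> x * (\<eta>2 x * w x))"
    by (simp add: eq fun_eq_iff algebra_simps)
  then have "surface_flux \<eta> = surface_flux \<eta>1 + surface_flux \<eta>2"
    unfolding surface_flux_def using i by simp
  ultimately show ?thesis using e i s by (simp add: flux_estimate_def algebra_simps abs_le_iff)
qed

text \<open>A finite cover by good balls is glued by splitting \<open>\<eta> = \<eta> \<phi> + \<eta> (1 - \<phi>)\<close> with a bump function \<open>\<phi>\<close>,
  one ball at a time.\<close>

lemma flux_estimate_global:
  assumes dim: "DIM('b) = Suc DIM('a::euclidean_space)" and \<delta>: "\<delta> > 0"
    and \<eta>: "c1_on UNIV \<eta> d\<eta>" "\<And>x. 0 \<le> \<eta> x" and V: "open V" "\<Lambda> \<subseteq> V" "\<And>x. x \<in> V \<Longrightarrow> \<eta> x = 0"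
  shows "flux_estimate \<delta> \<eta> d\<eta>"
proof -
  have "\<exists>r. \<forall>p\<in>closure \<Omega> - \<Lambda>. r p > 0 \<and> (\<forall>\<eta> d\<eta> s. c1_on UNIV \<eta> d\<eta> \<longrightarrow> (\<forall>x. 0 \<le> \<eta> x) \<longrightarrow> s < r p \<longrightarrow>
    (\<forall>x. s < dist x p \<longrightarrow> \<eta> x = 0) \<longrightarrow> flux_estimate \<delta> \<eta> d\<eta>)"
    by (rule bchoice, rule ballI) (rule local_estimate[OF dim _ \<delta>])
  then obtain r where r: "\<And>p. p \<in> closure \<Omega> - \<Lambda> \<Longrightarrow> r p > 0"
    "\<And>p \<eta> d\<eta> s. p \<in> closure \<Omega> - \<Lambda> \<Longrightarrow> c1_on UNIV \<eta> d\<eta> \<Longrightarrow> (\<And>x. 0 \<le> \<eta> x) \<Longrightarrow> s < r p \<Longrightarrow>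
      (\<And>x. s < dist x p \<Longrightarrow> \<eta> x = 0) \<Longrightarrow> flux_estimate \<delta> \<eta> d\<eta>" by blast
  obtain M where bump: "\<And>(p::'b) r. r > 0 \<Longrightarrow> \<exists>g. c1_on UNIV (bump p r) g \<and> (\<forall>x. norm (g x) \<le> M / r)"
    by (rule bump_c1) blast
  have step: "\<forall>\<eta> d\<eta>. c1_on UNIV \<eta> d\<eta> \<longrightarrow> (\<forall>x. 0 \<le> \<eta> x) \<longrightarrow>
      (\<forall>x\<in>closure \<Omega>. \<eta> x \<noteq> 0 \<longrightarrow> (\<exists>p\<in>D. dist x p < r p / 3)) \<longrightarrow> flux_estimate \<delta> \<eta> d\<eta>"
    if "finite D" "D \<subseteq> closure \<Omega> - \<Lambda>" for D
    using that
  proof (induction D rule: finite_induct)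
    case empty
    show ?case
    proof (intro allI impI)
      fix \<eta> d\<eta> assume \<eta>: "c1_on UNIV \<eta> d\<eta>" "\<forall>x\<in>closure \<Omega>. \<eta> x \<noteq> 0 \<longrightarrow> (\<exists>p\<in>{}. dist x p < r p / 3)"
      then have z: "\<eta> x = 0" if "x \<in> closure \<Omega>" for x using that by blast
      have z\<Omega>: "\<eta> x = 0" "d\<eta> x = 0" if "x \<in> \<Omega>" for x
        using z closure_subset that c1_on_gradient_zero[OF \<eta>(1) open_\<Omega>, of 0 x] by blast+
      show "flux_estimate \<delta> \<eta> d\<eta>"
      proof (rule flux_estimate_trivial)
        have "indicator \<Omega> x * (d\<eta> x \<bullet> field x + \<eta> x * source x) = 0" for x
          using z\<Omega>[of x] by (cases "x \<in> \<Omega>") auto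
        then show "volume_flux \<eta> d\<eta> = 0" unfolding volume_flux_def by (simp only: Bochner_Integration.integral_zero)
        show "\<eta> x = 0" if "x \<in> \<Sigma>" for x using z[of x] that closure_\<Omega> by auto
      qed
    qed
  next
    case (insert p D)
    have p: "p \<in> closure \<Omega> - \<Lambda>" using insert by auto
    \<comment> \<open>A bump of radius \<open>r p / 3\<close> is 1 on the small ball for which
      \<open>p\<close> is responsible and vanishes beyond \<open>2 * (r p / 3)\<close>, hence is
      admissible for the estimate at \<open>p\<close>.\<close>
    have rp: "r p / 3 > 0" using r(1)[OF p] by simp
    obtain g where g: "c1_on UNIV (bump p (r p / 3)) g" using bump[OF rp] by blast
    let ?b = "bump p (r p / 3)"
    show ?case
    proof (intro allI impI)
      fix \<eta> d\<eta> assume \<eta>: "c1_on UNIV \<eta> d\<eta>" "\<forall>x. 0 \<le> \<eta> x"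
        "\<forall>x\<in>closure \<Omega>. \<eta> x \<noteq> 0 \<longrightarrow> (\<exists>q\<in>insert p D. dist x q < r q / 3)"
      have c1: "c1_on UNIV (\<lambda>x. \<eta> x * ?b x) (\<lambda>x. \<eta> x *\<^sub>R g x + ?b x *\<^sub>R d\<eta> x)"
        by (rule c1_on_mult[OF \<eta>(1) g])
      have c2: "c1_on UNIV (\<lambda>x. \<eta> x * (1 - ?b x)) (\<lambda>x. \<eta> x *\<^sub>R (0 - g x) + (1 - ?b x) *\<^sub>R d\<eta> x)"
        by (rule c1_on_mult[OF \<eta>(1) c1_on_diff[OF c1_on_const g]])
      have e1: "flux_estimate \<delta> (\<lambda>x. \<eta> x * ?b x) (\<lambda>x. \<eta> x *\<^sub>R g x + ?b x *\<^sub>R d\<eta> x)"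
      proof (rule r(2)[OF p c1])
        show "0 \<le> \<eta> x * ?b x" for x
          using \<eta>(2) bump_range(1)[of p "r p / 3" x] by (intro mult_nonneg_nonneg) auto
        show "2 * (r p / 3) < r p" using rp by simp
        show "\<eta> x * ?b x = 0" if "2 * (r p / 3) < dist x p" for x
          using bump_eq_0[OF rp, of x p] that by simp
      qed
      have ih: "(\<forall>x. 0 \<le> \<eta>' x) \<Longrightarrow> (\<forall>x\<in>closure \<Omega>. \<eta>' x \<noteq> 0 \<longrightarrow> (\<exists>q\<in>D. dist x q < r q / 3)) \<Longrightarrow>
          flux_estimate \<delta> \<eta>' d\<eta>'" if "c1_on UNIV \<eta>' d\<eta>'" for \<eta>' d\<eta>'
        using insert.IH insert.prems that by blast
      have e2: "flux_estimate \<delta> (\<lambda>x. \<eta> x * (1 - ?b x)) (\<lambda>x. \<eta> x *\<^sub>R (0 - g x) + (1 - ?b x) *\<^sub>R d\<eta> x)"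
      proof (rule ih[OF c2])
        show "\<forall>x. 0 \<le> \<eta> x * (1 - ?b x)"
          using \<eta>(2) bump_range(2)[of p "r p / 3"] by (intro allI mult_nonneg_nonneg) auto
        show "\<forall>x\<in>closure \<Omega>. \<eta> x * (1 - ?b x) \<noteq> 0 \<longrightarrow> (\<exists>q\<in>D. dist x q < r q / 3)"
        proof (intro ballI impI)
          fix x assume x: "x \<in> closure \<Omega>" "\<eta> x * (1 - ?b x) \<noteq> 0"
          then obtain q where q: "q \<in> insert p D" "dist x q < r q / 3" using \<eta>(3) by auto
          moreover have "q \<noteq> p" using q(2) x(2) bump_eq_1[OF rp, of x p] by auto
          ultimately show "\<exists>q\<in>D. dist x q < r q / 3" by auto
        qed
      qed
      show "flux_estimate \<delta> \<eta> d\<eta>"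
        by (rule flux_estimate_add[OF c1 c2 e1 e2]) (simp_all add: algebra_simps)
    qed
  qed
  \<comment> \<open>Removing the neighbourhood of the edge leaves a compact set of points at which
    the local estimate is available.\<close>
  let ?X = "closure \<Omega> - V"
  have X: "compact ?X" using compact_closure_\<Omega> V(1) by (rule compact_diff)
  have Xs: "?X \<subseteq> closure \<Omega> - \<Lambda>" using V(2) by blast
  have cov: "?X \<subseteq> (\<Union>p\<in>?X. ball p (r p / 3))"
  proof
    fix x assume "x \<in> ?X"
    moreover from this have "x \<in> ball x (r x / 3)" using r(1)[of x] Xs by auto
    ultimately show "x \<in> (\<Union>p\<in>?X. ball p (r p / 3))" by (rule UN_I)
  qed
  obtain D where D: "D \<subseteq> ?X" "finite D" "?X \<subseteq> (\<Union>p\<in>D. ball p (r p / 3))"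
    by (rule compactE_image[OF X _ cov]) auto
  have "\<forall>x\<in>closure \<Omega>. \<eta> x \<noteq> 0 \<longrightarrow> (\<exists>p\<in>D. dist x p < r p / 3)"
  proof (intro ballI impI)
    fix x assume "x \<in> closure \<Omega>" "\<eta> x \<noteq> 0"
    then have "x \<in> ?X" using V(3) by auto
    then obtain p where "p \<in> D" "x \<in> ball p (r p / 3)" using D(3) by blast
    then show "\<exists>p\<in>D. dist x p < r p / 3" by (auto simp: dist_commute)
  qed
  with step[OF D(2) subset_trans[OF D(1) Xs]] \<eta> show ?thesis by blast
qed

text \<open>The estimate holds for every \<delta> > 0 and its right side is \<delta> times a fixed
  number, nonnegative by the case \<delta> = 1, so the difference vanishes.\<close>

lemma flux_identity:
  assumes dim: "DIM('b) = Suc DIM('a::euclidean_space)"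
    and \<eta>: "c1_on UNIV \<eta> d\<eta>" "\<And>x. 0 \<le> \<eta> x" and V: "open V" "\<Lambda> \<subseteq> V" "\<And>x. x \<in> V \<Longrightarrow> \<eta> x = 0"
  shows "integrable surface_measure (\<lambda>x. indicator \<Sigma> x * (\<eta> x * w x))"
    and "volume_flux \<eta> d\<eta> = R * surface_flux \<eta>"
proof -
  have est: "flux_estimate \<delta> \<eta> d\<eta>" if "\<delta> > 0" for \<delta>
    by (rule flux_estimate_global[OF dim that \<eta> V])
  show "integrable surface_measure (\<lambda>x. indicator \<Sigma> x * (\<eta> x * w x))"
    using est[of 1] by (simp add: flux_estimate_def)
  have "\<bar>volume_flux \<eta> d\<eta> - R * surface_flux \<eta>\<bar> \<le> surface_flux \<eta>"
    using est[of 1] by (simp add: flux_estimate_def)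
  then have G: "0 \<le> surface_flux \<eta>" by linarith
  define a where "a = \<bar>volume_flux \<eta> d\<eta> - R * surface_flux \<eta>\<bar>"
  have "a \<le> 0"
  proof (rule ccontr)
    assume "\<not> a \<le> 0"
    define \<delta> where "\<delta> = a / (2 * (surface_flux \<eta> + 1))"
    have "\<delta> > 0" using \<open>\<not> a \<le> 0\<close> G by (simp add: \<delta>_def)
    then have "a \<le> \<delta> * surface_flux \<eta>" using est by (simp add: flux_estimate_def a_def)
    moreover have "\<delta> * surface_flux \<eta> < \<delta> * (2 * (surface_flux \<eta> + 1))"
      using \<open>\<delta> > 0\<close> G by (intro mult_strict_left_mono) auto
    moreover have "\<delta> * (2 * (surface_flux \<eta> + 1)) = a" using G by (simp add: \<delta>_def)
    ultimately show False by simp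
  qed
  then show "volume_flux \<eta> d\<eta> = R * surface_flux \<eta>" by (simp add: a_def)
qed

text \<open>Removing the cutoff: its gradient contributes at most \<open>C \<integral>|\<nabla>\<eta>|\<close> because \<open>u\<close> is Lipschitz.\<close>

lemma volume_flux_tendsto:
  assumes \<eta>: "\<And>n. c1_on UNIV (\<eta> n) (d\<eta> n)" "\<And>n x. 0 \<le> \<eta> n x" "\<And>n x. \<eta> n x \<le> 1"
    and small: "\<And>n::nat. (\<integral>\<^sup>+x. ennreal (norm (d\<eta> n x)) \<partial>lborel) \<le> ennreal (1 / real (Suc n))"
    and lim: "\<And>x. x \<notin> \<Lambda> \<Longrightarrow> (\<lambda>n. \<eta> n x) \<longlonglongrightarrow> 1"
  shows "(\<lambda>n. volume_flux (\<eta> n) (d\<eta> n)) \<longlonglongrightarrow> (LINT x|lborel. indicator \<Omega> x * source x)"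
proof -
  obtain C where C: "C \<ge> 0" "\<And>x. x \<in> \<Omega> \<Longrightarrow> norm (field x) \<le> C" "\<And>x. x \<in> \<Omega> \<Longrightarrow> \<bar>source x\<bar> \<le> C"
    by (rule field_bound) blast
  have 1: "(\<lambda>n. LINT x|lborel. indicator \<Omega> x * (d\<eta> n x \<bullet> field x)) \<longlonglongrightarrow> 0"
  proof (rule tendsto_0_le[where K = C and f = "\<lambda>n. 1 / real (Suc n)"])
    show "(\<lambda>n. 1 / real (Suc n)) \<longlonglongrightarrow> 0" by (rule LIMSEQ_Suc[OF lim_1_over_n])
    have "norm (LINT x|lborel. indicator \<Omega> x * (d\<eta> n x \<bullet> field x)) \<le> norm (1 / real (Suc n)) * C" for n
    proof -
      have m: "d\<eta> n \<in> borel_measurable borel"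
        by (rule borel_measurable_continuous_onI[OF c1_on_continuous_gradient[OF \<eta>(1)]])
      have "ennreal (norm (LINT x|lborel. indicator \<Omega> x * (d\<eta> n x \<bullet> field x))) \<le>
          (\<integral>\<^sup>+x. ennreal (norm (indicator \<Omega> x * (d\<eta> n x \<bullet> field x))) \<partial>lborel)"
        by (rule integral_norm_bound_ennreal[OF integrable_volume(1)[OF \<eta>(1)]])
      also have "\<dots> \<le> (\<integral>\<^sup>+x. ennreal C * ennreal (norm (d\<eta> n x)) \<partial>lborel)"
      proof (rule nn_integral_mono)
        fix x
        have "norm (indicator \<Omega> x * (d\<eta> n x \<bullet> field x)) \<le> C * norm (d\<eta> n x)"
        proof (cases "x \<in> \<Omega>")
          case True
          have "\<bar>d\<eta> n x \<bullet> field x\<bar> \<le> norm (d\<eta> n x) * norm (field x)" by (rule Cauchy_Schwarz_ineq2)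
          also have "\<dots> \<le> norm (d\<eta> n x) * C" by (intro mult_left_mono C True) auto
          finally show ?thesis using True by (simp add: mult.commute)
        qed (simp add: C)
        then show "ennreal (norm (indicator \<Omega> x * (d\<eta> n x \<bullet> field x))) \<le> ennreal C * ennreal (norm (d\<eta> n x))"
          using C(1) by (simp add: ennreal_mult[symmetric] ennreal_leI)
      qed
      also have "\<dots> = ennreal C * (\<integral>\<^sup>+x. ennreal (norm (d\<eta> n x)) \<partial>lborel)"
        using m by (intro nn_integral_cmult) simp
      also have "\<dots> \<le> ennreal C * ennreal (1 / real (Suc n))" by (intro mult_left_mono small) simp
      also have "\<dots> = ennreal (C * (1 / real (Suc n)))" using C(1) by (intro ennreal_mult[symmetric]) auto
      finally have "norm (LINT x|lborel. indicator \<Omega> x * (d\<eta> n x \<bullet> field x)) \<le> C * (1 / real (Suc n))"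
        using C(1) by (subst (asm) ennreal_le_iff) auto
      then show ?thesis by (simp add: mult.commute)
    qed
    then show "\<forall>\<^sub>F n in sequentially. norm (LINT x|lborel. indicator \<Omega> x * (d\<eta> n x \<bullet> field x)) \<le> norm (1 / real (Suc n)) * C"
      by simp
  qed
  have isrc: "integrable lborel (\<lambda>x. indicator \<Omega> x * source x)"
    by (rule integrable_on_\<Omega>[OF continuous_field(2) C(3)])
  have 2: "(\<lambda>n. LINT x|lborel. indicator \<Omega> x * (\<eta> n x * source x)) \<longlonglongrightarrow> (LINT x|lborel. indicator \<Omega> x * source x)"
  proof (rule integral_dominated_convergence[where w = "\<lambda>x. norm (indicator \<Omega> x * source x)"])
    show "(\<lambda>x. indicator \<Omega> x * source x) \<in> borel_measurable lborel" using isrc by auto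
    show "(\<lambda>x. indicator \<Omega> x * (\<eta> n x * source x)) \<in> borel_measurable lborel" for n
      using integrable_volume(2)[OF \<eta>(1)] by auto
    show "integrable lborel (\<lambda>x. norm (indicator \<Omega> x * source x))" by (rule integrable_norm[OF isrc])
    show "AE x in lborel. (\<lambda>n. indicator \<Omega> x * (\<eta> n x * source x)) \<longlonglongrightarrow> indicator \<Omega> x * source x"
    proof (rule AE_I2)
      fix x
      show "(\<lambda>n. indicator \<Omega> x * (\<eta> n x * source x)) \<longlonglongrightarrow> indicator \<Omega> x * source x"
      proof (cases "x \<in> \<Omega>")
        case True
        then have "(\<lambda>n. \<eta> n x) \<longlonglongrightarrow> 1" using disjoint_parts(5) by (intro lim) auto
        then have "(\<lambda>n. indicator \<Omega> x * (\<eta> n x * source x)) \<longlonglongrightarrow> indicator \<Omega> x * (1 * source x)"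
          by (intro tendsto_intros)
        then show ?thesis by simp
      qed simp
    qed
    show "AE x in lborel. norm (indicator \<Omega> x * (\<eta> n x * source x)) \<le> norm (indicator \<Omega> x * source x)" for n
      using \<eta>(2,3)[of n] by (intro AE_I2) (auto simp: indicator_def abs_mult intro!: mult_left_le_one_le)
  qed
  have "(\<lambda>n. volume_flux (\<eta> n) (d\<eta> n)) \<longlonglongrightarrow> 0 + (LINT x|lborel. indicator \<Omega> x * source x)"
    unfolding volume_flux_split[OF \<eta>(1)] by (rule tendsto_add[OF 1 2])
  then show ?thesis by simp
qed

end

section \<open>Removing the cutoff at the edge\<close>

context mixed_problem
begin

text \<open>The same number \<open>1 / Suc n\<close> bounds the gradient integral and the distance
  from \<Lambda> within which the cutoff may differ from 1; a point off the closed set \<Lambda> is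
  eventually farther away.\<close>

lemma cutoff_sequence:
  assumes null: "hausdorff_outer_measure d \<Lambda> = 0" and d: "DIM('b) = Suc d"
  obtains \<eta> :: "nat \<Rightarrow> 'b \<Rightarrow> real" and d\<eta> V where "\<And>n. c1_on UNIV (\<eta> n) (d\<eta> n)" "\<And>n x. 0 \<le> \<eta> n x"
    "\<And>n x. \<eta> n x \<le> 1" "\<And>n. open (V n)" "\<And>n. \<Lambda> \<subseteq> V n" "\<And>n x. x \<in> V n \<Longrightarrow> \<eta> n x = 0"
    "\<And>n. (\<integral>\<^sup>+x. ennreal (norm (d\<eta> n x)) \<partial>lborel) \<le> ennreal (1 / real (Suc n))"
    "\<And>x. x \<notin> \<Lambda> \<Longrightarrow> (\<lambda>n. \<eta> n x) \<longlonglongrightarrow> 1"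
proof -
  have "\<exists>\<eta> d\<eta> V. c1_on UNIV \<eta> d\<eta> \<and> (\<forall>x. 0 \<le> \<eta> x) \<and> (\<forall>x. \<eta> x \<le> 1) \<and> open V \<and> \<Lambda> \<subseteq> V \<and> (\<forall>x\<in>V. \<eta> x = 0) \<and>
    (\<integral>\<^sup>+x. ennreal (norm (d\<eta> x)) \<partial>lborel) \<le> ennreal (1 / real (Suc n)) \<and>
    (\<forall>x. (\<forall>y\<in>\<Lambda>. 1 / real (Suc n) < dist x y) \<longrightarrow> \<eta> x = 1)" for n
  proof -
    have "0 < 1 / real (Suc n)" by simp
    then obtain \<eta> d\<eta> V where "c1_on UNIV \<eta> d\<eta>" "\<And>z. 0 \<le> \<eta> z" "\<And>z. \<eta> z \<le> 1" "open V" "\<Lambda> \<subseteq> V"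
      "\<And>z. z \<in> V \<Longrightarrow> \<eta> z = 0" "(\<integral>\<^sup>+z. ennreal (norm (d\<eta> z)) \<partial>lborel) \<le> ennreal (1 / real (Suc n))"
      "\<And>z. (\<And>y. y \<in> \<Lambda> \<Longrightarrow> 1 / real (Suc n) < dist z y) \<Longrightarrow> \<eta> z = 1"
      by (rule capacity_cutoff[OF compact_\<Lambda> null d]) blast
    then show ?thesis by (intro exI[of _ \<eta>] exI[of _ d\<eta>] exI[of _ V] conjI) simp_all
  qed
  then obtain \<eta> d\<eta> V where *: "\<And>n. c1_on UNIV (\<eta> n) (d\<eta> n)" "\<And>n x. 0 \<le> \<eta> n x"
    "\<And>n x. \<eta> n x \<le> 1" "\<And>n. open (V n)" "\<And>n. \<Lambda> \<subseteq> V n" "\<And>n x. x \<in> V n \<Longrightarrow> \<eta> n x = 0"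
    "\<And>n. (\<integral>\<^sup>+x. ennreal (norm (d\<eta> n x)) \<partial>lborel) \<le> ennreal (1 / real (Suc n))"
    "\<And>n x. (\<forall>y\<in>\<Lambda>. 1 / real (Suc n) < dist x y) \<Longrightarrow> \<eta> n x = 1" by metis
  have "(\<lambda>n. \<eta> n x) \<longlonglongrightarrow> 1" if "x \<notin> \<Lambda>" for x
  proof -
    obtain e where e: "e > 0" "\<And>y. y \<in> \<Lambda> \<Longrightarrow> e \<le> dist x y"
      using separate_point_closed[OF closed_\<Lambda> \<open>x \<notin> \<Lambda>\<close>] by blast
    have "(\<lambda>n. 1 / real (Suc n)) \<longlonglongrightarrow> 0" by (rule LIMSEQ_Suc[OF lim_1_over_n])
    then have "\<forall>\<^sub>F n in sequentially. 1 / real (Suc n) < e" using e(1) by (rule order_tendstoD)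
    then have "\<forall>\<^sub>F n in sequentially. \<eta> n x = 1"
      by eventually_elim (use e(2) in \<open>force intro!: *(8)\<close>)
    then show ?thesis by (rule tendsto_eventually)
  qed
  with *(1-7) show ?thesis by (rule that)
qed

text \<open>For the weight \<open>(1 + |x|\<^sup>2)/2\<close>, which is bounded below, the flux identity bounds the area of \<open>\<Sigma>\<close>.\<close>

lemma surface_measure_finite:
  assumes dim: "DIM('b) = Suc DIM('a::euclidean_space)" and null: "hausdorff_outer_measure DIM('a) \<Lambda> = 0"
    and R: "R \<noteq> 0"
  shows "emeasure surface_measure \<Sigma> < \<infinity>"
proof -
  interpret W: weighted_problem \<Omega> \<Sigma> T \<Lambda> \<nu> u R 0 1
    by unfold_locales (simp add: weight_def)
  obtain \<eta> :: "nat \<Rightarrow> 'b \<Rightarrow> real" and d\<eta> V where \<eta>: "\<And>n. c1_on UNIV (\<eta> n) (d\<eta> n)" "\<And>n x. 0 \<le> \<eta> n x"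
    "\<And>n x. \<eta> n x \<le> 1" "\<And>n. open (V n)" "\<And>n. \<Lambda> \<subseteq> V n" "\<And>n x. x \<in> V n \<Longrightarrow> \<eta> n x = 0"
    "\<And>n. (\<integral>\<^sup>+x. ennreal (norm (d\<eta> n x)) \<partial>lborel) \<le> ennreal (1 / real (Suc n))"
    "\<And>x. x \<notin> \<Lambda> \<Longrightarrow> (\<lambda>n. \<eta> n x) \<longlonglongrightarrow> 1" by (rule cutoff_sequence[OF null dim]) blast
  have id: "integrable surface_measure (\<lambda>x. indicator \<Sigma> x * (\<eta> n x * weight 0 1 x))"
    "W.volume_flux (\<eta> n) (d\<eta> n) = R * W.surface_flux (\<eta> n)" for n
    by (rule W.flux_identity[OF dim \<eta>(1,2,4,5)], erule \<eta>(6))+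
  have "(\<lambda>n. W.volume_flux (\<eta> n) (d\<eta> n)) \<longlonglongrightarrow> (LINT x|lborel. indicator \<Omega> x * W.source x)"
    by (rule W.volume_flux_tendsto[OF \<eta>(1,2,3,7,8)])
  then have "Bseq (\<lambda>n. W.volume_flux (\<eta> n) (d\<eta> n))" by (rule convergent_imp_Bseq[OF convergentI])
  then obtain B where "\<forall>n. norm (W.volume_flux (\<eta> n) (d\<eta> n)) \<le> B" by (auto simp: Bseq_def)
  then have B: "\<And>n. \<bar>W.volume_flux (\<eta> n) (d\<eta> n)\<bar> \<le> B" by simp
  \<comment> \<open>The volume fluxes converge and are therefore bounded; dividing by
    \<open>R\<close> bounds the surface fluxes uniformly.\<close>
  have G: "W.surface_flux (\<eta> n) \<le> B / \<bar>R\<bar>" for n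
  proof -
    have "\<bar>R\<bar> * W.surface_flux (\<eta> n) \<le> \<bar>R\<bar> * \<bar>W.surface_flux (\<eta> n)\<bar>"
      by (intro mult_left_mono) auto
    also have "\<dots> \<le> B" using B[of n] unfolding id(2) by (simp only: abs_mult)
    finally have "\<bar>R\<bar> * W.surface_flux (\<eta> n) \<le> B" .
    then show ?thesis using R by (simp add: field_simps)
  qed
  let ?f = "\<lambda>n x. ennreal (indicator \<Sigma> x * (\<eta> n x * weight 0 1 x))"
  have nn: "0 \<le> indicator \<Sigma> x * (\<eta> n x * weight 0 1 x)" for n x
    using \<eta>(2)[of n x] by (simp add: weight_def)
  have fi: "(\<integral>\<^sup>+x. ?f n x \<partial>surface_measure) \<le> ennreal (B / \<bar>R\<bar>)" for n
  proof -
    have "(\<integral>\<^sup>+x. ?f n x \<partial>surface_measure) = ennreal (W.surface_flux (\<eta> n))"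
      unfolding W.surface_flux_def by (rule nn_integral_eq_integral[OF id(1)]) (use nn in auto)
    then show ?thesis using G[of n] by (simp add: ennreal_leI)
  qed
  have sets: "sets (surface_measure :: 'b measure) = sets borel" by (simp add: surface_measure_def)
  have [measurable]: "\<Sigma> \<in> sets surface_measure" by (simp add: sets)
  \<comment> \<open>Fatou's lemma: on \<Sigma>, which avoids \<Lambda>, the cutoffs tend to 1 and
    the weight is at least 1/2. Integrability of the limit is not presupposed.\<close>
  have "ennreal (1 / 2) * emeasure surface_measure \<Sigma> = (\<integral>\<^sup>+x. ennreal (1 / 2) * indicator \<Sigma> x \<partial>surface_measure)"
    by (rule nn_integral_cmult_indicator[symmetric]) simp
  also have "\<dots> \<le> (\<integral>\<^sup>+x. liminf (\<lambda>n. ?f n x) \<partial>surface_measure)"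
  proof (rule nn_integral_mono)
    fix x
    show "ennreal (1 / 2) * indicator \<Sigma> x \<le> liminf (\<lambda>n. ?f n x)"
    proof (cases "x \<in> \<Sigma>")
      case True
      then have "(\<lambda>n. \<eta> n x) \<longlonglongrightarrow> 1" using disjoint_parts(2) by (intro \<eta>(8)) auto
      then have "(\<lambda>n. indicator \<Sigma> x * (\<eta> n x * weight 0 1 x)) \<longlonglongrightarrow> indicator \<Sigma> x * (1 * weight 0 1 x)"
        by (intro tendsto_intros)
      then have "(\<lambda>n. ?f n x) \<longlonglongrightarrow> ennreal (indicator \<Sigma> x * (1 * weight 0 1 x))" by (rule tendsto_ennrealI)
      then have "liminf (\<lambda>n. ?f n x) = ennreal (weight 0 1 x)" using True by (simp add: lim_imp_Liminf)
      moreover have "ennreal (1 / 2) \<le> ennreal (weight 0 1 x)" by (rule ennreal_leI) (simp add: weight_def)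
      ultimately show ?thesis using True by simp
    qed simp
  qed
  also have "\<dots> \<le> liminf (\<lambda>n. \<integral>\<^sup>+x. ?f n x \<partial>surface_measure)"
    by (rule nn_integral_liminf) (use borel_measurable_integrable[OF id(1)] in measurable)
  also have "\<dots> \<le> liminf (\<lambda>n::nat. ennreal (B / \<bar>R\<bar>))" by (intro Liminf_mono always_eventually allI fi)
  also have "\<dots> = ennreal (B / \<bar>R\<bar>)" by (simp add: Liminf_const)
  finally have "ennreal (1 / 2) * emeasure surface_measure \<Sigma> < \<infinity>" by (rule order_le_less_trans) simp
  then show ?thesis by (auto simp: ennreal_mult_less_top)
qed

text \<open>The volume side passes to the limit without any knowledge of the area of \<Sigma>. Its
  positive limit excludes \<open>R = 0\<close>, which gives finite area, and then the indicator of
  \<Sigma> dominates the surface integrands.\<close>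

theorem linear_weight_identity:
  assumes dim: "DIM('b) = Suc DIM('a::euclidean_space)" and null: "hausdorff_outer_measure DIM('a) \<Lambda> = 0"
    and e: "norm e = 1" "\<And>x. x \<in> \<Omega> \<union> \<Sigma> \<Longrightarrow> 0 < x \<bullet> e" "\<Omega> \<noteq> {}"
  shows "emeasure surface_measure \<Sigma> < \<infinity>"
    and "R * (LINT x|surface_measure. indicator \<Sigma> x * (x \<bullet> e)) = real DIM('b) * (LINT x|lborel. indicator \<Omega> x * (x \<bullet> e))"
    and "0 < (LINT x|lborel. indicator \<Omega> x * (x \<bullet> e))"
proof -
  interpret W: weighted_problem \<Omega> \<Sigma> T \<Lambda> \<nu> u R e 0
    by unfold_locales (use e(2) in \<open>auto simp: weight_def less_imp_le\<close>)
  have we: "weight e 0 x = x \<bullet> e" for x by (simp add: weight_def)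
  have le1: "\<bar>x \<bullet> e\<bar> \<le> 1" if "x \<in> \<Omega> \<union> \<Sigma>" for x
  proof -
    have "norm x \<le> 1" using that \<Omega>_ball \<Sigma>_ball by (auto simp: less_imp_le)
    then show ?thesis using Cauchy_Schwarz_ineq2[of x e] e(1) by simp
  qed
  have i\<Omega>: "integrable lborel (\<lambda>x. indicator \<Omega> x * (x \<bullet> e))"
    by (rule integrable_on_\<Omega>) (use le1 in \<open>auto intro!: continuous_intros\<close>)
  show pos: "0 < (LINT x|lborel. indicator \<Omega> x * (x \<bullet> e))"
  proof -
    have nn: "0 \<le> indicator \<Omega> x * (x \<bullet> e)" for x using e(2)[of x] by (auto simp: indicator_def)
    have "(LINT x|lborel. indicator \<Omega> x * (x \<bullet> e)) \<noteq> 0"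
    proof
      assume "(LINT x|lborel. indicator \<Omega> x * (x \<bullet> e)) = 0"
      then have "AE x in lborel. indicator \<Omega> x * (x \<bullet> e) = 0"
        using integral_nonneg_eq_0_iff_AE[OF i\<Omega>] nn by simp
      moreover have "indicator \<Omega> x * (x \<bullet> e) \<noteq> 0" if "x \<in> \<Omega>" for x using e(2)[of x] that by auto
      ultimately have "AE x in lborel. x \<notin> \<Omega>" by (auto elim!: eventually_mono)
      then have "\<Omega> \<in> null_sets lborel" by (subst (asm) AE_iff_null_sets[symmetric]) auto
      then have "negligible \<Omega>" by (auto simp: negligible_iff_null_sets null_sets_completion_iff)
      then show False using open_not_negligible[OF open_\<Omega> e(3)] by blast
    qed
    moreover have "0 \<le> (LINT x|lborel. indicator \<Omega> x * (x \<bullet> e))" using nn by (intro integral_nonneg_AE) auto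
    ultimately show ?thesis by simp
  qed
  obtain \<eta> :: "nat \<Rightarrow> 'b \<Rightarrow> real" and d\<eta> V where \<eta>: "\<And>n. c1_on UNIV (\<eta> n) (d\<eta> n)" "\<And>n x. 0 \<le> \<eta> n x"
    "\<And>n x. \<eta> n x \<le> 1" "\<And>n. open (V n)" "\<And>n. \<Lambda> \<subseteq> V n" "\<And>n x. x \<in> V n \<Longrightarrow> \<eta> n x = 0"
    "\<And>n. (\<integral>\<^sup>+x. ennreal (norm (d\<eta> n x)) \<partial>lborel) \<le> ennreal (1 / real (Suc n))"
    "\<And>x. x \<notin> \<Lambda> \<Longrightarrow> (\<lambda>n. \<eta> n x) \<longlonglongrightarrow> 1" by (rule cutoff_sequence[OF null dim]) blast
  have id: "integrable surface_measure (\<lambda>x. indicator \<Sigma> x * (\<eta> n x * weight e 0 x))"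
    "W.volume_flux (\<eta> n) (d\<eta> n) = R * W.surface_flux (\<eta> n)" for n
    by (rule W.flux_identity[OF dim \<eta>(1,2,4,5)], erule \<eta>(6))+
  have src: "(LINT x|lborel. indicator \<Omega> x * W.source x) = real DIM('b) * (LINT x|lborel. indicator \<Omega> x * (x \<bullet> e))"
  proof -
    have "indicator \<Omega> x * W.source x = real DIM('b) * (indicator \<Omega> x * (x \<bullet> e))" for x
      by (simp add: W.source_def we)
    then show ?thesis by (simp only: Bochner_Integration.integral_mult_right_zero)
  qed
  have vt: "(\<lambda>n. R * W.surface_flux (\<eta> n)) \<longlonglongrightarrow> real DIM('b) * (LINT x|lborel. indicator \<Omega> x * (x \<bullet> e))"
  proof -
    have "(\<lambda>n. W.volume_flux (\<eta> n) (d\<eta> n)) \<longlonglongrightarrow> (LINT x|lborel. indicator \<Omega> x * W.source x)"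
      by (rule W.volume_flux_tendsto[OF \<eta>(1,2,3,7,8)])
    then show ?thesis unfolding id(2) src .
  qed
  \<comment> \<open>For \<open>R = 0\<close> all cutoff fluxes vanish, but their limit is a positive
    multiple of the positive volume integral.\<close>
  have "R \<noteq> 0"
  proof
    assume "R = 0"
    then have "real DIM('b) * (LINT x|lborel. indicator \<Omega> x * (x \<bullet> e)) = 0"
      using vt by (simp add: LIMSEQ_const_iff)
    then show False using pos by simp
  qed
  then show fin: "emeasure surface_measure \<Sigma> < \<infinity>" by (rule surface_measure_finite[OF dim null])
  have sets: "sets (surface_measure :: 'b measure) = sets borel" by (simp add: surface_measure_def)
  have \<Sigma>m: "\<Sigma> \<in> sets surface_measure" by (simp add: sets)
  have "(\<lambda>n. W.surface_flux (\<eta> n)) \<longlonglongrightarrow> (LINT x|surface_measure. indicator \<Sigma> x * (x \<bullet> e))"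
    unfolding W.surface_flux_def we
  proof (rule integral_dominated_convergence[where w = "indicator \<Sigma>"])
    show "integrable surface_measure (indicator \<Sigma> :: 'b \<Rightarrow> real)"
      using \<Sigma>m fin by (intro integrable_real_indicator) auto
    have "(\<lambda>x. indicator \<Sigma> x * (x \<bullet> e)) \<in> borel_measurable borel" by measurable
    then show "(\<lambda>x. indicator \<Sigma> x * (x \<bullet> e)) \<in> borel_measurable surface_measure"
      using measurable_cong_sets[OF sets refl] by blast
    show "(\<lambda>x. indicator \<Sigma> x * (\<eta> n x * (x \<bullet> e))) \<in> borel_measurable surface_measure" for n
      using borel_measurable_integrable[OF id(1)] by (simp add: we)
    show "AE x in surface_measure. (\<lambda>n. indicator \<Sigma> x * (\<eta> n x * (x \<bullet> e))) \<longlonglongrightarrow> indicator \<Sigma> x * (x \<bullet> e)"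
    proof (rule AE_I2)
      fix x
      show "(\<lambda>n. indicator \<Sigma> x * (\<eta> n x * (x \<bullet> e))) \<longlonglongrightarrow> indicator \<Sigma> x * (x \<bullet> e)"
      proof (cases "x \<in> \<Sigma>")
        case True
        then have "(\<lambda>n. \<eta> n x) \<longlonglongrightarrow> 1" using disjoint_parts(2) by (intro \<eta>(8)) auto
        then have "(\<lambda>n. indicator \<Sigma> x * (\<eta> n x * (x \<bullet> e))) \<longlonglongrightarrow> indicator \<Sigma> x * (1 * (x \<bullet> e))"
          by (intro tendsto_intros)
        then show ?thesis by simp
      qed simp
    qed
    show "AE x in surface_measure. norm (indicator \<Sigma> x * (\<eta> n x * (x \<bullet> e))) \<le> indicator \<Sigma> x" for n
    proof (rule AE_I2)
      fix x
      have "\<bar>\<eta> n x\<bar> * \<bar>x \<bullet> e\<bar> \<le> 1 * 1" if "x \<in> \<Sigma>"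
        using \<eta>(2,3)[of n x] le1[of x] that by (intro mult_mono) auto
      then show "norm (indicator \<Sigma> x * (\<eta> n x * (x \<bullet> e))) \<le> indicator \<Sigma> x"
        by (auto simp: indicator_def abs_mult)
    qed
  qed
  then have "(\<lambda>n. R * W.surface_flux (\<eta> n)) \<longlonglongrightarrow> R * (LINT x|surface_measure. indicator \<Sigma> x * (x \<bullet> e))"
    by (rule tendsto_mult_left)
  with vt show "R * (LINT x|surface_measure. indicator \<Sigma> x * (x \<bullet> e)) = real DIM('b) * (LINT x|lborel. indicator \<Omega> x * (x \<bullet> e))"
    using LIMSEQ_unique by blast
qed

end

text \<open>An index type with one element fewer, so that \<open>real^'n\<close> is a hyperplane extension of
  \<open>real^'n pred_index\<close>. The case distinction only keeps the type nonempty.\<close>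

typedef (overloaded) ('n::finite) pred_index = "{i::'n. CARD('n) \<ge> 2 \<longrightarrow> i \<noteq> (SOME j. True)}"
proof -
  show "\<exists>i. i \<in> {i::'n. CARD('n) \<ge> 2 \<longrightarrow> i \<noteq> (SOME j. True)}"
  proof (rule ccontr)
    assume "\<not> ?thesis"
    then have "CARD('n) \<ge> 2" "(UNIV :: 'n set) = {SOME j. True}" by auto
    then show False by (metis card.empty card.insert finite.emptyI empty_iff Suc_1 not_less_eq_eq le_refl One_nat_def)
  qed
qed

instance pred_index :: (finite) finite
proof
  have "finite (range (Rep_pred_index :: 'a pred_index \<Rightarrow> 'a))" by simp
  then show "finite (UNIV :: 'a pred_index set)"
    by (rule finite_imageD) (auto simp: inj_on_def Rep_pred_index_inject)
qed

lemma card_pred_index: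
  assumes "CARD('n::finite) \<ge> 2"
  shows "CARD('n) = Suc CARD('n pred_index)"
proof -
  have "CARD('n pred_index) = card {i::'n. CARD('n) \<ge> 2 \<longrightarrow> i \<noteq> (SOME j. True)}"
    by (rule type_definition.card[OF type_definition_pred_index])
  also have "{i::'n. CARD('n) \<ge> 2 \<longrightarrow> i \<noteq> (SOME j. True)} = UNIV - {SOME j. True}" using assms by auto
  also have "card \<dots> = CARD('n) - 1" by (simp add: card_Diff_singleton)
  finally show ?thesis using assms by simp
qed

section \<open>Centers of mass and the formula for R\<close>

text \<open>Finite measure and boundedness make the identity integrable on \<open>A\<close>, so
  taking a coordinate commutes with the vector-valued integral.\<close>

lemma center_of_mass_component:
  fixes M :: "(real^'n::finite) measure"
  assumes M: "space M = UNIV" "A \<in> sets M" "emeasure M A < \<infinity>" and A: "A \<subseteq> ball 0 1"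
    and m: "(\<lambda>x. x) \<in> borel_measurable M"
  shows "center_of_mass (restrict_space M A) $ i = (LINT x:A|M. x $ i) / measure M A"
proof -
  have "integrable (restrict_space M A) (\<lambda>x. x)"
  proof (rule integrableI_bounded_set[where A = A and B = 1])
    show "A \<in> sets (restrict_space M A)" using M by (simp add: sets_restrict_space_iff)
    show "(\<lambda>x. x) \<in> borel_measurable (restrict_space M A)" by (rule measurable_restrict_space1[OF m])
    show "emeasure (restrict_space M A) A < \<infinity>" using M by (simp add: emeasure_restrict_space)
    show "AE x in restrict_space M A. x \<in> A \<longrightarrow> norm x \<le> 1"
      using A by (intro AE_I2) (auto simp: less_imp_le)
    show "AE x in restrict_space M A. x \<notin> A \<longrightarrow> x = 0"
      by (intro AE_I2) (simp add: space_restrict_space)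
  qed
  then have "(LINT x|restrict_space M A. x) $ i = (LINT x|restrict_space M A. x $ i)"
    by (rule integral_bounded_linear[OF bounded_linear_vec_nth, symmetric])
  also have "\<dots> = (LINT x:A|M. x $ i)"
    unfolding set_lebesgue_integral_def using M by (intro integral_restrict_space) simp
  finally show ?thesis
    using M by (simp add: center_of_mass_def measure_restrict_space space_restrict_space)
qed

text \<open>Used in contraposition: a nonzero integral shows that the measure by which the center of
  mass divides is nonzero. Finiteness is assumed because \<open>measure\<close> is 0 also for sets
  of infinite measure.\<close>

lemma set_integral_measure_zero:
  fixes f :: "'a \<Rightarrow> real"
  assumes "A \<in> sets M" "emeasure M A < \<infinity>" "measure M A = 0"
  shows "(LINT x:A|M. f x) = 0"
proof -
  have "A \<in> null_sets M" using assms by (auto simp: null_sets_def emeasure_eq_ennreal_measure)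
  then have "AE x in M. x \<notin> A" by (rule AE_not_in)
  then have "AE x in M. indicator A x *\<^sub>R f x = 0" by eventually_elim simp
  then show ?thesis unfolding set_lebesgue_integral_def by (rule integral_eq_zero_AE)
qed

theorem proposition2p4:
  fixes \<Omega> \<Sigma> T \<Lambda> :: "(real^'n::finite) set"
    and n :: 'n
    and \<nu> :: "real^'n \<Rightarrow> real^'n"
    and u :: "real^'n \<Rightarrow> real"
    and R :: real
  assumes N_ge_2: "CARD('n) \<ge> 2"
    and domain: "open \<Omega>" "connected \<Omega>" "\<Omega> \<noteq> {}" "\<Omega> \<subseteq> upper_half_ball n"
    and Sigma: "smooth_submanifold (CARD('n) - 1) \<Sigma>" "\<Sigma> \<subseteq> upper_half_ball n"
    and T: "T = frontier \<Omega> - closure \<Sigma>" "T \<subseteq> sphere 0 1"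
    and boundary: "frontier \<Omega> = closure \<Sigma> \<union> T"
    and Lambda: "\<Lambda> = closure \<Sigma> \<inter> closure T" "smooth_submanifold (CARD('n) - 2) \<Lambda>"
      "closure \<Sigma> = \<Sigma> \<union> \<Lambda>"
    and normal: "\<And>x. x \<in> \<Sigma> \<union> T \<Longrightarrow> outward_unit_normal \<Omega> x (\<nu> x)"
    and regularity: "smooth_on (closure \<Omega> - \<Lambda>) u" "\<exists>\<gamma>\<in>{0<..<1}. holder_on \<gamma> (closure \<Omega>) u"
    and sobolev: "sobolev_space 1 \<infinity> \<Omega> u" "sobolev_space 2 2 \<Omega> u"
    and equation: "\<And>x. x \<in> \<Omega> \<Longrightarrow> laplacian u x = real CARD('n)"
    and dirichlet: "\<And>x. x \<in> \<Sigma> \<Longrightarrow> u x = 0"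
    and robin: "\<And>x. x \<in> T \<Longrightarrow> has_normal_derivative u x (\<nu> x) (u x)"
    and overdetermined: "\<And>x. x \<in> \<Sigma> \<Longrightarrow> has_normal_derivative u x (\<nu> x) R"
  shows "R = real CARD('n) * ((LINT x:\<Omega>|lebesgue. x $ n) / (LINT x:\<Sigma>|surface_measure. x $ n)) \<and>
    real CARD('n) * ((LINT x:\<Omega>|lebesgue. x $ n) / (LINT x:\<Sigma>|surface_measure. x $ n)) =
      real CARD('n) * measure lebesgue \<Omega> / measure surface_measure \<Sigma> *
      (center_of_mass (lebesgue_on \<Omega>) $ n / center_of_mass (restrict_space surface_measure \<Sigma>) $ n)"
proof -
  have \<Omega>b: "\<Omega> \<subseteq> ball 0 1" and \<Sigma>b: "\<Sigma> \<subseteq> ball 0 1" and pos: "\<And>x. x \<in> \<Omega> \<union> \<Sigma> \<Longrightarrow> 0 < x $ n"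
    using domain(4) Sigma(2) by (auto simp: upper_half_ball_def)
  have \<Omega>bd: "bounded \<Omega>" using \<Omega>b bounded_ball bounded_subset by blast
  have \<Omega>\<Lambda>: "\<Omega> \<subseteq> closure \<Omega> - \<Lambda>"
  proof -
    have "\<Lambda> \<subseteq> frontier \<Omega>" using boundary Lambda(3) by blast
    moreover have "frontier \<Omega> = closure \<Omega> - \<Omega>" using domain(1) by (simp add: frontier_def interior_open)
    moreover have "\<Omega> \<subseteq> closure \<Omega>" by (rule closure_subset)
    ultimately show ?thesis by blast
  qed
  have c1: "c1_on \<Omega> u (grad u)"
    by (rule smooth_on_open_c1[OF domain(1) smooth_on_subset[OF regularity(1) \<Omega>\<Lambda>]])
  have bounded_u: "\<exists>C. \<forall>x\<in>\<Omega>. \<bar>u x\<bar> \<le> C"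
  proof -
    obtain \<gamma> C where \<gamma>: "0 < \<gamma>" and C: "\<forall>x\<in>closure \<Omega>. \<forall>y\<in>closure \<Omega>. \<bar>u x - u y\<bar> \<le> C * dist x y powr \<gamma>"
      using regularity(2) by (auto simp: holder_on_def)
    obtain p where p: "p \<in> \<Omega>" using domain(3) by blast
    have "\<bar>u x\<bar> \<le> \<bar>u p\<bar> + \<bar>C\<bar> * 2 powr \<gamma>" if x: "x \<in> \<Omega>" for x
    proof -
      have "\<bar>u x - u p\<bar> \<le> C * dist x p powr \<gamma>" using C x p closure_subset by blast
      also have "\<dots> \<le> \<bar>C\<bar> * 2 powr \<gamma>"
      proof (intro mult_mono powr_mono2)
        have "norm x < 1" "norm p < 1" using x p \<Omega>b by auto
        then show "dist x p \<le> 2" using norm_triangle_ineq4[of x p] by (simp add: dist_norm)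
      qed (use \<gamma> in auto)
      finally show ?thesis by linarith
    qed
    then show ?thesis by blast
  qed
  \<comment> \<open>Each classical partial derivative is bounded by the essential bound of the weak
    one; the norm is then bounded by the sum over the basis.\<close>
  have bounded_grad: "\<exists>C. \<forall>x\<in>\<Omega>. norm (grad u x) \<le> C"
  proof -
    have "\<exists>C. \<forall>x\<in>\<Omega>. \<bar>grad u x \<bullet> e\<bar> \<le> C" if e: "e \<in> Basis" for e
    proof -
      obtain g where "weak_derivative \<Omega> e u g" "Lp_space \<infinity> \<Omega> g"
        using sobolev(1) e by auto
      then show ?thesis by (rule weak_derivative_bound[OF domain(1) \<Omega>bd c1])
    qed
    then obtain C where C: "\<And>e x. e \<in> Basis \<Longrightarrow> x \<in> \<Omega> \<Longrightarrow> \<bar>grad u x \<bullet> e\<bar> \<le> C e" by metis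
    have "norm (grad u x) \<le> (\<Sum>e\<in>Basis. C e)" if "x \<in> \<Omega>" for x
      using norm_le_l1[of "grad u x"] sum_mono[of Basis "\<lambda>e. \<bar>grad u x \<bullet> e\<bar>" C] C that by fastforce
    then show ?thesis by blast
  qed
  interpret mixed_problem \<Omega> \<Sigma> T \<Lambda> \<nu> u R
  proof
    show "laplacian u x = real DIM(real^'n)" if "x \<in> \<Omega>" for x using equation[OF that] by simp
  qed (fact domain(1) \<Omega>b \<Sigma>b T boundary Lambda(1,3) normal regularity(1) dirichlet robin overdetermined
      bounded_u bounded_grad)+
  have dim: "DIM(real^'n) = Suc DIM(real^('n pred_index))"
    using card_pred_index[OF N_ge_2] by simp
  \<comment> \<open>The edge has dimension \<open>CARD('n) - 2\<close>, and
    \<open>CARD('n) \<ge> 2\<close> makes this smaller than the dimension of the surface measure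
    also with truncated subtraction.\<close>
  have null: "hausdorff_outer_measure DIM(real^('n pred_index)) \<Lambda> = 0"
    by (rule hausdorff_null_submanifold[OF Lambda(2) compact_\<Lambda>])
      (use card_pred_index[OF N_ge_2] N_ge_2 in simp)
  let ?e = "axis n 1 :: real^'n"
  have xe: "x \<bullet> ?e = x $ n" for x by (simp add: inner_axis)
  have e: "norm ?e = 1" by simp
  note main = linear_weight_identity[OF dim null e _ domain(3), unfolded xe, OF pos]
  let ?H = "surface_measure :: (real^'n) measure"
  define I\<Omega> where "I\<Omega> = (LINT x:\<Omega>|lebesgue. x $ n)"
  define I\<Sigma> where "I\<Sigma> = (LINT x:\<Sigma>|?H. x $ n)"
  have I\<Omega>: "(LINT x|lborel. indicator \<Omega> x * x $ n) = I\<Omega>"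
  proof -
    have "(\<lambda>x::real^'n. indicator \<Omega> x * x $ n) \<in> borel_measurable lborel" by measurable
    from integral_completion[OF this] show ?thesis by (simp add: I\<Omega>_def set_lebesgue_integral_def)
  qed
  have I\<Sigma>: "(LINT x|?H. indicator \<Sigma> x * x $ n) = I\<Sigma>" by (simp add: I\<Sigma>_def set_lebesgue_integral_def)
  have id: "R * I\<Sigma> = real CARD('n) * I\<Omega>" "0 < I\<Omega>" using main(2,3) unfolding I\<Omega> I\<Sigma> by simp_all
  \<comment> \<open>The positive volume side excludes a zero denominator, so the quotients in the
    claim are genuine and not the default value of division by 0.\<close>
  then have I\<Sigma>0: "I\<Sigma> \<noteq> 0" by auto
  have setsH: "sets ?H = sets borel" "space ?H = UNIV" by (simp_all add: surface_measure_def)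
  have \<Sigma>H: "\<Sigma> \<in> sets ?H" by (simp add: setsH)
  have \<Omega>L: "\<Omega> \<in> sets lebesgue" "emeasure lebesgue \<Omega> < \<infinity>"
    using lmeasurable_open[OF \<Omega>bd domain(1)] by (auto simp: fmeasurable_def)
  have m\<Sigma>: "measure ?H \<Sigma> \<noteq> 0"
    using set_integral_measure_zero[OF \<Sigma>H main(1)] I\<Sigma>0 by (auto simp: I\<Sigma>_def)
  have m\<Omega>: "measure lebesgue \<Omega> \<noteq> 0"
    using set_integral_measure_zero[OF \<Omega>L] id(2) by (auto simp: I\<Omega>_def)
  have "(\<lambda>x. x) \<in> borel_measurable ?H"
    by (subst measurable_cong_sets[OF setsH(1) refl]) simp
  then have c\<Sigma>: "center_of_mass (restrict_space ?H \<Sigma>) $ n = I\<Sigma> / measure ?H \<Sigma>"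
    unfolding I\<Sigma>_def by (intro center_of_mass_component setsH(2) \<Sigma>H main(1) \<Sigma>b)
  have "(\<lambda>x::real^'n. x) \<in> borel_measurable lebesgue" by (rule measurable_completion) simp
  then have c\<Omega>: "center_of_mass (lebesgue_on \<Omega>) $ n = I\<Omega> / measure lebesgue \<Omega>"
    unfolding I\<Omega>_def by (intro center_of_mass_component \<Omega>L \<Omega>b) auto
  have "R = real CARD('n) * (I\<Omega> / I\<Sigma>)" using id(1) I\<Sigma>0 by (simp add: field_simps)
  moreover have "real CARD('n) * (I\<Omega> / I\<Sigma>) = real CARD('n) * measure lebesgue \<Omega> / measure ?H \<Sigma> *
      ((I\<Omega> / measure lebesgue \<Omega>) / (I\<Sigma> / measure ?H \<Sigma>))"
    using m\<Sigma> m\<Omega> by simp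
  ultimately show ?thesis unfolding c\<Sigma> c\<Omega> I\<Omega>_def I\<Sigma>_def by blast
qed

end
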